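(* Let $(V,F)$ be an $n$-dimensional Randers–Minkowski space with the Busemann–Hausdorff (resp. Holmes–Thompson) volume form $d\mu$. Then any isoparametric hypersurface in $(V,F,d\mu)$ has at most two distinct principal curvatures, and it must be either a hyperplane, a Minkowski hypersphere or reverse Minkowski hypersphere $\hat S^{n-1}_{F_\pm}(r)$, or an $F^*$-Minkowski cylinder or reverse $F^*$-Minkowski cylinder $\hat S^{m-1}_{\tilde F_\pm}(r)\times\mathbb R^{n-m}$.
   Context: Randers–Minkowski space. $V$ is an $n$-dimensional real vector space and $F=\alpha+\beta$, where $\alpha(y)=\sqrt{a_{ij}y^iy^j}$ is a Euclidean norm and $\beta(y)=b_iy^i$ a linear form with $b=\|\beta\|_\alpha<1$. Then $F:V\to[0,\infty)$ is smooth on $V\setminus\{0\}$, positively $1$-homogeneous, and $g_{ij}(y)=\frac12[F^2]_{y^iy^j}$ is positive definite; $V$ is viewed as a Finsler manifold with $F(x,y)=F(y)$, $y\in T_xV=V$. The Busemann–Hausdorff volume form has density $\sigma=\mathrm{vol}(\mathbb B^n)/\mathrm{vol}\{y:F(y)<1\}$ and the Holmes–Thompson one $\sigma=\frac1{\mathrm{vol}(\mathbb B^n)}\int_{\{F(y)<1\}}\det(g_{ij}(y))\,dy$ (both constant in linear coordinates). The dual metric is $F^*(\xi)=\sup_{y\neq0}\xi(y)/F(y)$ on $V^*$. Gradient and Laplacian. Legendre transformation: $\mathcal L(y)=F(y)[F]_{y^i}(y)dx^i$, $\mathcal L(0)=0$; $\nabla f=\mathcal L^{-1}(df)$; for $d\mu=\sigma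 dx$, $\Delta f=\operatorname{div}\nabla f=\frac1\sigma\partial_{x^i}(\sigma(\nabla f)^i)$. Isoparametric. Let $f$ be a non-constant continuous function on $V$, smooth on $V\setminus S$ with $S$ closed of measure zero; $M_f=\{x\in V\setminus S:df(x)\ne0\}$, $J=f(M_f)$. $f$ is isoparametric if there are a smooth $\tilde a$ and a continuous $\tilde b$ on $J$ with $F(\nabla f)=\tilde a(f)$ and $\Delta f=\tilde b(f)$ on $M_f$. The regular level surfaces $N_t=f^{-1}(t)$ are called isoparametric hypersurfaces. Their principal curvatures are the eigenvalues of $X\mapsto-D_X\mathbf n$ on $TN_t$, where $\mathbf n=\nabla f/F(\nabla f)$ and $D$ is the ordinary derivative in $V$. Special hypersurfaces. $\hat S^{n-1}_{F_+}(r)$ is the Minkowski hypersphere $\{F(x-x_0)=r\}$ and $\hat S^{n-1}_{F_-}(r)$ the reverse Minkowski hypersphere $\{F(x_0-x)=r\}$, $r>0$. $F^*$-Minkowski cylinders: fix a Euclidean inner product identifying $V$ with $V^*$; let $2\le m\le n-1$, let $\bar V\subset V$ be an $m$-dimensional subspace and $\bar V^*\subset V^*$ the corresponding $m$-dimensional subspace, so in suitable orthonormal coordinates $\bar V=\{(x^1,\dots,x^m,0,\dots,0)\}$, $\bar V^*=\{(\xi_1,\dots,\xi_m,0,\dots,0)\}$. Let $\tilde F(\bar y)=\sup_{\bar\xi\in\bar V^*\setminus0}\bar\xi(\bar y)/F^*(\bar\xi)$, $\bar y\in\bar V$, the dual metric of $F^*|_{\bar V^*}$. For $x=(x^1,\dots,x^n)$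 write $\bar x=(x^1,\dots,x^m,0,\dots,0)$. Then $\hat S^{m-1}_{\tilde F_\pm}(r)\times\mathbb R^{n-m}=\{x\in V:\tilde F(\pm(\bar x-\bar x_0))=r\}$, $\bar x_0\in\bar V$; sign $+$ is the $F^*$-Minkowski cylinder, sign $-$ the reverse one.
   Formalization: An isoparametric hypersurface here is a connected component of the regular part of a level set (a whole level set may be several spheres); it is shown to be a relatively open piece of one of the listed models, and all of it when closed, as for components of regular levels. *)

theory Defs
  imports "HOL-Analysis.Analysis"
begin

text \<open>
  The \<open>n\<close>-dimensional space \<open>V\<close> is \<open>real ^ 'n\<close>, in linear coordinates; covectors are
  represented by their coordinates \<open>\<xi>\<^sub>i\<close>, so that \<open>\<xi>(y) = \<xi> \<bullet> y\<close>.
\<close>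

text \<open>Meant for open sets \<open>U\<close> (all derivatives are taken in the ambient space).\<close>

primrec times_differentiable_on ::
  "nat \<Rightarrow> 'a set \<Rightarrow> ('a::real_normed_vector \<Rightarrow> 'b::real_normed_vector) \<Rightarrow> bool" where
  "times_differentiable_on 0 U f \<longleftrightarrow> continuous_on U f"
| "times_differentiable_on (Suc k) U f \<longleftrightarrow>
     (\<forall>x\<in>U. f differentiable (at x)) \<and>
     (\<forall>v. times_differentiable_on k U (\<lambda>x. frechet_derivative f (at x) v))"

definition smooth_on :: "'a set \<Rightarrow> ('a::real_normed_vector \<Rightarrow> 'b::real_normed_vector) \<Rightarrow> bool" where
  "smooth_on U f \<longleftrightarrow> (\<forall>k. times_differentiable_on k U f)"

definition partial_deriv :: "'n \<Rightarrow> (real ^ 'n::finite \<Rightarrow> real) \<Rightarrow> real ^ 'n \<Rightarrow> real" where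
  "partial_deriv i h x = frechet_derivative h (at x) (axis i 1)"

definition differential :: "(real ^ 'n::finite \<Rightarrow> real) \<Rightarrow> real ^ 'n \<Rightarrow> real ^ 'n" where
  "differential h x = (\<chi> i. partial_deriv i h x)"

definition alpha_norm :: "real ^ 'n ^ 'n \<Rightarrow> real ^ 'n::finite \<Rightarrow> real" where
  "alpha_norm a y = sqrt (\<Sum>i\<in>UNIV. \<Sum>j\<in>UNIV. a $ i $ j * y $ i * y $ j)"

definition beta_form :: "real ^ 'n \<Rightarrow> real ^ 'n::finite \<Rightarrow> real" where
  "beta_form b y = (\<Sum>i\<in>UNIV. b $ i * y $ i)"

definition randers_norm :: "real ^ 'n ^ 'n \<Rightarrow> real ^ 'n \<Rightarrow> real ^ 'n::finite \<Rightarrow> real" where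
  "randers_norm a b y = alpha_norm a y + beta_form b y"

definition randers_minkowski :: "real ^ 'n ^ 'n \<Rightarrow> real ^ 'n::finite \<Rightarrow> bool" where
  "randers_minkowski a b \<longleftrightarrow>
     transpose a = a \<and>
     (\<forall>y. y \<noteq> 0 \<longrightarrow> (\<Sum>i\<in>UNIV. \<Sum>j\<in>UNIV. a $ i $ j * y $ i * y $ j) > 0) \<and>
     (SUP y\<in>- {0}. \<bar>beta_form b y\<bar> / alpha_norm a y) < 1"

definition fundamental_tensor :: "(real ^ 'n::finite \<Rightarrow> real) \<Rightarrow> real ^ 'n \<Rightarrow> real ^ 'n ^ 'n" where
  "fundamental_tensor F y =
     (\<chi> i j. 1 / 2 * partial_deriv j (partial_deriv i (\<lambda>z. (F z)\<^sup>2)) y)"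

definition busemann_hausdorff :: "(real ^ 'n::finite \<Rightarrow> real) \<Rightarrow> real" where
  "busemann_hausdorff F =
     measure lborel (ball 0 1 :: (real ^ 'n) set) / measure lborel {y. F y < 1}"

definition holmes_thompson :: "(real ^ 'n::finite \<Rightarrow> real) \<Rightarrow> real" where
  "holmes_thompson F =
     1 / measure lborel (ball 0 1 :: (real ^ 'n) set) *
     (LINT y:{y. F y < 1}|lborel. det (fundamental_tensor F y))"

definition dual_metric :: "(real ^ 'n::finite \<Rightarrow> real) \<Rightarrow> real ^ 'n \<Rightarrow> real" where
  "dual_metric F \<xi> = (SUP y\<in>- {0}. (\<xi> \<bullet> y) / F y)"

definition legendre :: "(real ^ 'n::finite \<Rightarrow> real) \<Rightarrow> real ^ 'n \<Rightarrow> real ^ 'n" where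
  "legendre F y = (if y = 0 then 0 else F y *\<^sub>R differential F y)"

definition gradient :: "(real ^ 'n::finite \<Rightarrow> real) \<Rightarrow> (real ^ 'n \<Rightarrow> real) \<Rightarrow> real ^ 'n \<Rightarrow> real ^ 'n" where
  "gradient F f x = inv (legendre F) (differential f x)"

definition divergence :: "real \<Rightarrow> (real ^ 'n::finite \<Rightarrow> real ^ 'n) \<Rightarrow> real ^ 'n \<Rightarrow> real" where
  "divergence \<sigma> X x = 1 / \<sigma> * (\<Sum>i\<in>UNIV. partial_deriv i (\<lambda>z. \<sigma> * X z $ i) x)"

definition laplacian ::
  "(real ^ 'n::finite \<Rightarrow> real) \<Rightarrow> real \<Rightarrow> (real ^ 'n \<Rightarrow> real) \<Rightarrow> real ^ 'n \<Rightarrow> real" where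
  "laplacian F \<sigma> f = divergence \<sigma> (gradient F f)"

definition regular_set :: "(real ^ 'n::finite \<Rightarrow> real) \<Rightarrow> (real ^ 'n) set \<Rightarrow> (real ^ 'n) set" where
  "regular_set f S = {x. x \<notin> S \<and> differential f x \<noteq> 0}"

definition isoparametric ::
  "(real ^ 'n::finite \<Rightarrow> real) \<Rightarrow> real \<Rightarrow> (real ^ 'n \<Rightarrow> real) \<Rightarrow> (real ^ 'n) set \<Rightarrow> bool" where
  "isoparametric F \<sigma> f S \<longleftrightarrow>
     continuous_on UNIV f \<and> \<not> f constant_on UNIV \<and>
     closed S \<and> S \<in> null_sets lborel \<and> smooth_on (- S) f \<and>
     (\<exists>a b. smooth_on (f ` regular_set f S) a \<and> continuous_on (f ` regular_set f S) b \<and>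
        (\<forall>x\<in>regular_set f S. F (gradient F f x) = a (f x) \<and> laplacian F \<sigma> f x = b (f x)))"

text \<open>
  Isoparametric hypersurfaces are understood to be connected, and to consist of regular points: a
  level set of an isoparametric function may have several components, and it may run into \<open>S\<close>
  or into critical points (the Euclidean function \<open>max x\<^sub>1 x\<^sub>2\<close> is isoparametric with \<open>S\<close> the
  diagonal, and its level sets are bent along \<open>S\<close>). The components of a level set all of whose
  points are regular are closed, see \<open>closed_isoparametric_hypersurface\<close> below.
\<close>

definition isoparametric_hypersurface ::
  "(real ^ 'n::finite \<Rightarrow> real) \<Rightarrow> real \<Rightarrow> (real ^ 'n \<Rightarrow> real) \<Rightarrow> (real ^ 'n) set \<Rightarrow> (real ^ 'n) set \<Rightarrow> bool"
  where
  "isoparametric_hypersurface F \<sigma> f S N \<longleftrightarrow>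
     isoparametric F \<sigma> f S \<and> (\<exists>t. N \<in> components (f -` {t} \<inter> regular_set f S))"

lemma closed_isoparametric_hypersurface:
  assumes "isoparametric F \<sigma> f S" and "f -` {t} \<subseteq> regular_set f S"
    and "N \<in> components (f -` {t} \<inter> regular_set f S)"
  shows "closed N"
proof -
  have "closed (f -` {t})"
    using assms(1) by (intro continuous_closed_vimage)
      (auto simp: isoparametric_def continuous_on_eq_continuous_at)
  moreover have "f -` {t} \<inter> regular_set f S = f -` {t}"
    using assms(2) by auto
  ultimately show ?thesis
    using assms(3) closed_components by metis
qed

definition unit_normal :: "(real ^ 'n::finite \<Rightarrow> real) \<Rightarrow> (real ^ 'n \<Rightarrow> real) \<Rightarrow> real ^ 'n \<Rightarrow> real ^ 'n" where
  "unit_normal F f x = (1 / F (gradient F f x)) *\<^sub>R gradient F f x"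

text \<open>The tangent space at \<open>x\<close> of the level surface through \<open>x\<close> is the kernel of \<open>df\<close> at \<open>x\<close>.\<close>

definition principal_curvature ::
  "(real ^ 'n::finite \<Rightarrow> real) \<Rightarrow> (real ^ 'n \<Rightarrow> real) \<Rightarrow> real ^ 'n \<Rightarrow> real \<Rightarrow> bool" where
  "principal_curvature F f x \<kappa> \<longleftrightarrow>
     (\<exists>X. X \<noteq> 0 \<and> differential f x \<bullet> X = 0 \<and>
          - frechet_derivative (unit_normal F f) (at x) X = \<kappa> *\<^sub>R X)"

definition is_hyperplane :: "(real ^ 'n::finite) set \<Rightarrow> bool" where
  "is_hyperplane M \<longleftrightarrow> (\<exists>c d. c \<noteq> 0 \<and> M = {x. c \<bullet> x = d})"

definition is_minkowski_hypersphere ::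
  "(real ^ 'n::finite \<Rightarrow> real) \<Rightarrow> (real ^ 'n) set \<Rightarrow> bool" where
  "is_minkowski_hypersphere F M \<longleftrightarrow> (\<exists>x0 r. r > 0 \<and> M = {x. F (x - x0) = r})"

definition is_reverse_minkowski_hypersphere ::
  "(real ^ 'n::finite \<Rightarrow> real) \<Rightarrow> (real ^ 'n) set \<Rightarrow> bool" where
  "is_reverse_minkowski_hypersphere F M \<longleftrightarrow> (\<exists>x0 r. r > 0 \<and> M = {x. F (x0 - x) = r})"

text \<open>
  The cylinders over an \<open>m\<close>-dimensional subspace \<open>W\<close> use the inner product of \<open>real ^ 'n\<close>. Another
  choice of inner product yields the same family of cylinders: in terms of the subspace \<open>W\<^sup>*\<close> of the
  dual space, they are the sets of all \<open>x\<close> at which the supremum of \<open>\<xi> (\<plusminus>(x - x\<^sub>0)) / F\<^sup>* \<xi>\<close> over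
  nonzero \<open>\<xi>\<close> in \<open>W\<^sup>*\<close> equals \<open>r\<close>.
\<close>

definition orth_proj :: "(real ^ 'n::finite) set \<Rightarrow> real ^ 'n \<Rightarrow> real ^ 'n" where
  "orth_proj W x = (THE p. p \<in> W \<and> (\<forall>w\<in>W. orthogonal (x - p) w))"

definition dual_of_restricted_dual ::
  "(real ^ 'n::finite \<Rightarrow> real) \<Rightarrow> (real ^ 'n) set \<Rightarrow> real ^ 'n \<Rightarrow> real" where
  "dual_of_restricted_dual F W y = (SUP \<xi>\<in>W - {0}. (\<xi> \<bullet> y) / dual_metric F \<xi>)"

definition is_dual_minkowski_cylinder ::
  "(real ^ 'n::finite \<Rightarrow> real) \<Rightarrow> (real ^ 'n) set \<Rightarrow> bool" where
  "is_dual_minkowski_cylinder F M \<longleftrightarrow>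
     (\<exists>W x0 r. subspace W \<and> 2 \<le> dim W \<and> dim W \<le> CARD('n) - 1 \<and> x0 \<in> W \<and> r > 0 \<and>
        M = {x. dual_of_restricted_dual F W (orth_proj W x - x0) = r})"

definition is_reverse_dual_minkowski_cylinder ::
  "(real ^ 'n::finite \<Rightarrow> real) \<Rightarrow> (real ^ 'n) set \<Rightarrow> bool" where
  "is_reverse_dual_minkowski_cylinder F M \<longleftrightarrow>
     (\<exists>W x0 r. subspace W \<and> 2 \<le> dim W \<and> dim W \<le> CARD('n) - 1 \<and> x0 \<in> W \<and> r > 0 \<and>
        M = {x. dual_of_restricted_dual F W (x0 - orth_proj W x) = r})"

end

theory Submission
  imports Defs
begin

text \<open>
  The unit ball of a Randers norm is an ellipsoid, that is \<open>{w + C u | \<bar>u\<bar> < 1}\<close> for an invertible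
  \<open>C\<close> and a vector \<open>w\<close>, so that \<open>F\<^sup>*(\<xi>) = \<bar>C\<^sup>T \<xi>\<bar> + \<xi>(w)\<close>. If \<open>f\<close> is isoparametric and \<open>\<nu>\<close> is the
  direction of \<open>C\<^sup>T df\<close>, then \<open>\<nabla>f / F(\<nabla>f) = w + C \<nu>\<close>, and in the moving frame
  \<open>E\<^sub>k = \<partial>\<^bsub>C e\<^sub>k\<^esub> + \<nu>\<^sub>k \<partial>\<^sub>w\<close>, which follows the drift by the wind \<open>w\<close>, everything looks Euclidean: the \<open>E\<^sub>k\<close>
  commute, \<open>A\<^sub>k\<^sub>l = E\<^sub>k \<nu>\<^sub>l\<close> is symmetric with \<open>A \<nu> = 0\<close>, and \<open>tr A\<close> is a function of \<open>f\<close> because both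
  volume forms have constant density. Hence every \<open>tr A\<^sup>k\<close> has a gradient proportional to \<open>\<nu>\<close>.

  For such a frame, computing the Laplacian of \<open>tr A\<^sup>2\<close> in two ways gives
  \<open>\<bar>T\<bar>\<^sup>2 = (tr A\<^sup>2)\<^sup>2 - tr A tr A\<^sup>3\<close>, where \<open>T\<close> is the tangential part of the derivative of \<open>A\<close>. If all
  eigenvalues of \<open>A\<close> are nonnegative, the right-hand side is at most \<open>0\<close>, so that all nonzero eigenvalues
  coincide. The general case reduces to this one by passing to the parallel surfaces at a large distance
  \<open>s\<close>: the frame \<open>(I + s A)\<^sup>-\<^sup>1 E\<close> has the shape operator \<open>(I + s A)\<^sup>-\<^sup>1 A\<close>, whose eigenvalues
  \<open>\<lambda> / (1 + s \<lambda>)\<close> are nonnegative for large \<open>s\<close>. No Cartan formula and no focal set is needed.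

  Consequently \<open>A\<^sup>2 = \<lambda> A\<close> and \<open>T = 0\<close>. If \<open>\<lambda> = 0\<close>, then \<open>\<nu>\<close> is locally constant and the level set lies in a
  hyperplane; otherwise the projection \<open>Q = A / \<lambda> + \<nu> \<nu>\<^sup>T\<close> is locally constant, as is the centre
  \<open>Q C\<^sup>-\<^sup>1 x - \<nu> / \<lambda>\<close> along the level set, which is therefore an open part of a round cylinder in the
  metric given by \<open>C\<close>. The ellipsoidal cylinders so obtained are exactly the (dual) Minkowski ones.
\<close>

subsection \<open>Smooth functions\<close>

text \<open>The wind \<open>w\<close> could spoil the Euclidean picture: the bracket of two frame
  fields is the antisymmetric part of \<open>A\<close> times the derivative along \<open>w\<close>.
  Testing this on \<open>f\<close>, whose frame derivatives are the speed times \<nu> with the speed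
  a function of \<open>f\<close>, shows that the antisymmetric part vanishes. Knowing that
  \<open>tr A\<close> is a function of \<open>f\<close> does not yet allow the chain rule, because
  that function need not be differentiable; an open mapping argument takes its place. The identity
  for \<open>T\<close> says something only if
  \<open>(tr A\<^sup>2)\<^sup>2 - tr A tr A\<^sup>3\<close> has a sign. Up to a negative factor it
  is the sum of all \<open>\<lambda>\<^sub>i \<lambda>\<^sub>j (\<lambda>\<^sub>i -
  \<lambda>\<^sub>j)\<^sup>2\<close>, which eigenvalues of mixed sign leave undecided. As
  \<open>\<lambda> / (1 + s \<lambda>)\<close> is injective in \<lambda>, equality of the shifted
  nonzero eigenvalues returns equality of the original ones. A component of the regular part of a
  level set may be cut off by \<open>S\<close> or by critical points. The local models are therefore
  glued along the component only: it is an open piece of one model, and the whole model once it is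
  closed.\<close>

lemma times_differentiable_on_cong:
  assumes "open U" "times_differentiable_on k U f" "\<And>x. x \<in> U \<Longrightarrow> f x = g x"
  shows "times_differentiable_on k U g"
  using assms(2,3)
proof (induction k arbitrary: f g)
  case 0
  then show ?case by (simp cong: continuous_on_cong)
next
  case (Suc k)
  have d: "(g has_derivative frechet_derivative f (at x)) (at x)" if "x \<in> U" for x
  proof (rule has_derivative_transform_within_open[OF _ assms(1) that])
    show "(f has_derivative frechet_derivative f (at x)) (at x)"
      using Suc.prems that by (simp add: frechet_derivative_works[symmetric])
  qed (use Suc.prems in auto)
  then have e: "frechet_derivative g (at x) = frechet_derivative f (at x)" if "x \<in> U" for x
    using frechet_derivative_at that by metis
  have "times_differentiable_on k U (\<lambda>x. frechet_derivative g (at x) v)" for v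
    by (rule Suc.IH[where f = "\<lambda>x. frechet_derivative f (at x) v"]) (use Suc.prems e in auto)
  then show ?case using d by (auto simp: differentiable_def)
qed

lemma times_differentiable_on_SucD:
  "times_differentiable_on (Suc k) U f \<Longrightarrow> times_differentiable_on k U f"
proof (induction k arbitrary: f)
  case 0
  then show ?case
    by (simp add: differentiable_imp_continuous_within continuous_at_imp_continuous_on)
next
  case (Suc k)
  then show ?case by (metis times_differentiable_on.simps(2))
qed

lemma times_differentiable_on_subset:
  "times_differentiable_on k U f \<Longrightarrow> T \<subseteq> U \<Longrightarrow> times_differentiable_on k T f"
  by (induction k arbitrary: f) (auto intro: continuous_on_subset)

lemma times_differentiable_on_SucI:
  assumes "open U" "\<And>x. x \<in> U \<Longrightarrow> (f has_derivative f' x) (at x)"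
    "\<And>v. times_differentiable_on k U (\<lambda>x. f' x v)"
  shows "times_differentiable_on (Suc k) U f"
proof -
  have "times_differentiable_on k U (\<lambda>x. frechet_derivative f (at x) v)" for v
    by (rule times_differentiable_on_cong[OF assms(1) assms(3)[of v]])
      (use assms(2) frechet_derivative_at in metis)
  then show ?thesis using assms(2) by (auto simp: differentiable_def)
qed

lemma times_differentiable_on_SucE:
  assumes "times_differentiable_on (Suc k) U f"
  shows "\<exists>f'. (\<forall>x\<in>U. (f has_derivative f' x) (at x)) \<and>
    (\<forall>v. times_differentiable_on k U (\<lambda>x. f' x v))"
  using assms by (intro exI[of _ "\<lambda>x. frechet_derivative f (at x)"])
    (auto simp: frechet_derivative_works[symmetric])

lemma times_differentiable_on_const: "open U \<Longrightarrow> times_differentiable_on k U (\<lambda>x. c)"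
  by (induction k arbitrary: c) auto

lemma times_differentiable_on_linear:
  assumes "open U" "bounded_linear L" "times_differentiable_on k U f"
  shows "times_differentiable_on k U (\<lambda>x. L (f x))"
  using assms(3)
proof (induction k arbitrary: f)
  case 0
  then show ?case using assms(2) by (auto intro: bounded_linear.continuous_on)
next
  case (Suc k)
  obtain f' where *: "\<And>x. x \<in> U \<Longrightarrow> (f has_derivative f' x) (at x)"
    "\<And>v. times_differentiable_on k U (\<lambda>x. f' x v)"
    using times_differentiable_on_SucE[OF Suc.prems] by blast
  show ?case
    by (rule times_differentiable_on_SucI[OF assms(1), where f' = "\<lambda>x v. L (f' x v)"])
      (use * Suc.IH assms(2) in \<open>auto intro: bounded_linear.has_derivative\<close>)
qed

lemma times_differentiable_on_add:
  assumes "open U" "times_differentiable_on k U f" "times_differentiable_on k U g"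
  shows "times_differentiable_on k U (\<lambda>x. f x + g x)"
  using assms(2,3)
proof (induction k arbitrary: f g)
  case 0
  then show ?case by (auto intro: continuous_intros)
next
  case (Suc k)
  obtain f' where f: "\<And>x. x \<in> U \<Longrightarrow> (f has_derivative f' x) (at x)"
    "\<And>v. times_differentiable_on k U (\<lambda>x. f' x v)"
    using times_differentiable_on_SucE[OF Suc.prems(1)] by blast
  obtain g' where g: "\<And>x. x \<in> U \<Longrightarrow> (g has_derivative g' x) (at x)"
    "\<And>v. times_differentiable_on k U (\<lambda>x. g' x v)"
    using times_differentiable_on_SucE[OF Suc.prems(2)] by blast
  show ?case
    by (rule times_differentiable_on_SucI[OF assms(1), where f' = "\<lambda>x v. f' x v + g' x v"])
      (use f g Suc.IH in \<open>auto intro: has_derivative_add\<close>)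
qed

lemma times_differentiable_on_bilinear:
  assumes "open U" "bounded_bilinear B" "times_differentiable_on k U f" "times_differentiable_on k U g"
  shows "times_differentiable_on k U (\<lambda>x. B (f x) (g x))"
  using assms(3,4)
proof (induction k arbitrary: f g)
  case 0
  then show ?case using assms(2) by (auto intro: bounded_bilinear.continuous_on)
next
  case (Suc k)
  obtain f' where f: "\<And>x. x \<in> U \<Longrightarrow> (f has_derivative f' x) (at x)"
    "\<And>v. times_differentiable_on k U (\<lambda>x. f' x v)"
    using times_differentiable_on_SucE[OF Suc.prems(1)] by blast
  obtain g' where g: "\<And>x. x \<in> U \<Longrightarrow> (g has_derivative g' x) (at x)"
    "\<And>v. times_differentiable_on k U (\<lambda>x. g' x v)"
    using times_differentiable_on_SucE[OF Suc.prems(2)] by blast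
  show ?case
  proof (rule times_differentiable_on_SucI[OF assms(1),
        where f' = "\<lambda>x v. B (f x) (g' x v) + B (f' x v) (g x)"])
    show "((\<lambda>x. B (f x) (g x)) has_derivative (\<lambda>v. B (f x) (g' x v) + B (f' x v) (g x))) (at x)"
      if "x \<in> U" for x
      using bounded_bilinear.FDERIV[OF assms(2) f(1)[OF that] g(1)[OF that]] .
    show "times_differentiable_on k U (\<lambda>x. B (f x) (g' x v) + B (f' x v) (g x))" for v
      by (intro times_differentiable_on_add assms(1) Suc.IH f(2) g(2)
          Suc.prems[THEN times_differentiable_on_SucD])
  qed
qed

lemma times_differentiable_on_inverse:
  fixes f :: "'a::real_normed_vector \<Rightarrow> real"
  assumes "open U" "times_differentiable_on k U f" "\<And>x. x \<in> U \<Longrightarrow> f x \<noteq> 0"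
  shows "times_differentiable_on k U (\<lambda>x. inverse (f x))"
  using assms(2)
proof (induction k)
  case 0
  then show ?case using assms(3) by (auto intro: continuous_intros)
next
  case (Suc k)
  obtain f' where f: "\<And>x. x \<in> U \<Longrightarrow> (f has_derivative f' x) (at x)"
    "\<And>v. times_differentiable_on k U (\<lambda>x. f' x v)"
    using times_differentiable_on_SucE[OF Suc.prems(1)] by blast
  note IH = Suc.IH[OF times_differentiable_on_SucD[OF Suc.prems]]
  note bl = times_differentiable_on_bilinear[OF assms(1) bounded_bilinear_mult]
  show ?case
  proof (rule times_differentiable_on_SucI[OF assms(1),
        where f' = "\<lambda>x v. - (inverse (f x) * f' x v * inverse (f x))"])
    show "times_differentiable_on k U (\<lambda>x. - (inverse (f x) * f' x v * inverse (f x)))" for v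
      using times_differentiable_on_linear[OF assms(1) bounded_linear_minus[OF bounded_linear_ident]
          bl[OF bl[OF IH f(2)[of v]] IH]] by simp
  qed (use f(1) assms(3) in \<open>simp add: has_derivative_inverse\<close>)
qed

lemma times_differentiable_on_sqrt:
  fixes f :: "'a::real_normed_vector \<Rightarrow> real"
  assumes "open U" "times_differentiable_on k U f" "\<And>x. x \<in> U \<Longrightarrow> f x > 0"
  shows "times_differentiable_on k U (\<lambda>x. sqrt (f x))"
  using assms(2)
proof (induction k)
  case 0
  then show ?case by (auto intro: continuous_intros)
next
  case (Suc k)
  obtain f' where f: "\<And>x. x \<in> U \<Longrightarrow> (f has_derivative f' x) (at x)"
    "\<And>v. times_differentiable_on k U (\<lambda>x. f' x v)"
    using times_differentiable_on_SucE[OF Suc.prems(1)] by blast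
  note IH = Suc.IH[OF times_differentiable_on_SucD[OF Suc.prems]]
  show ?case
  proof (rule times_differentiable_on_SucI[OF assms(1),
        where f' = "\<lambda>x v. (1/2) *\<^sub>R (inverse (sqrt (f x)) * f' x v)"])
    show "times_differentiable_on k U (\<lambda>x. (1/2) *\<^sub>R (inverse (sqrt (f x)) * f' x v))" for v
      by (intro times_differentiable_on_linear[OF assms(1) bounded_linear_scaleR_right]
          times_differentiable_on_bilinear[OF assms(1) bounded_bilinear_mult]
          times_differentiable_on_inverse assms(1) IH f(2)) (use assms(3) in force)
    show "((\<lambda>x. sqrt (f x)) has_derivative (\<lambda>v. (1/2) *\<^sub>R (inverse (sqrt (f x)) * f' x v))) (at x)"
      if "x \<in> U" for x
      by (rule has_derivative_eq_rhs[OF has_derivative_real_sqrt[OF assms(3)[OF that] f(1)[OF that]]])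
        (auto simp: field_simps)
  qed
qed

lemma smooth_on_cong:
  "open U \<Longrightarrow> smooth_on U f \<Longrightarrow> (\<And>x. x \<in> U \<Longrightarrow> f x = g x) \<Longrightarrow> smooth_on U g"
  unfolding smooth_on_def using times_differentiable_on_cong by blast

lemma smooth_on_subset: "smooth_on U f \<Longrightarrow> T \<subseteq> U \<Longrightarrow> smooth_on T f"
  unfolding smooth_on_def using times_differentiable_on_subset by blast

lemma smooth_on_imp_has_derivative:
  "smooth_on U f \<Longrightarrow> x \<in> U \<Longrightarrow> (f has_derivative frechet_derivative f (at x)) (at x)"
  unfolding smooth_on_def using times_differentiable_on.simps(2)[of 0 U f]
  by (metis frechet_derivative_works times_differentiable_on.simps(2))

lemma smooth_on_imp_differentiable: "smooth_on U f \<Longrightarrow> x \<in> U \<Longrightarrow> f differentiable (at x)"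
  using smooth_on_imp_has_derivative differentiable_def by blast

lemma smooth_on_imp_continuous_on: "smooth_on U f \<Longrightarrow> continuous_on U f"
  unfolding smooth_on_def using times_differentiable_on.simps(1) by blast

lemma smooth_on_frechet_derivative:
  "smooth_on U f \<Longrightarrow> smooth_on U (\<lambda>x. frechet_derivative f (at x) v)"
  unfolding smooth_on_def using times_differentiable_on.simps(2) by blast

lemma smooth_on_const: "open U \<Longrightarrow> smooth_on U (\<lambda>x. c)"
  by (simp add: smooth_on_def times_differentiable_on_const)

lemma smooth_on_linear: "open U \<Longrightarrow> bounded_linear L \<Longrightarrow> smooth_on U f \<Longrightarrow> smooth_on U (\<lambda>x. L (f x))"
  by (simp add: smooth_on_def times_differentiable_on_linear)

lemma smooth_on_ident: 
  assumes "open U" shows "smooth_on U (\<lambda>x. x)"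
proof -
  have "times_differentiable_on k U (\<lambda>x. x)" for k
    by (cases k) (use assms in \<open>auto simp: times_differentiable_on_const\<close>)
  then show ?thesis by (simp add: smooth_on_def)
qed

lemma smooth_on_minus: "open U \<Longrightarrow> smooth_on U f \<Longrightarrow> smooth_on U (\<lambda>x. - f x)"
  using smooth_on_linear[OF _ bounded_linear_minus[OF bounded_linear_ident]] by blast

lemma smooth_on_add:
  "open U \<Longrightarrow> smooth_on U f \<Longrightarrow> smooth_on U g \<Longrightarrow> smooth_on U (\<lambda>x. f x + g x)"
  by (simp add: smooth_on_def times_differentiable_on_add)

lemma smooth_on_bilinear:
  "open U \<Longrightarrow> bounded_bilinear B \<Longrightarrow> smooth_on U f \<Longrightarrow> smooth_on U g \<Longrightarrow>
    smooth_on U (\<lambda>x. B (f x) (g x))"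
  by (simp add: smooth_on_def times_differentiable_on_bilinear)

lemma smooth_on_mult:
  fixes f g :: "'a::real_normed_vector \<Rightarrow> real"
  shows "open U \<Longrightarrow> smooth_on U f \<Longrightarrow> smooth_on U g \<Longrightarrow> smooth_on U (\<lambda>x. f x * g x)"
  using smooth_on_bilinear[OF _ bounded_bilinear_mult] .

lemma smooth_on_scaleR:
  "open U \<Longrightarrow> smooth_on U f \<Longrightarrow> smooth_on U g \<Longrightarrow> smooth_on U (\<lambda>x. f x *\<^sub>R g x)"
  using smooth_on_bilinear[OF _ bounded_bilinear_scaleR] .

lemma smooth_on_sum:
  "open U \<Longrightarrow> (\<And>i. i \<in> I \<Longrightarrow> smooth_on U (f i)) \<Longrightarrow> smooth_on U (\<lambda>x. \<Sum>i\<in>I. f i x)"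
  by (induction I rule: infinite_finite_induct) (auto intro: smooth_on_const smooth_on_add)

lemma smooth_on_prod:
  fixes f :: "'i \<Rightarrow> 'a::real_normed_vector \<Rightarrow> real"
  shows "open U \<Longrightarrow> (\<And>i. i \<in> I \<Longrightarrow> smooth_on U (f i)) \<Longrightarrow> smooth_on U (\<lambda>x. \<Prod>i\<in>I. f i x)"
  by (induction I rule: infinite_finite_induct) (auto intro: smooth_on_const smooth_on_mult)

lemma smooth_on_divide:
  fixes f g :: "'a::real_normed_vector \<Rightarrow> real"
  assumes "open U" "smooth_on U f" "smooth_on U g" "\<And>x. x \<in> U \<Longrightarrow> g x \<noteq> 0"
  shows "smooth_on U (\<lambda>x. f x / g x)"
proof -
  have "smooth_on U (\<lambda>x. inverse (g x))"
    using assms by (simp add: smooth_on_def times_differentiable_on_inverse)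
  then show ?thesis using smooth_on_mult[OF assms(1,2)] by (simp add: divide_inverse)
qed

lemma smooth_on_sqrt:
  fixes f :: "'a::real_normed_vector \<Rightarrow> real"
  shows "open U \<Longrightarrow> smooth_on U f \<Longrightarrow> (\<And>x. x \<in> U \<Longrightarrow> f x > 0) \<Longrightarrow> smooth_on U (\<lambda>x. sqrt (f x))"
  by (simp add: smooth_on_def times_differentiable_on_sqrt)

lemma smooth_on_nth: 
  fixes f :: "'a::real_normed_vector \<Rightarrow> 'b::real_normed_vector ^ 'm"
  shows "open U \<Longrightarrow> smooth_on U f \<Longrightarrow> smooth_on U (\<lambda>x. f x $ i)"
  using smooth_on_linear[OF _ bounded_linear_vec_nth] .

lemma smooth_on_vec_lambda:
  fixes f :: "'m::finite \<Rightarrow> 'a::real_normed_vector \<Rightarrow> real"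
  assumes "open U" "\<And>i. smooth_on U (f i)"
  shows "smooth_on U (\<lambda>x. \<chi> i. f i x)"
proof -
  have "(\<lambda>x. \<chi> i. f i x) = (\<lambda>x. \<Sum>i\<in>UNIV. f i x *\<^sub>R axis i 1)"
    by (simp add: fun_eq_iff vec_eq_iff axis_def if_distrib[of "(*) _"] cong: if_cong)
  then show ?thesis
    using assms by (auto intro!: smooth_on_sum smooth_on_scaleR smooth_on_const)
qed

lemma smooth_on_det:
  fixes M :: "'a::real_normed_vector \<Rightarrow> real ^ 'm ^ 'm"
  assumes "open U" "\<And>i j. smooth_on U (\<lambda>x. M x $ i $ j)"
  shows "smooth_on U (\<lambda>x. det (M x))"
  unfolding det_def using assms
  by (auto intro!: smooth_on_sum smooth_on_mult smooth_on_prod smooth_on_const)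

section \<open>Smooth dependence of the inverse matrix\<close>

lemma matrix_inv_inverse:
  fixes M :: "real ^ 'm ^ 'm"
  assumes "det M \<noteq> 0"
  shows "M ** matrix_inv M = mat 1" "matrix_inv M ** M = mat 1"
proof -
  have "\<exists>M'. M ** M' = mat 1 \<and> M' ** M = mat 1"
    using assms by (simp add: invertible_det_nz[symmetric] invertible_def)
  then have "M ** matrix_inv M = mat 1 \<and> matrix_inv M ** M = mat 1"
    unfolding matrix_inv_def by (rule someI_ex)
  then show "M ** matrix_inv M = mat 1" "matrix_inv M ** M = mat 1" by auto
qed

text \<open>Cramer's rule exhibits the entries of the inverse as quotients of polynomials in the
  entries of \<open>M\<close>, which is what makes the inverse smooth.\<close>

lemma matrix_inv_nth:
  fixes M :: "real ^ 'm ^ 'm"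
  assumes "det M \<noteq> 0"
  shows "matrix_inv M $ k $ l = det (\<chi> i j. if j = k then axis l 1 $ i else M $ i $ j) / det M"
proof -
  have "M *v (matrix_inv M *v axis l 1) = axis l 1"
    using assms by (simp add: matrix_vector_mul_assoc matrix_inv_inverse)
  then have "matrix_inv M *v axis l 1 =
     (\<chi> k. det (\<chi> i j. if j = k then axis l 1 $ i else M $ i $ j) / det M)"
    using cramer[OF assms] by blast
  then have "(matrix_inv M *v axis l 1) $ k =
      det (\<chi> i j. if j = k then axis l 1 $ i else M $ i $ j) / det M"
    by simp
  then show ?thesis by (simp add: matrix_vector_mul_component inner_axis)
qed

lemma smooth_on_matrix_inv:
  fixes M :: "'a::real_normed_vector \<Rightarrow> real ^ 'm ^ 'm"
  assumes "open U" "\<And>i j. smooth_on U (\<lambda>x. M x $ i $ j)" "\<And>x. x \<in> U \<Longrightarrow> det (M x) \<noteq> 0"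
  shows "smooth_on U (\<lambda>x. matrix_inv (M x) $ k $ l)"
proof (rule smooth_on_cong[OF assms(1)])
  show "smooth_on U (\<lambda>x. det (\<chi> i j. if j = k then axis l 1 $ i else M x $ i $ j) / det (M x))"
  proof (intro smooth_on_divide assms(1) smooth_on_det assms(2,3))
    fix i j
    show "smooth_on U (\<lambda>x. (\<chi> i j. if j = k then axis l 1 $ i else M x $ i $ j) $ i $ j)"
      using assms(1,2) by (cases "j = k") (auto intro: smooth_on_const)
  qed
qed (use assms(3) in \<open>simp add: matrix_inv_nth\<close>)

text \<open>Two applications of the mean value theorem, first in direction \<open>u\<close> and then
  in direction \<open>v\<close>, turn the second difference into \<open>t\<^sup>2\<close> times the
  mixed derivative at a nearby point; continuity moves that point to \<open>x\<close>.\<close>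

lemma frechet_derivative_symmetric_real:
  fixes f :: "'a::real_normed_vector \<Rightarrow> real"
  assumes U: "open U" "x \<in> U"
    and f: "\<And>z. z \<in> U \<Longrightarrow> f differentiable (at z)"
    and f2: "\<And>z. z \<in> U \<Longrightarrow> (\<lambda>y. frechet_derivative f (at y) u) differentiable (at z)"
    and c: "continuous_on U (\<lambda>y. frechet_derivative (\<lambda>y. frechet_derivative f (at y) u) (at y) v)"
    and e: "e > 0"
  obtains d where "d > 0" "\<And>t. 0 < t \<Longrightarrow> t < d \<Longrightarrow>
    \<bar>f (x + t *\<^sub>R u + t *\<^sub>R v) - f (x + t *\<^sub>R u) - f (x + t *\<^sub>R v) + f x
      - t\<^sup>2 * frechet_derivative (\<lambda>y. frechet_derivative f (at y) u) (at x) v\<bar> \<le> e * t\<^sup>2"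
proof -
  define g where "g y = frechet_derivative f (at y) u" for y
  define h where "h y = frechet_derivative g (at y) v" for y
  have h: "continuous_on U h" using c by (simp add: h_def g_def[abs_def])
  obtain d0 where d0: "d0 > 0" "ball x d0 \<subseteq> U" using U open_contains_ball by blast
  have "isCont h x" using h U continuous_on_eq_continuous_at by blast
  then obtain d1 where d1: "d1 > 0" "\<And>y. dist y x < d1 \<Longrightarrow> \<bar>h y - h x\<bar> < e"
    using e unfolding continuous_at_eps_delta dist_real_def by blast
  \<comment> \<open>\<open>t K\<close> bounds every displacement \<open>s u + r v\<close> with
    \<open>s\<close> and \<open>r\<close> in \<open>[0, t]\<close>. The summand 1 keeps
    \<open>K\<close> positive when \<open>u\<close> and \<open>v\<close> are both zero.\<close>
  define K where "K = norm u + norm v + 1"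
  have K: "K > 0" by (simp add: K_def add_nonneg_pos)
  define d where "d = min d0 d1 / K"
  have dpos: "d > 0" using d0 d1 K by (simp add: d_def)
  have near: "x + s *\<^sub>R u + r *\<^sub>R v \<in> ball x (min d0 d1)"
    if "0 \<le> s" "s \<le> t" "0 \<le> r" "r \<le> t" "0 < t" "t < d" for s r t
  proof -
    have "norm (s *\<^sub>R u + r *\<^sub>R v) \<le> s * norm u + r * norm v"
      using norm_triangle_ineq[of "s *\<^sub>R u" "r *\<^sub>R v"] that by simp
    also have "\<dots> \<le> t * norm u + t * norm v"
      using that by (intro add_mono mult_right_mono) auto
    also have "\<dots> < t * K" using that by (simp add: K_def algebra_simps)
    also have "\<dots> < d * K" using that K by simp
    also have "\<dots> = min d0 d1" using K by (simp add: d_def)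
    finally show ?thesis by (simp add: dist_norm add.assoc norm_minus_commute[of _ x] norm_minus_cancel[of "s *\<^sub>R u + r *\<^sub>R v", symmetric] del: norm_minus_cancel)
  qed
  show thesis
  proof (rule that[OF dpos])
    fix t assume t: "0 < t" "t < d"
    have dir: "((\<lambda>s. p (y + s *\<^sub>R w)) has_real_derivative frechet_derivative p (at (y + s *\<^sub>R w)) w) (at s)"
      if "p differentiable (at (y + s *\<^sub>R w))" for p :: "'a \<Rightarrow> real" and y w s
    proof -
      have "((\<lambda>s. p (y + s *\<^sub>R w)) has_derivative
          (\<lambda>h. frechet_derivative p (at (y + s *\<^sub>R w)) (h *\<^sub>R w))) (at s)"
        by (rule has_derivative_compose[where g = p])
          (use that frechet_derivative_works in \<open>auto intro!: derivative_eq_intros\<close>)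
      moreover have "frechet_derivative p (at (y + s *\<^sub>R w)) (h *\<^sub>R w) =
          frechet_derivative p (at (y + s *\<^sub>R w)) w * h" for h
        using linear_frechet_derivative[OF that] by (simp add: linear_cmul)
      ultimately show ?thesis by (simp add: has_field_derivative_def)
    qed
    have inU: "x + s *\<^sub>R u + r *\<^sub>R v \<in> U" if "0 \<le> s" "s \<le> t" "0 \<le> r" "r \<le> t" for s r
      using near[OF that t] d0 by auto
    define \<phi> where "\<phi> s = f (x + t *\<^sub>R v + s *\<^sub>R u) - f (x + s *\<^sub>R u)" for s
    have d\<phi>: "(\<phi> has_real_derivative (g (x + t *\<^sub>R v + s *\<^sub>R u) - g (x + s *\<^sub>R u))) (at s)"
      if "0 \<le> s" "s \<le> t" for s
      unfolding \<phi>_def g_def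
      by (intro DERIV_diff dir f) (use inU[of s t] inU[of s 0] that t in \<open>auto simp: ac_simps\<close>)
    obtain s where s: "0 < s" "s < t" "\<phi> t - \<phi> 0 = t * (g (x + t *\<^sub>R v + s *\<^sub>R u) - g (x + s *\<^sub>R u))"
      using MVT2[OF t(1) d\<phi>] by auto
    have dg: "((\<lambda>r. g (x + s *\<^sub>R u + r *\<^sub>R v)) has_real_derivative h (x + s *\<^sub>R u + r *\<^sub>R v)) (at r)"
      if "0 \<le> r" "r \<le> t" for r
      unfolding h_def using f2[folded g_def] inU[of s r] s that t
      by (intro dir) auto
    obtain r where r: "0 < r" "r < t"
      "g (x + s *\<^sub>R u + t *\<^sub>R v) - g (x + s *\<^sub>R u) = t * h (x + s *\<^sub>R u + r *\<^sub>R v)"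
      using MVT2[OF t(1) dg] by auto
    have "\<phi> t - \<phi> 0 = t\<^sup>2 * h (x + s *\<^sub>R u + r *\<^sub>R v)"
      using s(3) r(3) by (simp add: power2_eq_square ac_simps)
    moreover have "\<bar>h (x + s *\<^sub>R u + r *\<^sub>R v) - h x\<bar> < e"
      using near[of s t r] s r t by (intro d1) (auto simp: dist_commute)
    moreover have "f (x + t *\<^sub>R u + t *\<^sub>R v) - f (x + t *\<^sub>R u) - f (x + t *\<^sub>R v) + f x = \<phi> t - \<phi> 0"
      by (simp add: \<phi>_def ac_simps)
    ultimately have "\<bar>f (x + t *\<^sub>R u + t *\<^sub>R v) - f (x + t *\<^sub>R u) - f (x + t *\<^sub>R v) + f x - t\<^sup>2 * h x\<bar>
        = t\<^sup>2 * \<bar>h (x + s *\<^sub>R u + r *\<^sub>R v) - h x\<bar>"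
      by (simp add: abs_mult flip: right_diff_distrib)
    also have "\<dots> \<le> e * t\<^sup>2"
      using \<open>\<bar>h (x + s *\<^sub>R u + r *\<^sub>R v) - h x\<bar> < e\<close> by (subst mult.commute) (intro mult_right_mono; simp)
    finally show "\<bar>f (x + t *\<^sub>R u + t *\<^sub>R v) - f (x + t *\<^sub>R u) - f (x + t *\<^sub>R v) + f x
      - t\<^sup>2 * frechet_derivative (\<lambda>y. frechet_derivative f (at y) u) (at x) v\<bar> \<le> e * t\<^sup>2"
      by (simp add: h_def g_def[abs_def])
  qed
qed

text \<open>The second difference does not distinguish \<open>u\<close> from \<open>v\<close>, so
  both mixed derivatives are its limit after division by \<open>t\<^sup>2\<close>.\<close>

lemma smooth_on_frechet_derivative_symmetric:
  fixes f :: "'a::real_normed_vector \<Rightarrow> real"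
  assumes "open U" "x \<in> U" "smooth_on U f"
  shows "frechet_derivative (\<lambda>y. frechet_derivative f (at y) u) (at x) v =
         frechet_derivative (\<lambda>y. frechet_derivative f (at y) v) (at x) u"
proof -
  define p where "p u v = frechet_derivative (\<lambda>y. frechet_derivative f (at y) u) (at x) v" for u v
  have *: "\<exists>d>0. \<forall>t. 0 < t \<and> t < d \<longrightarrow>
    \<bar>f (x + t *\<^sub>R u + t *\<^sub>R v) - f (x + t *\<^sub>R u) - f (x + t *\<^sub>R v) + f x - t\<^sup>2 * p u v\<bar> \<le> e * t\<^sup>2"
    if "e > 0" for u v e
    unfolding p_def
    by (rule frechet_derivative_symmetric_real[OF assms(1,2) _ _ _ that, of f u v])
      (auto intro!: smooth_on_imp_differentiable[OF assms(3)] smooth_on_imp_continuous_on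
        smooth_on_frechet_derivative assms(3) smooth_on_imp_differentiable[where U = U])
  have "\<bar>p u v - p v u\<bar> \<le> e" if "e > 0" for e
  proof -
    have e2: "e / 2 > 0" using that by simp
    obtain d1 where d1: "d1 > 0" "\<And>t. 0 < t \<Longrightarrow> t < d1 \<Longrightarrow>
      \<bar>f (x + t *\<^sub>R u + t *\<^sub>R v) - f (x + t *\<^sub>R u) - f (x + t *\<^sub>R v) + f x - t\<^sup>2 * p u v\<bar> \<le> e/2 * t\<^sup>2"
      using *[of "e/2" u v] e2 by blast
    obtain d2 where d2: "d2 > 0" "\<And>t. 0 < t \<Longrightarrow> t < d2 \<Longrightarrow>
      \<bar>f (x + t *\<^sub>R v + t *\<^sub>R u) - f (x + t *\<^sub>R v) - f (x + t *\<^sub>R u) + f x - t\<^sup>2 * p v u\<bar> \<le> e/2 * t\<^sup>2"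
      using *[of "e/2" v u] e2 by blast
    define t where "t = min d1 d2 / 2"
    have t: "t > 0" "t < d1" "t < d2" using d1 d2 by (auto simp: t_def)
    have eq: "x + t *\<^sub>R v + t *\<^sub>R u = x + t *\<^sub>R u + t *\<^sub>R v" by simp
    have "\<bar>t\<^sup>2 * p u v - t\<^sup>2 * p v u\<bar> \<le> e * t\<^sup>2"
      using d1(2)[OF t(1,2)] d2(2)[OF t(1,3)] unfolding eq by linarith
    moreover have "\<bar>t\<^sup>2 * p u v - t\<^sup>2 * p v u\<bar> = t\<^sup>2 * \<bar>p u v - p v u\<bar>"
      by (simp add: abs_mult flip: right_diff_distrib)
    ultimately have "t\<^sup>2 * \<bar>p u v - p v u\<bar> \<le> t\<^sup>2 * e"
      by (simp add: mult.commute)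
    then show ?thesis using t by simp
  qed
  then have "\<bar>p u v - p v u\<bar> \<le> 0" using field_le_epsilon[of "\<bar>p u v - p v u\<bar>" 0] by simp
  then show ?thesis by (simp add: p_def)
qed

subsection \<open>Symmetric matrices and their resolvents\<close>

lemma symmetric_matrix_inner:
  fixes A :: "real ^ 'n ^ 'n"
  assumes "transpose A = A"
  shows "x \<bullet> (A *v y) = (A *v x) \<bullet> y"
  using assms by (metis dot_lmul_matrix vector_transpose_matrix)

text \<open>A maximiser \<open>e\<close> of the quadratic form on the unit sphere of
  \<open>W\<close> is an eigenvector: if the residual \<open>y = A e - d e\<close> were nonzero,
  moving from \<open>e\<close> towards \<open>y\<close> would increase the Rayleigh quotient to
  first order.\<close>

lemma eigenvector_in_invariant_subspace:
  fixes A :: "real ^ 'n ^ 'n"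
  assumes A: "transpose A = A" and W: "subspace W" "\<And>x. x \<in> W \<Longrightarrow> A *v x \<in> W" and z: "z \<in> W" "z \<noteq> 0"
  shows "\<exists>e\<in>W. norm e = 1 \<and> (\<exists>d. A *v e = d *\<^sub>R e)"
proof -
  let ?K = "sphere 0 1 \<inter> W"
  have "compact ?K" using closed_subspace[OF W(1)] by (intro compact_Int_closed) auto
  moreover have "(1 / norm z) *\<^sub>R z \<in> ?K" using z W(1) by (auto simp: subspace_scale)
  moreover have "continuous_on ?K (\<lambda>x. x \<bullet> (A *v x))"
    by (intro continuous_intros matrix_vector_mult_linear_continuous_on)
  ultimately obtain e where e: "e \<in> ?K" and mx: "\<And>x. x \<in> ?K \<Longrightarrow> x \<bullet> (A *v x) \<le> e \<bullet> (A *v e)"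
    using continuous_attains_sup[of ?K "\<lambda>x. x \<bullet> (A *v x)"] by blast
  define d where "d = e \<bullet> (A *v e)"
  have le: "x \<bullet> (A *v x) \<le> d * (x \<bullet> x)" if "x \<in> W" for x
  proof (cases "x = 0")
    case False
    have "(1 / norm x) *\<^sub>R x \<in> ?K" using False that W(1) by (auto simp: subspace_scale)
    then have "(1 / norm x) * ((1 / norm x) * (x \<bullet> (A *v x))) \<le> d"
      using mx[of "(1 / norm x) *\<^sub>R x"] by (simp add: d_def matrix_vector_mult_scaleR)
    then show ?thesis using False
      by (simp add: dot_square_norm power2_eq_square field_simps)
  qed simp
  have ee: "e \<bullet> e = 1" "e \<in> W" "norm e = 1" using e by (auto simp: dot_square_norm)
  define y where "y = A *v e - d *\<^sub>R e"
  have yW: "y \<in> W" using W ee by (simp add: y_def subspace_diff subspace_scale)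
  have ye: "y \<bullet> e = 0" by (simp add: y_def inner_diff_left ee d_def inner_commute[of "A *v e" e])
  have yA: "y \<bullet> (A *v e) = y \<bullet> y" using ye by (simp add: y_def inner_diff_right algebra_simps)
  have "y \<bullet> y = 0"
  proof (rule ccontr)
    assume "y \<bullet> y \<noteq> 0"
    then have pos: "y \<bullet> y > 0" by (metis inner_ge_zero less_eq_real_def)
    \<comment> \<open>The step \<open>t\<close> is so small that the quadratic term, at most
      \<open>t c = y \<bullet> y\<close>, cannot absorb the linear gain
      \<open>2 (y \<bullet> y)\<close>.\<close>
    define c where "c = \<bar>y \<bullet> (A *v y) - d * (y \<bullet> y)\<bar> + 1"
    define t where "t = (y \<bullet> y) / c"
    have c: "c > 0" by (simp add: c_def)
    have t: "t > 0" using pos c by (simp add: t_def)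
    have "(e + t *\<^sub>R y) \<bullet> (A *v (e + t *\<^sub>R y)) \<le> d * ((e + t *\<^sub>R y) \<bullet> (e + t *\<^sub>R y))"
      using ee yW W(1) by (intro le) (simp add: subspace_add subspace_scale)
    moreover have "(e + t *\<^sub>R y) \<bullet> (A *v (e + t *\<^sub>R y)) = d + 2 * t * (y \<bullet> y) + t\<^sup>2 * (y \<bullet> (A *v y))"
      using symmetric_matrix_inner[OF A, of e y] yA
      by (simp add: matrix_vector_right_distrib matrix_vector_mult_scaleR inner_add_left
          inner_add_right d_def[symmetric] inner_commute[of "A *v e" y] power2_eq_square algebra_simps)
    moreover have "(e + t *\<^sub>R y) \<bullet> (e + t *\<^sub>R y) = 1 + t\<^sup>2 * (y \<bullet> y)"
      using ye by (simp add: inner_add_left inner_add_right ee inner_commute[of e y] power2_eq_square)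
    ultimately have "d + 2 * t * (y \<bullet> y) + t\<^sup>2 * (y \<bullet> (A *v y)) \<le> d * (1 + t\<^sup>2 * (y \<bullet> y))"
      by simp
    then have "t * (2 * (y \<bullet> y) + t * (y \<bullet> (A *v y) - d * (y \<bullet> y))) \<le> 0"
      by (simp add: algebra_simps power2_eq_square)
    then have "2 * (y \<bullet> y) + t * (y \<bullet> (A *v y) - d * (y \<bullet> y)) \<le> 0"
      using t by (simp add: mult_le_0_iff)
    then have "2 * (y \<bullet> y) \<le> t * - (y \<bullet> (A *v y) - d * (y \<bullet> y))"
      by (simp add: algebra_simps)
    also have "\<dots> \<le> t * c" using t by (intro mult_left_mono) (auto simp: c_def)
    also have "\<dots> = y \<bullet> y" using c by (simp add: t_def)
    finally show False using pos by simp
  qed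
  then have "A *v e = d *\<^sub>R e" by (simp add: y_def)
  then show ?thesis using ee by blast
qed

text \<open>A largest orthonormal set of eigenvectors spans the space: its orthogonal complement is
  invariant under the symmetric \<open>A\<close>, and if nonzero would contain one more
  eigenvector.\<close>

theorem symmetric_matrix_eigenbasis:
  fixes A :: "real ^ 'n ^ 'n"
  assumes A: "transpose A = A"
  obtains e :: "'n \<Rightarrow> real ^ 'n" and d where
    "\<And>i j. e i \<bullet> e j = (if i = j then 1 else 0)" "\<And>i. A *v e i = d i *\<^sub>R e i"
proof -
  define OE where "OE B \<longleftrightarrow> finite B \<and> pairwise orthogonal B \<and>
    (\<forall>b\<in>B. norm b = 1 \<and> (\<exists>d. A *v b = d *\<^sub>R b))" for B :: "(real ^ 'n) set"
  have ind: "independent B" if "OE B" for B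
    using that pairwise_orthogonal_independent[of B] by (force simp: OE_def)
  have card: "card B \<le> CARD('n)" if "OE B" for B
    using independent_bound[OF ind[OF that]] by simp
  have "OE {}" by (simp add: OE_def)
  then obtain B where B: "OE B" and mx: "\<And>B'. OE B' \<Longrightarrow> card B' \<le> card B"
    using ex_has_greatest_nat[of OE "{}" card "CARD('n) + 1"] card by fastforce
  define W where "W = {x. \<forall>b\<in>B. orthogonal b x}"
  have "subspace W" by (auto simp: W_def subspace_def orthogonal_clauses)
  moreover have "A *v x \<in> W" if "x \<in> W" for x
  proof -
    have "b \<bullet> (A *v x) = 0" if b: "b \<in> B" for b
    proof -
      obtain d where "A *v b = d *\<^sub>R b" using B b by (auto simp: OE_def)
      then show ?thesis using \<open>x \<in> W\<close> b
        by (simp add: symmetric_matrix_inner[OF A] W_def orthogonal_def)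
    qed
    then show ?thesis by (simp add: W_def orthogonal_def)
  qed
  moreover have False if "e \<in> W" "norm e = 1" "A *v e = d *\<^sub>R e" for e d
  proof -
    have "e \<notin> B" using that by (auto simp: W_def orthogonal_def)
    moreover have "OE (insert e B)"
      using B that by (auto simp: OE_def pairwise_insert W_def orthogonal_commute)
    ultimately show False using mx[of "insert e B"] B by (simp add: OE_def)
  qed
  ultimately have W0: "x = 0" if "x \<in> W" for x
    using eigenvector_in_invariant_subspace[OF A, of W x] that by blast
  have "span B = UNIV"
  proof (rule ccontr)
    assume "span B \<noteq> UNIV"
    then obtain x where "x \<noteq> 0" "\<And>y. y \<in> span B \<Longrightarrow> orthogonal x y"
      using orthogonal_to_subspace_exists_gen[of "B" UNIV] by (metis UNIV_I psubsetI span_UNIV subset_UNIV)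
    then show False using W0[of x] by (auto simp: W_def span_base orthogonal_commute)
  qed
  then have "card B = CARD('n)"
    using ind[OF B] by (metis dim_UNIV dim_eq_card_independent dim_span card_cart_basis dim_vec_eq vec.dim_UNIV DIM_cart DIM_real mult.right_neutral)
  then obtain e where e: "bij_betw e (UNIV :: 'n set) B"
    using B finite_same_card_bij[of "UNIV :: 'n set" B] by (auto simp: OE_def)
  have eB: "e i \<in> B" for i using e by (auto simp: bij_betw_def)
  have "\<forall>i. \<exists>d. A *v e i = d *\<^sub>R e i" using B eB by (auto simp: OE_def)
  then obtain d where "\<And>i. A *v e i = d i *\<^sub>R e i" by metis
  moreover have "e i \<bullet> e j = (if i = j then 1 else 0)" for i j
  proof (cases "i = j")
    case True
    then show ?thesis using B eB by (simp add: OE_def dot_square_norm)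
  next
    case False
    then have "e i \<noteq> e j" using e by (auto simp: bij_betw_def inj_on_def)
    then show ?thesis using B eB False by (auto simp: OE_def pairwise_def orthogonal_def)
  qed
  ultimately show thesis using that by blast
qed

context
  fixes e :: "'n::finite \<Rightarrow> real ^ 'n"
  assumes on: "\<And>i j. e i \<bullet> e j = (if i = j then 1 else 0)"
begin

text \<open>Orthonormal rows of a square matrix force orthonormal columns, since a right inverse is
  also a left inverse.\<close>

lemma orthonormal_family_entries: "(\<Sum>i\<in>UNIV. e i $ k * e i $ l) = (if k = l then 1 else 0)"
proof -
  define P where "P = (\<chi> i. e i)"
  have "P ** transpose P = mat 1"
    using on by (simp add: P_def vec_eq_iff matrix_matrix_mult_def transpose_def mat_def inner_vec_def)
  then have "transpose P ** P = mat 1" by (simp add: matrix_left_right_inverse)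
  then have "(transpose P ** P) $ k $ l = (if k = l then 1 else 0)" by (simp add: mat_def)
  then show ?thesis by (simp add: P_def matrix_matrix_mult_def transpose_def)
qed

lemma orthonormal_family_expand: "(\<Sum>i\<in>UNIV. (x \<bullet> e i) *\<^sub>R e i) = x"
proof -
  have "(\<Sum>i\<in>UNIV. (x \<bullet> e i) *\<^sub>R e i) $ k = x $ k" for k
  proof -
    have "(\<Sum>i\<in>UNIV. (x \<bullet> e i) *\<^sub>R e i) $ k = (\<Sum>i\<in>UNIV. \<Sum>l\<in>UNIV. x $ l * (e i $ l * e i $ k))"
      by (simp add: inner_vec_def sum_distrib_right mult.assoc)
    also have "\<dots> = (\<Sum>l\<in>UNIV. x $ l * (\<Sum>i\<in>UNIV. e i $ l * e i $ k))"
      by (subst sum.swap) (simp add: sum_distrib_left)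
    finally show ?thesis by (simp add: orthonormal_family_entries if_distrib cong: if_cong)
  qed
  then show ?thesis by (simp add: vec_eq_iff)
qed

lemma orthonormal_family_matrix_eqI:
  fixes M :: "real ^ 'n ^ 'm"
  assumes "\<And>i. M *v e i = M' *v e i"
  shows "M = M'"
proof -
  have "M *v x = M' *v x" for x
  proof -
    have "M *v (\<Sum>i\<in>UNIV. (x \<bullet> e i) *\<^sub>R e i) = M' *v (\<Sum>i\<in>UNIV. (x \<bullet> e i) *\<^sub>R e i)"
      using assms by (simp add: linear_sum[OF matrix_vector_mul_linear] matrix_vector_mult_scaleR)
    then show ?thesis by (simp add: orthonormal_family_expand)
  qed
  then show ?thesis by (simp add: matrix_eq)
qed

lemma trace_orthonormal_family: "trace M = (\<Sum>i\<in>UNIV. e i \<bullet> (M *v e i))"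
proof -
  have "(\<Sum>i\<in>UNIV. e i \<bullet> (M *v e i)) =
      (\<Sum>i\<in>UNIV. \<Sum>k\<in>UNIV. \<Sum>l\<in>UNIV. M $ k $ l * (e i $ k * e i $ l))"
    by (simp add: inner_vec_def matrix_vector_mult_def sum_distrib_left ac_simps)
  also have "\<dots> = (\<Sum>k\<in>UNIV. \<Sum>l\<in>UNIV. \<Sum>i\<in>UNIV. M $ k $ l * (e i $ k * e i $ l))"
  proof -
    have "(\<Sum>k\<in>UNIV. \<Sum>i\<in>UNIV. \<Sum>l\<in>UNIV. M $ k $ l * (e i $ k * e i $ l)) =
        (\<Sum>k\<in>UNIV. \<Sum>l\<in>UNIV. \<Sum>i\<in>UNIV. M $ k $ l * (e i $ k * e i $ l))"
      by (rule sum.cong[OF refl]) (rule sum.swap)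
    then show ?thesis by (subst sum.swap)
  qed
  also have "\<dots> = trace M"
    by (simp add: sum_distrib_left[symmetric] orthonormal_family_entries trace_def if_distrib cong: if_cong)
  finally show ?thesis by simp
qed

end

section \<open>Positive definite matrices\<close>

lemma positive_definite_matrix_root:
  fixes G :: "real ^ 'n ^ 'n"
  assumes G: "transpose G = G" "\<And>x. x \<noteq> 0 \<Longrightarrow> x \<bullet> (G *v x) > 0"
  obtains D :: "real ^ 'n ^ 'n" where "det D \<noteq> 0" "\<And>x. (norm (D *v x))\<^sup>2 = x \<bullet> (G *v x)"
proof -
  obtain e :: "'n \<Rightarrow> real ^ 'n" and d where
    on: "\<And>i j. e i \<bullet> e j = (if i = j then 1 else 0)" and ev: "\<And>i. G *v e i = d i *\<^sub>R e i"
    using symmetric_matrix_eigenbasis[OF G(1)] by blast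
  have d: "d i > 0" for i
  proof -
    have "e i \<noteq> 0" using on[of i i] by auto
    then show ?thesis using G(2)[of "e i"] by (simp add: ev on)
  qed
  \<comment> \<open>The components of \<open>D x\<close> are the eigencoordinates of
    \<open>x\<close> scaled by the roots of the eigenvalues, so that their squares add up to the
    quadratic form of \<open>G\<close>.\<close>
  define D :: "real ^ 'n ^ 'n" where "D = (\<chi> i. sqrt (d i) *\<^sub>R e i)"
  have n: "(norm (D *v x))\<^sup>2 = x \<bullet> (G *v x)" for x
  proof -
    have "(norm (D *v x))\<^sup>2 = (\<Sum>i\<in>UNIV. d i * (x \<bullet> e i)\<^sup>2)"
    proof -
      have c: "(D *v x) $ i = sqrt (d i) * (x \<bullet> e i)" for i
        by (simp add: D_def matrix_vector_mul_component inner_commute)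
      have "(D *v x) $ i * (D *v x) $ i = d i * (x \<bullet> e i)\<^sup>2" for i
        using d[of i] by (simp add: c power2_eq_square)
      then show ?thesis unfolding power2_norm_eq_inner inner_vec_def[of "D *v x"] by simp
    qed
    also have "\<dots> = (\<Sum>i\<in>UNIV. (x \<bullet> e i) * (x \<bullet> (G *v e i)))"
      by (simp add: ev power2_eq_square ac_simps)
    also have "\<dots> = x \<bullet> (G *v (\<Sum>i\<in>UNIV. (x \<bullet> e i) *\<^sub>R e i))"
      by (simp add: linear_sum[OF matrix_vector_mul_linear] matrix_vector_mult_scaleR inner_sum_right)
    finally show ?thesis by (simp add: orthonormal_family_expand[OF on])
  qed
  have "D *v x = 0 \<Longrightarrow> x = 0" for x using n[of x] G(2)[of x] by force
  then have "det D \<noteq> 0"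
    by (metis invertible_det_nz invertible_left_inverse matrix_left_invertible_ker)
  then show thesis using n that by blast
qed

text \<open>On the segment from the identity to \<open>G\<close> the quadratic form stays positive,
  so the determinant never vanishes and keeps the sign it has at the identity.\<close>

lemma det_positive_definite:
  fixes G :: "real ^ 'n ^ 'n"
  assumes G: "\<And>x. x \<noteq> 0 \<Longrightarrow> x \<bullet> (G *v x) > 0"
  shows "det G > 0"
proof (rule ccontr)
  assume *: "\<not> det G > 0"
  define H where "H t = (1 - t) *\<^sub>R mat 1 + t *\<^sub>R G" for t :: real
  have nz: "det (H t) \<noteq> 0" if "0 \<le> t" "t \<le> 1" for t
  proof -
    have "x = 0" if "H t *v x = 0" for x
    proof (rule ccontr)
      assume x: "x \<noteq> 0"
      have "x \<bullet> (H t *v x) = (1 - t) * (x \<bullet> x) + t * (x \<bullet> (G *v x))"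
        by (simp add: H_def matrix_vector_mult_add_rdistrib inner_add_right scaleR_matrix_vector_assoc[symmetric])
      moreover have "(1 - t) * (x \<bullet> x) + t * (x \<bullet> (G *v x)) > 0"
        using G[OF x] x \<open>0 \<le> t\<close> \<open>t \<le> 1\<close>
        by (cases "t = 0") (auto intro!: add_nonneg_pos mult_pos_pos)
      ultimately show False using that by simp
    qed
    then show ?thesis
      by (metis invertible_det_nz invertible_left_inverse matrix_left_invertible_ker)
  qed
  have "continuous_on {0..1} (\<lambda>t. det (H t))"
    unfolding det_def H_def by (intro continuous_intros)
  moreover have "det (H 0) = 1" "det (H 1) \<le> 0" using * by (auto simp: H_def)
  ultimately obtain t where "0 \<le> t" "t \<le> 1" "det (H t) = 0"
    using IVT2'[of "\<lambda>t. det (H t)" 1 0 0] by auto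
  then show False using nz by blast
qed

section \<open>Traces of powers and the resolvent\<close>

primrec matrix_power :: "real ^ 'n ^ 'n \<Rightarrow> nat \<Rightarrow> real ^ 'n ^ 'n" where
  "matrix_power A 0 = mat 1"
| "matrix_power A (Suc k) = A ** matrix_power A k"

text \<open>On a finite spectrum every function, in particular the square of the resolvent function,
  agrees with a polynomial.\<close>

lemma polynomial_interpolation:
  fixes \<phi> :: "real \<Rightarrow> real"
  assumes "finite L"
  shows "\<exists>p. \<forall>x\<in>L. poly p x = \<phi> x"
  using assms
proof (induction L rule: finite_induct)
  case (insert a L)
  then obtain p where p: "\<forall>x\<in>L. poly p x = \<phi> x" by blast
  define q where "q = (\<Prod>b\<in>L. [:-b, 1:])"
  have "poly q a \<noteq> 0" using insert by (auto simp: q_def poly_prod)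
  moreover have "poly q x = 0" if "x \<in> L" for x using insert that by (auto simp: q_def poly_prod)
  ultimately show ?case using p
    by (intro exI[of _ "p + smult ((\<phi> a - poly p a) / poly q a) q"]) auto
qed simp

text \<open>For symmetric \<open>A\<close> the resolvent \<open>R\<close> is a polynomial in \<open>A\<close>.\<close>

lemma trace_resolvent_eq_0:
  fixes A M R :: "real ^ 'n ^ 'n"
  assumes A: "transpose A = A" and tr: "\<And>k. trace (matrix_power A k ** M) = 0"
    and R: "R ** (mat 1 + s *\<^sub>R A) = mat 1"
  shows "trace (R ** R ** M) = 0"
proof -
  obtain e :: "'n \<Rightarrow> real ^ 'n" and d where
    on: "\<And>i j. e i \<bullet> e j = (if i = j then 1 else 0)" and ev: "\<And>i. A *v e i = d i *\<^sub>R e i"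
    using symmetric_matrix_eigenbasis[OF A] by blast
  have evI: "(mat 1 + s *\<^sub>R A) *v e i = (1 + s * d i) *\<^sub>R e i" for i
    by (simp add: matrix_vector_mult_add_rdistrib scaleR_matrix_vector_assoc[symmetric] ev algebra_simps)
  have Rv: "R *v ((mat 1 + s *\<^sub>R A) *v x) = x" for x
    using R by (simp add: matrix_vector_mul_assoc)
  have ne: "e i \<noteq> 0" for i using on[of i i] by auto
  have nz: "1 + s * d i \<noteq> 0" for i
  proof
    assume "1 + s * d i = 0"
    then show False using Rv[of "e i"] evI[of i] ne by simp
  qed
  have "R *v e i = (1 / (1 + s * d i)) *\<^sub>R e i" for i
  proof -
    have "(1 + s * d i) *\<^sub>R (R *v e i) = e i"
      using Rv[of "e i"] by (simp add: evI matrix_vector_mult_scaleR)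
    then have "(1 / (1 + s * d i)) *\<^sub>R ((1 + s * d i) *\<^sub>R (R *v e i)) = (1 / (1 + s * d i)) *\<^sub>R e i" by simp
    then show ?thesis using nz by simp
  qed
  then have RR: "(R ** R) *v e i = (1 / (1 + s * d i))\<^sup>2 *\<^sub>R e i" for i
    by (simp add: matrix_vector_mul_assoc[symmetric] matrix_vector_mult_scaleR power2_eq_square)
  have P: "matrix_power A k *v e i = d i ^ k *\<^sub>R e i" for i k
    by (induction k) (simp_all add: matrix_vector_mul_assoc[symmetric] matrix_vector_mult_scaleR ev mult.commute)
  \<comment> \<open>\<open>M\<close> need not be diagonal in the eigenbasis of \<open>A\<close>, but
    the trace of its product with a matrix that is diagonal there sees only these diagonal
    entries.\<close>
  define m where "m i = e i \<bullet> (M *v e i)" for i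
  have diag: "trace (K ** M) = (\<Sum>i\<in>UNIV. c i * m i)" if "\<And>i. K *v e i = c i *\<^sub>R e i" for K c
  proof -
    have "trace (K ** M) = trace (M ** K)" by (rule trace_mul_sym)
    then show ?thesis
      by (simp add: trace_orthonormal_family[OF on] matrix_vector_mul_assoc[symmetric] that
          matrix_vector_mult_scaleR m_def)
  qed
  obtain p where p: "\<forall>x\<in>range d. poly p x = (1 / (1 + s * x))\<^sup>2"
    using polynomial_interpolation[of "range d" "\<lambda>x. (1 / (1 + s * x))\<^sup>2"] by auto
  have "trace (R ** R ** M) = (\<Sum>i\<in>UNIV. poly p (d i) * m i)"
    using diag[OF RR] p by simp
  also have "\<dots> = (\<Sum>i\<in>UNIV. \<Sum>k\<le>degree p. coeff p k * (d i ^ k * m i))"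
    by (simp add: poly_altdef sum_distrib_right mult.assoc)
  also have "\<dots> = (\<Sum>k\<le>degree p. coeff p k * (\<Sum>i\<in>UNIV. d i ^ k * m i))"
    by (subst sum.swap) (simp add: sum_distrib_left)
  also have "\<dots> = 0" using diag[OF P] tr by simp
  finally show ?thesis .
qed

text \<open>Writes the defect between the power sums as a weighted sum of squares. With nonnegative
  \<mu> it is nonnegative, and it vanishes only if all nonzero \<mu> agree.\<close>

lemma sum_weighted_square_diff:
  fixes \<mu> :: "'n::finite \<Rightarrow> real"
  shows "(\<Sum>i\<in>UNIV. \<Sum>j\<in>UNIV. \<mu> i * \<mu> j * (\<mu> i - \<mu> j)\<^sup>2) =
    2 * ((\<Sum>i\<in>UNIV. \<mu> i) * (\<Sum>i\<in>UNIV. \<mu> i ^ 3) - (\<Sum>i\<in>UNIV. \<mu> i ^ 2)\<^sup>2)"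
proof -
  have "(\<Sum>i\<in>UNIV. \<Sum>j\<in>UNIV. \<mu> i * \<mu> j * (\<mu> i - \<mu> j)\<^sup>2) =
    (\<Sum>i\<in>UNIV. \<Sum>j\<in>UNIV. \<mu> i ^ 3 * \<mu> j + \<mu> i * \<mu> j ^ 3 - 2 * (\<mu> i ^ 2 * \<mu> j ^ 2))"
    by (intro sum.cong refl) (simp add: power2_eq_square power3_eq_cube algebra_simps)
  also have "\<dots> = (\<Sum>i\<in>UNIV. \<mu> i ^ 3) * (\<Sum>i\<in>UNIV. \<mu> i) + (\<Sum>i\<in>UNIV. \<mu> i) * (\<Sum>i\<in>UNIV. \<mu> i ^ 3)
      - 2 * ((\<Sum>i\<in>UNIV. \<mu> i ^ 2) * (\<Sum>i\<in>UNIV. \<mu> i ^ 2))"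
  proof -
    have "(\<Sum>i\<in>UNIV. \<Sum>j\<in>UNIV. 2 * (\<mu> i ^ 2 * \<mu> j ^ 2)) =
        2 * ((\<Sum>i\<in>UNIV. \<mu> i ^ 2) * (\<Sum>i\<in>UNIV. \<mu> i ^ 2))"
      unfolding sum_product by (simp add: sum_distrib_left)
    moreover have "(\<Sum>i\<in>UNIV. \<Sum>j\<in>UNIV. \<mu> i ^ 3 * \<mu> j) = (\<Sum>i\<in>UNIV. \<mu> i ^ 3) * (\<Sum>i\<in>UNIV. \<mu> i)"
      "(\<Sum>i\<in>UNIV. \<Sum>j\<in>UNIV. \<mu> i * \<mu> j ^ 3) = (\<Sum>i\<in>UNIV. \<mu> i) * (\<Sum>i\<in>UNIV. \<mu> i ^ 3)"
      unfolding sum_product by (rule refl)+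
    ultimately show ?thesis by (simp only: sum.distrib sum_subtractf)
  qed
  finally show ?thesis by (simp add: power2_eq_square[of "sum _ _"] mult.commute)
qed

text \<open>For large \<open>s\<close> all eigenvalues \<open>d / (1 + s d)\<close> of the resolvent are nonnegative, whatever the
  signs of the \<open>d\<close>.\<close>

lemma resolvent_shift:
  fixes A :: "real ^ 'n ^ 'n"
  assumes A: "transpose A = A"
  obtains s where "det (mat 1 + s *\<^sub>R A) \<noteq> 0"
    "\<And>R B. R ** (mat 1 + s *\<^sub>R A) = mat 1 \<Longrightarrow> B = R ** A \<Longrightarrow>
       (trace (B ** B))\<^sup>2 \<le> trace B * trace (B ** B ** B) \<and>
       ((trace (B ** B))\<^sup>2 = trace B * trace (B ** B ** B) \<longrightarrow> (\<exists>l. A ** A = l *\<^sub>R A))"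
proof -
  obtain e :: "'n \<Rightarrow> real ^ 'n" and d where
    on: "\<And>i j. e i \<bullet> e j = (if i = j then 1 else 0)" and ev: "\<And>i. A *v e i = d i *\<^sub>R e i"
    using symmetric_matrix_eigenbasis[OF A] by blast
  \<comment> \<open>A single \<open>s\<close> above every \<open>1 / \<bar>d i\<bar>\<close>: for
    negative \<open>d i\<close> the denominator \<open>1 + s d i\<close> becomes negative as well. A
    zero eigenvalue contributes \<open>1 / 0 = 0\<close> to the sum, and the summand 1 makes the
    bound strict.\<close>
  define s where "s = 1 + (\<Sum>i\<in>UNIV. 1 / \<bar>d i\<bar>)"
  have s: "s > 1 / \<bar>d i\<bar>" for i
  proof -
    have "1 / \<bar>d i\<bar> \<le> (\<Sum>i\<in>UNIV. 1 / \<bar>d i\<bar>)" by (rule member_le_sum) auto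
    then show ?thesis by (simp add: s_def)
  qed
  have spos: "s > 0" unfolding s_def by (intro add_pos_nonneg sum_nonneg) auto
  define \<mu> where "\<mu> i = d i / (1 + s * d i)" for i
  have nz: "1 + s * d i \<noteq> 0" and \<mu>0: "\<mu> i \<ge> 0" and \<mu>z: "\<mu> i = 0 \<longleftrightarrow> d i = 0" for i
  proof -
    have "1 + s * d i \<noteq> 0 \<and> \<mu> i \<ge> 0 \<and> (\<mu> i = 0 \<longleftrightarrow> d i = 0)"
    proof (cases "d i < 0")
      case True
      then have "s * d i < -1" using s[of i] by (simp add: field_simps)
      then show ?thesis using True by (auto simp: \<mu>_def divide_nonpos_neg)
    next
      case False
      then have "s * d i \<ge> 0" using spos by simp
      then show ?thesis using False by (auto simp: \<mu>_def)
    qed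
    then show "1 + s * d i \<noteq> 0" "\<mu> i \<ge> 0" "\<mu> i = 0 \<longleftrightarrow> d i = 0" by auto
  qed
  have evI: "(mat 1 + s *\<^sub>R A) *v e i = (1 + s * d i) *\<^sub>R e i" for i
    by (simp add: matrix_vector_mult_add_rdistrib scaleR_matrix_vector_assoc[symmetric] ev algebra_simps)
  have "x = 0" if "(mat 1 + s *\<^sub>R A) *v x = 0" for x
  proof -
    have "(x \<bullet> e i) = 0" for i
    proof -
      have "transpose (mat 1 + s *\<^sub>R A) = mat 1 + s *\<^sub>R A"
        using A by (auto simp: transpose_def vec_eq_iff mat_def)
      from symmetric_matrix_inner[OF this, of x "e i"] that
      show ?thesis using nz by (simp add: evI)
    qed
    then show ?thesis using orthonormal_family_expand[OF on, of x] by simp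
  qed
  then have "det (mat 1 + s *\<^sub>R A) \<noteq> 0"
    by (metis invertible_det_nz invertible_left_inverse matrix_left_invertible_ker)
  moreover have "(trace (B ** B))\<^sup>2 \<le> trace B * trace (B ** B ** B) \<and>
       ((trace (B ** B))\<^sup>2 = trace B * trace (B ** B ** B) \<longrightarrow> (\<exists>l. A ** A = l *\<^sub>R A))"
    if R: "R ** (mat 1 + s *\<^sub>R A) = mat 1" and B: "B = R ** A" for R B
  proof -
    have Rv: "R *v ((mat 1 + s *\<^sub>R A) *v x) = x" for x
      using R by (simp add: matrix_vector_mul_assoc)
    have Be: "B *v e i = \<mu> i *\<^sub>R e i" for i
    proof -
      have "(1 + s * d i) *\<^sub>R (B *v e i) = d i *\<^sub>R e i"
      proof -
        have "(1 + s * d i) *\<^sub>R (R *v e i) = e i"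
          using Rv[of "e i"] by (simp add: evI matrix_vector_mult_scaleR)
        moreover have "B *v e i = d i *\<^sub>R (R *v e i)"
          by (simp add: B matrix_vector_mul_assoc[symmetric] ev matrix_vector_mult_scaleR)
        ultimately show ?thesis by (metis scaleR_left_commute)
      qed
      then have "(1 / (1 + s * d i)) *\<^sub>R ((1 + s * d i) *\<^sub>R (B *v e i)) = \<mu> i *\<^sub>R e i"
        by (simp add: \<mu>_def)
      then show ?thesis using nz by simp
    qed
    have t: "trace B = (\<Sum>i\<in>UNIV. \<mu> i)" "trace (B ** B) = (\<Sum>i\<in>UNIV. \<mu> i ^ 2)"
      "trace (B ** B ** B) = (\<Sum>i\<in>UNIV. \<mu> i ^ 3)"
      by (simp_all add: trace_orthonormal_family[OF on] matrix_vector_mul_assoc[symmetric] Be on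
          matrix_vector_mult_scaleR power2_eq_square power3_eq_cube mult.assoc)
    have nonneg: "\<mu> i * \<mu> j * (\<mu> i - \<mu> j)\<^sup>2 \<ge> 0" for i j using \<mu>0 by simp
    have "(\<Sum>i\<in>UNIV. \<Sum>j\<in>UNIV. \<mu> i * \<mu> j * (\<mu> i - \<mu> j)\<^sup>2) \<ge> 0"
      by (intro sum_nonneg nonneg)
    moreover have "\<exists>l. A ** A = l *\<^sub>R A" if "(\<Sum>i\<in>UNIV. \<Sum>j\<in>UNIV. \<mu> i * \<mu> j * (\<mu> i - \<mu> j)\<^sup>2) = 0"
    proof -
      have "(\<Sum>j\<in>UNIV. \<mu> i * \<mu> j * (\<mu> i - \<mu> j)\<^sup>2) = 0" for i
        using that by (subst (asm) sum_nonneg_eq_0_iff) (auto intro!: sum_nonneg nonneg)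
      then have "\<mu> i * \<mu> j * (\<mu> i - \<mu> j)\<^sup>2 = 0" for i j
        by (subst (asm) sum_nonneg_eq_0_iff) (auto intro!: nonneg)
      then have eq: "\<mu> i = \<mu> j" if "d i \<noteq> 0" "d j \<noteq> 0" for i j using that \<mu>z by auto
      have deq: "d i = d j" if "d i \<noteq> 0" "d j \<noteq> 0" for i j
      proof -
        have "d i * (1 + s * d j) = d j * (1 + s * d i)"
          using eq[OF that] nz[of i] nz[of j] by (simp add: \<mu>_def frac_eq_eq)
        then show ?thesis by (simp add: algebra_simps)
      qed
      obtain l where l: "\<And>i. d i \<noteq> 0 \<Longrightarrow> d i = l" using deq by metis
      have "A ** A = l *\<^sub>R A"
      proof (rule orthonormal_family_matrix_eqI[OF on])
        show "(A ** A) *v e i = (l *\<^sub>R A) *v e i" for i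
          using l[of i] by (cases "d i = 0")
            (auto simp: matrix_vector_mul_assoc[symmetric] ev matrix_vector_mult_scaleR scaleR_matrix_vector_assoc[symmetric])
      qed
      then show ?thesis by blast
    qed
    ultimately show ?thesis by (auto simp: t sum_weighted_square_diff)
  qed
  ultimately show thesis using that by blast
qed

subsection \<open>Commuting frames with a unit normal\<close>

definition along :: "('a::real_normed_vector \<Rightarrow> 'a) \<Rightarrow> ('a \<Rightarrow> real) \<Rightarrow> 'a \<Rightarrow> real" where
  "along X h x = frechet_derivative h (at x) (X x)"

lemma along_eqI: "(h has_derivative h') (at x) \<Longrightarrow> along X h x = h' (X x)"
  by (simp add: along_def frechet_derivative_at[symmetric])

lemma along_const: "along X (\<lambda>x. c) x = 0"
  by (simp add: along_def)

lemma along_add: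
  "f differentiable (at x) \<Longrightarrow> g differentiable (at x) \<Longrightarrow>
    along X (\<lambda>x. f x + g x) x = along X f x + along X g x"
  by (subst along_eqI[OF has_derivative_add]) (auto simp: along_def frechet_derivative_works)

lemma along_minus: "f differentiable (at x) \<Longrightarrow> along X (\<lambda>x. - f x) x = - along X f x"
  by (subst along_eqI[OF has_derivative_minus]) (auto simp: along_def frechet_derivative_works)

lemma along_diff:
  "f differentiable (at x) \<Longrightarrow> g differentiable (at x) \<Longrightarrow>
    along X (\<lambda>x. f x - g x) x = along X f x - along X g x"
  by (subst along_eqI[OF has_derivative_diff]) (auto simp: along_def frechet_derivative_works)

lemma along_mult:
  "f differentiable (at x) \<Longrightarrow> g differentiable (at x) \<Longrightarrow>
    along X (\<lambda>x. f x * g x) x = f x * along X g x + along X f x * g x"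
  by (subst along_eqI[OF has_derivative_mult]) (auto simp: along_def frechet_derivative_works)

lemma along_sum:
  "(\<And>i. i \<in> I \<Longrightarrow> f i differentiable (at x)) \<Longrightarrow>
    along X (\<lambda>x. \<Sum>i\<in>I. f i x) x = (\<Sum>i\<in>I. along X (f i) x)"
  by (subst along_eqI[OF has_derivative_sum[where f' = "\<lambda>i. frechet_derivative (f i) (at x)"]])
    (auto simp: along_def frechet_derivative_works)

lemma along_cong:
  assumes "open W" "x \<in> W" "\<And>y. y \<in> W \<Longrightarrow> f y = g y"
  shows "along X f x = along X g x"
proof -
  have "(f has_derivative D) (at x) \<longleftrightarrow> (g has_derivative D) (at x)" for D
    using assms has_derivative_transform_within_open[of f D x UNIV W g]
      has_derivative_transform_within_open[of g D x UNIV W f] by auto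
  then show ?thesis by (simp add: along_def frechet_derivative_def)
qed

lemma along_field_sum:
  assumes "h differentiable (at x)"
  shows "along (\<lambda>x. \<Sum>i\<in>I. c i x *\<^sub>R X i x) h x = (\<Sum>i\<in>I. c i x * along (X i) h x)"
  using linear_frechet_derivative[OF assms]
  by (simp add: along_def linear_sum linear_cmul)

text \<open>\<open>smooth_on\<close> speaks of derivatives in constant directions, so the field is
  expanded in the coordinate basis first.\<close>

lemma smooth_on_along:
  fixes X :: "real ^ 'n \<Rightarrow> real ^ 'n"
  assumes "open W" "smooth_on W X" "smooth_on W h"
  shows "smooth_on W (along X h)"
proof (rule smooth_on_cong[OF assms(1)])
  show "smooth_on W (\<lambda>x. \<Sum>i\<in>UNIV. X x $ i * frechet_derivative h (at x) (axis i 1))"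
    using assms by (intro smooth_on_sum smooth_on_mult smooth_on_nth smooth_on_frechet_derivative)
  fix x assume x: "x \<in> W"
  have "X x = (\<Sum>i\<in>UNIV. X x $ i *\<^sub>R axis i 1)"
    by (simp add: vec_eq_iff axis_def if_distrib[of "(*) _"] cong: if_cong)
  then have "along X h x = frechet_derivative h (at x) (\<Sum>i\<in>UNIV. X x $ i *\<^sub>R axis i 1)"
    by (simp add: along_def)
  also have "\<dots> = (\<Sum>i\<in>UNIV. X x $ i * frechet_derivative h (at x) (axis i 1))"
    using linear_frechet_derivative[OF smooth_on_imp_differentiable[OF assms(3) x]]
    by (simp add: linear_sum linear_cmul)
  finally show "(\<Sum>i\<in>UNIV. X x $ i * frechet_derivative h (at x) (axis i 1)) = along X h x" by simp
qed

lemma triple_sum_swap12: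
  "(\<Sum>k\<in>K. \<Sum>i\<in>I. \<Sum>j\<in>J. g k i j) = (\<Sum>i\<in>I. \<Sum>k\<in>K. \<Sum>j\<in>J. g k i j)"
  by (rule sum.swap)

lemma triple_sum_swap23:
  "(\<Sum>k\<in>K. \<Sum>i\<in>I. \<Sum>j\<in>J. g k i j) = (\<Sum>k\<in>K. \<Sum>j\<in>J. \<Sum>i\<in>I. g k i j)"
  by (intro sum.cong refl sum.swap)

text \<open>The tensor being squared is the tangential part of \<open>S\<close>: the terms with
  \<open>Q\<close> cancel every contraction with \<nu>. Of the cross terms, the three with
  \<open>S\<close> give \<open>-2 q\<close> each, the three squares of the corrections give
  \<open>q\<close> each, and the mixed products of the corrections vanish, which leaves
  \<open>-3 q\<close>.\<close>

lemma tensor_square_expand: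
  fixes S :: "'n::finite \<Rightarrow> 'n \<Rightarrow> 'n \<Rightarrow> real"
  assumes S: "\<And>k i j. S k i j = S i k j" "\<And>k i j. S k i j = S k j i" and Q: "\<And>i j. Q i j = Q j i"
    and \<nu>: "(\<Sum>k\<in>UNIV. (\<nu> k)\<^sup>2) = 1" and S\<nu>: "\<And>i j. (\<Sum>k\<in>UNIV. \<nu> k * S k i j) = - Q i j"
    and Q\<nu>: "\<And>j. (\<Sum>i\<in>UNIV. \<nu> i * Q i j) = 0"
  shows "(\<Sum>k\<in>UNIV. \<Sum>i\<in>UNIV. \<Sum>j\<in>UNIV. (S k i j + \<nu> k * Q i j + \<nu> i * Q k j + \<nu> j * Q k i)\<^sup>2) =
    (\<Sum>k\<in>UNIV. \<Sum>i\<in>UNIV. \<Sum>j\<in>UNIV. (S k i j)\<^sup>2) - 3 * (\<Sum>i\<in>UNIV. \<Sum>j\<in>UNIV. (Q i j)\<^sup>2)"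
proof -
  define q where "q = (\<Sum>i\<in>UNIV. \<Sum>j\<in>UNIV. (Q i j)\<^sup>2)"
  have x1: "(\<Sum>k\<in>UNIV. \<Sum>i\<in>UNIV. \<Sum>j\<in>UNIV. S k i j * (\<nu> k * Q i j)) = - q"
  proof -
    have "(\<Sum>k\<in>UNIV. \<Sum>i\<in>UNIV. \<Sum>j\<in>UNIV. S k i j * (\<nu> k * Q i j)) =
        (\<Sum>i\<in>UNIV. \<Sum>j\<in>UNIV. (\<Sum>k\<in>UNIV. \<nu> k * S k i j) * Q i j)"
      by (subst triple_sum_swap12, subst triple_sum_swap23) (simp add: sum_distrib_right sum_distrib_left ac_simps)
    then show ?thesis by (simp add: S\<nu> q_def sum_negf power2_eq_square)
  qed
  have x2: "(\<Sum>k\<in>UNIV. \<Sum>i\<in>UNIV. \<Sum>j\<in>UNIV. S k i j * (\<nu> i * Q k j)) = - q"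
    by (subst triple_sum_swap12) (subst S(1), rule x1)
  have x3: "(\<Sum>k\<in>UNIV. \<Sum>i\<in>UNIV. \<Sum>j\<in>UNIV. S k i j * (\<nu> j * Q k i)) = - q"
    by (subst triple_sum_swap23) (subst S(2), rule x2)
  have y1: "(\<Sum>k\<in>UNIV. \<Sum>i\<in>UNIV. \<Sum>j\<in>UNIV. (\<nu> k * Q i j)\<^sup>2) = q"
  proof -
    have "(\<Sum>k\<in>UNIV. \<Sum>i\<in>UNIV. \<Sum>j\<in>UNIV. (\<nu> k * Q i j)\<^sup>2) = (\<Sum>k\<in>UNIV. (\<nu> k)\<^sup>2) * q"
      by (simp only: q_def power_mult_distrib sum_distrib_left[symmetric] sum_distrib_right[symmetric])
    then show ?thesis by (simp add: \<nu>)
  qed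
  have y2: "(\<Sum>k\<in>UNIV. \<Sum>i\<in>UNIV. \<Sum>j\<in>UNIV. (\<nu> i * Q k j)\<^sup>2) = q"
    by (subst triple_sum_swap12) (rule y1)
  have y3: "(\<Sum>k\<in>UNIV. \<Sum>i\<in>UNIV. \<Sum>j\<in>UNIV. (\<nu> j * Q k i)\<^sup>2) = q"
    by (subst triple_sum_swap23) (rule y2)
  have z1: "(\<Sum>k\<in>UNIV. \<Sum>i\<in>UNIV. \<Sum>j\<in>UNIV. (\<nu> k * Q i j) * (\<nu> i * Q k j)) = 0"
  proof -
    have "(\<Sum>k\<in>UNIV. \<Sum>i\<in>UNIV. \<Sum>j\<in>UNIV. (\<nu> k * Q i j) * (\<nu> i * Q k j)) =
        (\<Sum>k\<in>UNIV. \<Sum>j\<in>UNIV. \<nu> k * Q k j * (\<Sum>i\<in>UNIV. \<nu> i * Q i j))"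
      by (subst triple_sum_swap23) (simp add: sum_distrib_left ac_simps)
    then show ?thesis by (simp add: Q\<nu>)
  qed
  have z2: "(\<Sum>k\<in>UNIV. \<Sum>i\<in>UNIV. \<Sum>j\<in>UNIV. (\<nu> k * Q i j) * (\<nu> j * Q k i)) = 0"
    by (subst triple_sum_swap23) (subst Q, rule z1)
  have z3: "(\<Sum>k\<in>UNIV. \<Sum>i\<in>UNIV. \<Sum>j\<in>UNIV. (\<nu> i * Q k j) * (\<nu> j * Q k i)) = 0"
  proof -
    have "(\<Sum>k\<in>UNIV. \<Sum>i\<in>UNIV. \<Sum>j\<in>UNIV. (\<nu> i * Q k j) * (\<nu> j * Q k i)) =
        (\<Sum>k\<in>UNIV. \<Sum>i\<in>UNIV. \<nu> i * Q k i * (\<Sum>j\<in>UNIV. \<nu> j * Q j k))"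
      by (simp add: sum_distrib_left ac_simps Q[of _ "_::'n"])
    then show ?thesis by (simp add: Q\<nu>)
  qed
  have "(S k i j + \<nu> k * Q i j + \<nu> i * Q k j + \<nu> j * Q k i)\<^sup>2 =
    (S k i j)\<^sup>2 + 2 * (S k i j * (\<nu> k * Q i j)) + 2 * (S k i j * (\<nu> i * Q k j))
    + 2 * (S k i j * (\<nu> j * Q k i)) + (\<nu> k * Q i j)\<^sup>2 + (\<nu> i * Q k j)\<^sup>2 + (\<nu> j * Q k i)\<^sup>2
    + 2 * ((\<nu> k * Q i j) * (\<nu> i * Q k j)) + 2 * ((\<nu> k * Q i j) * (\<nu> j * Q k i))
    + 2 * ((\<nu> i * Q k j) * (\<nu> j * Q k i))" for k i j
    by (simp add: power2_eq_square algebra_simps)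
  then show ?thesis
    by (simp only: sum.distrib sum_distrib_left[symmetric] x1 x2 x3 y1 y2 y3 z1 z2 z3 q_def[symmetric])
qed

lemma matrix_add_rdistrib: "(A + B) ** C = A ** C + B ** (C :: 'a::semiring_1 ^ 'm ^ 'n)"
  by (simp add: vec_eq_iff matrix_matrix_mult_def distrib_right sum.distrib)

lemma matrix_diff_ldistrib: "A ** (B - C) = A ** B - A ** (C :: real ^ 'm ^ 'n)"
  by (simp add: vec_eq_iff matrix_matrix_mult_def right_diff_distrib sum_subtractf)

lemma scaleR_matrix_mult:
  fixes A :: "real ^ 'm ^ 'n"
  shows "(c *\<^sub>R A) ** B = c *\<^sub>R (A ** B)" "A ** (c *\<^sub>R B) = c *\<^sub>R (A ** B)"
    "(- A) ** B = - (A ** B)"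
  by (simp_all add: vec_eq_iff matrix_matrix_mult_def sum_distrib_left sum_negf ac_simps)

lemma trace_scaleR: "trace (c *\<^sub>R A) = c * trace (A :: real ^ 'n ^ 'n)"
  by (simp add: trace_def sum_distrib_left)

text \<open>The operators act like partial derivatives in flat coordinates, and
  \<open>symmetric\<close> says that \<nu> is a closed unit covector field in them.
  \<open>commute\<close> ranges over functions smooth on any open \<open>W\<close>, since such a
  function need not extend smoothly to \<open>U\<close>; this makes the notion local, see
  \<open>restrict\<close>.\<close>

locale normal_frame =
  fixes U :: "(real ^ 'n::finite) set" and v :: "'n \<Rightarrow> real ^ 'n \<Rightarrow> real ^ 'n"
    and \<nu> :: "'n \<Rightarrow> real ^ 'n \<Rightarrow> real"
  assumes open_U: "open U"
    and smooth_v: "smooth_on U (v k)"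
    and smooth_\<nu>: "smooth_on U (\<nu> k)"
    and unit: "x \<in> U \<Longrightarrow> (\<Sum>k\<in>UNIV. (\<nu> k x)\<^sup>2) = 1"
    and commute: "\<And>W h x. open W \<Longrightarrow> W \<subseteq> U \<Longrightarrow> smooth_on W h \<Longrightarrow> x \<in> W \<Longrightarrow>
      along (v k) (along (v l) h) x = along (v l) (along (v k) h) x"
    and symmetric: "x \<in> U \<Longrightarrow> along (v k) (\<nu> l) x = along (v l) (\<nu> k) x"
begin

abbreviation E :: "'n \<Rightarrow> (real ^ 'n \<Rightarrow> real) \<Rightarrow> real ^ 'n \<Rightarrow> real" where
  "E k \<equiv> along (v k)"

definition A :: "'n \<Rightarrow> 'n \<Rightarrow> real ^ 'n \<Rightarrow> real" where
  "A i j = E i (\<nu> j)"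

definition shape :: "real ^ 'n \<Rightarrow> real ^ 'n ^ 'n" where
  "shape x = (\<chi> i j. A i j x)"

definition EM :: "'n \<Rightarrow> (real ^ 'n \<Rightarrow> real ^ 'n ^ 'n) \<Rightarrow> real ^ 'n \<Rightarrow> real ^ 'n ^ 'n" where
  "EM k M x = (\<chi> i j. E k (\<lambda>x. M x $ i $ j) x)"

definition smoothM :: "(real ^ 'n \<Rightarrow> real ^ 'n ^ 'n) \<Rightarrow> bool" where
  "smoothM M \<longleftrightarrow> (\<forall>i j. smooth_on U (\<lambda>x. M x $ i $ j))"

text \<open>Power sums of the eigenvalues of the shape operator. Unlike the eigenvalues themselves,
  they are smooth also where multiplicities change.\<close>

definition p :: "nat \<Rightarrow> real ^ 'n \<Rightarrow> real" where
  "p k x = trace (matrix_power (shape x) k)"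

lemma restrict: "open V \<Longrightarrow> V \<subseteq> U \<Longrightarrow> normal_frame V v \<nu>"
  by unfold_locales
    (use smooth_on_subset[OF smooth_v] smooth_on_subset[OF smooth_\<nu>] unit symmetric commute in
      \<open>auto intro: commute\<close>)

lemma smooth_E: "smooth_on U h \<Longrightarrow> smooth_on U (E k h)"
  using smooth_on_along open_U smooth_v by blast

lemma smooth_A: "smooth_on U (A i j)"
  unfolding A_def by (intro smooth_E smooth_\<nu>)

lemma A_sym: "x \<in> U \<Longrightarrow> A i j x = A j i x"
  by (simp add: A_def symmetric)

lemma E_cong: "x \<in> U \<Longrightarrow> (\<And>y. y \<in> U \<Longrightarrow> f y = g y) \<Longrightarrow> E k f x = E k g x"
  using along_cong open_U by blast

lemma E_const_eq: "x \<in> U \<Longrightarrow> (\<And>y. y \<in> U \<Longrightarrow> f y = c) \<Longrightarrow> E k f x = 0"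
  using E_cong[of x f "\<lambda>x. c"] by (simp add: along_const)

lemma E_add: "x \<in> U \<Longrightarrow> smooth_on U f \<Longrightarrow> smooth_on U g \<Longrightarrow>
    E k (\<lambda>x. f x + g x) x = E k f x + E k g x"
  by (simp add: along_add smooth_on_imp_differentiable)

lemma E_minus: "x \<in> U \<Longrightarrow> smooth_on U f \<Longrightarrow> E k (\<lambda>x. - f x) x = - E k f x"
  by (simp add: along_minus smooth_on_imp_differentiable)

lemma E_mult: "x \<in> U \<Longrightarrow> smooth_on U f \<Longrightarrow> smooth_on U g \<Longrightarrow>
    E k (\<lambda>x. f x * g x) x = f x * E k g x + E k f x * g x"
  by (simp add: along_mult smooth_on_imp_differentiable)

lemma E_cmult: "x \<in> U \<Longrightarrow> smooth_on U g \<Longrightarrow> E k (\<lambda>x. c * g x) x = c * E k g x"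
  using E_mult[OF _ smooth_on_const[OF open_U], of x g k c] by (simp add: along_const)

lemma E_sum: "x \<in> U \<Longrightarrow> (\<And>i. i \<in> I \<Longrightarrow> smooth_on U (f i)) \<Longrightarrow>
    E k (\<lambda>x. \<Sum>i\<in>I. f i x) x = (\<Sum>i\<in>I. E k (f i) x)"
  by (rule along_sum) (auto intro: smooth_on_imp_differentiable)

lemma E_commute: "x \<in> U \<Longrightarrow> smooth_on U h \<Longrightarrow> E k (E l h) x = E l (E k h) x"
  using commute[OF open_U] by blast

lemma E_\<nu>: "E i (\<nu> j) = A i j"
  by (simp add: A_def)

section \<open>Codazzi and Riccati equations\<close>

lemma A_normal: assumes "x \<in> U" shows "(\<Sum>j\<in>UNIV. \<nu> j x * A i j x) = 0"
proof -
  have "0 = E i (\<lambda>x. \<Sum>k\<in>UNIV. \<nu> k x * \<nu> k x) x"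
    using E_const_eq[OF assms, of "\<lambda>x. \<Sum>k\<in>UNIV. \<nu> k x * \<nu> k x" 1] unit by (simp add: power2_eq_square)
  also have "\<dots> = (\<Sum>k\<in>UNIV. 2 * (\<nu> k x * A i k x))"
    using assms by (subst E_sum) (auto simp: E_mult smooth_\<nu> smooth_on_mult open_U E_\<nu>)
  finally show ?thesis by (simp add: sum_distrib_left[symmetric])
qed

text \<open>The Codazzi equation: \<open>A\<close> is itself a derivative of \<nu>, and the frame
  operators commute. Together with the symmetry of \<open>A\<close> the derivative of
  \<open>A\<close> is totally symmetric.\<close>

lemma EA_sym1: assumes "x \<in> U" shows "E k (A i j) x = E i (A k j) x"
  unfolding A_def using E_commute[OF assms smooth_\<nu>] .

lemma EA_sym2: assumes "x \<in> U" shows "E k (A i j) x = E k (A j i) x"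
  using assms A_sym by (rule E_cong)

text \<open>The Riccati equation in the normal direction: differentiate \<open>A \<nu> = 0\<close>
  and use the Codazzi equation to move the derivative onto the normal index.\<close>

lemma EA_normal: assumes "x \<in> U"
  shows "(\<Sum>k\<in>UNIV. \<nu> k x * E k (A i j) x) = - (\<Sum>k\<in>UNIV. A i k x * A k j x)"
proof -
  have "0 = E i (\<lambda>x. \<Sum>k\<in>UNIV. \<nu> k x * A j k x) x"
    using E_const_eq[OF assms, of "\<lambda>x. \<Sum>k\<in>UNIV. \<nu> k x * A j k x" 0] A_normal by simp
  also have "\<dots> = (\<Sum>k\<in>UNIV. \<nu> k x * E i (A j k) x + A i k x * A j k x)"
    using assms by (subst E_sum) (auto simp: E_mult smooth_\<nu> smooth_A smooth_on_mult open_U E_\<nu>)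
  also have "\<dots> = (\<Sum>k\<in>UNIV. \<nu> k x * E k (A i j) x) + (\<Sum>k\<in>UNIV. A i k x * A k j x)"
    using EA_sym1[OF assms, of i] EA_sym2[OF assms, of i j] A_sym[OF assms, of j]
    by (simp add: sum.distrib)
  finally show ?thesis by simp
qed

lemma shape_transpose: "x \<in> U \<Longrightarrow> transpose (shape x) = shape x"
  using A_sym by (simp add: shape_def transpose_def vec_eq_iff)

lemma shape_normal: "x \<in> U \<Longrightarrow> shape x *v (\<chi> i. \<nu> i x) = 0"
  using A_normal by (simp add: shape_def matrix_vector_mult_def vec_eq_iff mult.commute)

lemma smoothM_shape: "smoothM shape"
  by (simp add: smoothM_def shape_def smooth_A)

lemma smoothM_mult: "smoothM M \<Longrightarrow> smoothM N \<Longrightarrow> smoothM (\<lambda>x. M x ** N x)"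
  by (auto simp: smoothM_def matrix_matrix_mult_def intro!: smooth_on_sum smooth_on_mult open_U)

lemma smoothM_power: "smoothM M \<Longrightarrow> smoothM (\<lambda>x. matrix_power (M x) k)"
proof (induction k)
  case 0
  then show ?case by (simp add: smoothM_def smooth_on_const open_U)
next
  case (Suc k)
  then show ?case by (simp add: smoothM_mult)
qed

lemma smooth_trace: "smoothM M \<Longrightarrow> smooth_on U (\<lambda>x. trace (M x))"
  unfolding trace_def smoothM_def by (intro smooth_on_sum open_U) auto

lemma EM_mult:
  assumes "x \<in> U" "smoothM M" "smoothM N"
  shows "EM k (\<lambda>x. M x ** N x) x = EM k M x ** N x + M x ** EM k N x"
proof -
  have *: "smooth_on U (\<lambda>x. M x $ i $ j)" "smooth_on U (\<lambda>x. N x $ i $ j)" for i j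
    using assms by (auto simp: smoothM_def)
  have "E k (\<lambda>x. \<Sum>l\<in>UNIV. M x $ i $ l * N x $ l $ j) x =
    (\<Sum>l\<in>UNIV. M x $ i $ l * E k (\<lambda>x. N x $ l $ j) x + E k (\<lambda>x. M x $ i $ l) x * N x $ l $ j)" for i j
    using assms(1) * by (subst E_sum) (auto simp: E_mult smooth_on_mult open_U)
  then show ?thesis
    by (simp add: EM_def matrix_matrix_mult_def vec_eq_iff sum.distrib add.commute)
qed

lemma E_trace:
  assumes "x \<in> U" "smoothM M"
  shows "E k (\<lambda>x. trace (M x)) x = trace (EM k M x)"
  unfolding trace_def EM_def using assms by (subst E_sum) (auto simp: smoothM_def)

lemma EM_const: "EM k (\<lambda>x. M) x = 0"
  by (simp add: EM_def vec_eq_iff along_const)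

lemma matrix_power_add: "matrix_power M (k + l) = matrix_power M k ** matrix_power M l"
  by (induction k) (simp_all add: matrix_mul_assoc)

text \<open>The trailing power \<open>l\<close> carries the induction: the product rule releases a
  factor \<open>shape x\<close> on the left, and cyclicity of the trace moves it to the right end.
  For \<open>k = 0\<close> the truncated exponent does no harm, because the prefactor is 0.\<close>

lemma trace_EM_power:
  assumes "x \<in> U"
  shows "trace (EM m (\<lambda>x. matrix_power (shape x) k) x ** matrix_power (shape x) l) =
    real k * trace (matrix_power (shape x) (k + l - 1) ** EM m shape x)"
proof (induction k arbitrary: l)
  case 0
  then show ?case by (simp add: EM_const trace_def)
next
  case (Suc k)
  let ?P = "matrix_power (shape x)"
  have "trace (EM m (\<lambda>x. matrix_power (shape x) (Suc k)) x ** ?P l) =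
    trace (EM m shape x ** ?P k ** ?P l) +
    trace (shape x ** EM m (\<lambda>x. matrix_power (shape x) k) x ** ?P l)"
    using EM_mult[OF assms smoothM_shape smoothM_power[OF smoothM_shape]]
    by (simp add: matrix_add_rdistrib trace_add)
  also have "trace (EM m shape x ** ?P k ** ?P l) = trace (?P (k + l) ** EM m shape x)"
    by (metis matrix_mul_assoc matrix_power_add trace_mul_sym)
  also have "trace (shape x ** EM m (\<lambda>x. matrix_power (shape x) k) x ** ?P l) =
    trace (EM m (\<lambda>x. matrix_power (shape x) k) x ** ?P (l + 1))"
  proof -
    have "?P (l + 1) = ?P l ** shape x" by (simp only: matrix_power_add) simp
    then show ?thesis by (metis matrix_mul_assoc trace_mul_sym)
  qed
  also have "\<dots> = k * trace (?P (k + l) ** EM m shape x)" using Suc.IH[of "l + 1"] by (simp only: add_Suc_right Suc_eq_plus1[symmetric] diff_Suc_1)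
  finally show ?case by (simp add: algebra_simps)
qed

lemma smooth_p: "smooth_on U (p k)"
  unfolding p_def[abs_def] by (intro smooth_trace smoothM_power smoothM_shape)

lemma E_p:
  assumes "x \<in> U"
  shows "E m (p (Suc k)) x = real (Suc k) * trace (matrix_power (shape x) k ** EM m shape x)"
  using E_trace[OF assms smoothM_power[OF smoothM_shape, of "Suc k"], of m] trace_EM_power[OF assms, of m "Suc k" 0]
  by (simp add: p_def[abs_def])

lemma EM_shape_normal:
  assumes "x \<in> U"
  shows "(\<Sum>m\<in>UNIV. \<nu> m x *\<^sub>R EM m shape x) = - (shape x ** shape x)"
  using EA_normal[OF assms] by (simp add: vec_eq_iff EM_def shape_def matrix_matrix_mult_def)

lemma trace_mult_EM_shape_normal:
  assumes "x \<in> U"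
  shows "(\<Sum>m\<in>UNIV. \<nu> m x * trace (M ** EM m shape x)) = - trace (M ** (shape x ** shape x))"
proof -
  have lin: "linear (\<lambda>X. trace (M ** X))"
    by (rule linearI) (simp_all add: matrix_add_ldistrib trace_add trace_def matrix_matrix_mult_def
        sum_distrib_left mult.left_commute distrib_left sum.distrib)
  have "(\<Sum>m\<in>UNIV. \<nu> m x * trace (M ** EM m shape x)) = trace (M ** (\<Sum>m\<in>UNIV. \<nu> m x *\<^sub>R EM m shape x))"
    using linear_sum[OF lin, of "\<lambda>m. \<nu> m x *\<^sub>R EM m shape x" UNIV] linear_cmul[OF lin] by simp
  also have "\<dots> = - trace (M ** (shape x ** shape x))"
    unfolding EM_shape_normal[OF assms] using linear_neg[OF lin] by simp
  finally show ?thesis .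
qed

lemma matrix_power_mult_square: "matrix_power M k ** (M ** M) = matrix_power M (k + 2)"
  using matrix_power_add[of M k 2] by (simp add: numeral_2_eq_2)

text \<open>The trace of the Riccati equation. Along the normal each power sum is driven by the next
  one, so information about one power sum passes on to its successor.\<close>

lemma E_p_normal:
  assumes "x \<in> U"
  shows "(\<Sum>m\<in>UNIV. \<nu> m x * E m (p (Suc k)) x) = - real (Suc k) * p (k + 2) x"
proof -
  have "(\<Sum>m\<in>UNIV. \<nu> m x * E m (p (Suc k)) x) =
    real (Suc k) * (\<Sum>m\<in>UNIV. \<nu> m x * trace (matrix_power (shape x) k ** EM m shape x))"
    by (simp only: E_p[OF assms] sum_distrib_left mult.left_commute)
  then show ?thesis
    unfolding trace_mult_EM_shape_normal[OF assms] matrix_power_mult_square p_def by (simp add: algebra_simps)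
qed

text \<open>The Hessian of \<open>f\<close> is symmetric and so is its part \<open>g A\<close>;
  hence \<open>E j g\<close> times \<open>\<nu> k\<close> is symmetric in \<open>j\<close> and
  \<open>k\<close>. Contracting with the unit vector \<nu> yields the claim.\<close>

lemma normal_of_normal:
  assumes "smooth_on U f" "smooth_on U g" "\<And>y k. y \<in> U \<Longrightarrow> E k f y = g y * \<nu> k y" "x \<in> U"
  shows "E k g x = (\<Sum>j\<in>UNIV. \<nu> j x * E j g x) * \<nu> k x"
proof -
  have E2: "E j (E k f) x = g x * A j k x + E j g x * \<nu> k x" for j k
  proof -
    have "E j (E k f) x = E j (\<lambda>y. g y * \<nu> k y) x" using assms by (intro E_cong)
    then show ?thesis by (simp add: E_mult assms smooth_\<nu> E_\<nu>)
  qed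
  have *: "E k g x * \<nu> j x = E j g x * \<nu> k x" for j
    using E2[of j k] E2[of k j] E_commute[OF assms(4,1), of j k] A_sym[OF assms(4), of j k] by simp
  have "E k g x = (\<Sum>j\<in>UNIV. (\<nu> j x)\<^sup>2) * E k g x" using unit assms by simp
  also have "\<dots> = (\<Sum>j\<in>UNIV. \<nu> j x * (E k g x * \<nu> j x))"
    by (simp add: sum_distrib_right sum_distrib_left power2_eq_square ac_simps)
  also have "\<dots> = (\<Sum>j\<in>UNIV. \<nu> j x * E j g x) * \<nu> k x"
    by (simp add: * sum_distrib_right mult.assoc)
  finally show ?thesis .
qed


text \<open>The Simons-type identity that replaces Cartan's formula: the Laplacian of \<open>p 2\<close> is computed
  once from \<open>p 2\<close> being a function of the level and once from \<open>p 2 = \<Sum> A\<^sub>i\<^sub>j\<^sup>2\<close>.\<close>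

theorem tangential_derivative_norm:
  assumes p1: "\<And>y k. y \<in> U \<Longrightarrow> E k (p 1) y = - p 2 y * \<nu> k y" and x: "x \<in> U"
  defines "Q \<equiv> \<lambda>i j. (shape x ** shape x) $ i $ j"
  shows "(\<Sum>k\<in>UNIV. \<Sum>i\<in>UNIV. \<Sum>j\<in>UNIV.
      (E k (A i j) x + \<nu> k x * Q i j + \<nu> i x * Q k j + \<nu> j x * Q k i)\<^sup>2) =
    (p 2 x)\<^sup>2 - p 1 x * p 3 x"
proof -
  note sm = smooth_p smooth_A smooth_\<nu> smooth_E smooth_on_mult smooth_on_minus smooth_on_sum
    smooth_on_const open_U
  have Q: "Q i j = (\<Sum>k\<in>UNIV. A i k x * A k j x)" for i j
    by (simp add: Q_def matrix_matrix_mult_def shape_def)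
  have Qsym: "Q i j = Q j i" for i j
    unfolding Q by (intro sum.cong refl) (metis A_sym x mult.commute)
  have p2: "p 2 y = (\<Sum>i\<in>UNIV. \<Sum>j\<in>UNIV. A i j y * A i j y)" if "y \<in> U" for y
  proof -
    have "p 2 y = trace (shape y ** shape y)" by (simp add: p_def numeral_2_eq_2)
    also have "\<dots> = (\<Sum>i\<in>UNIV. \<Sum>j\<in>UNIV. A i j y * A j i y)"
      by (simp add: trace_def matrix_matrix_mult_def shape_def)
    finally show ?thesis using A_sym[OF that] by (metis (no_types, lifting) sum.cong)
  qed
  have p4: "p 4 x = (\<Sum>i\<in>UNIV. \<Sum>j\<in>UNIV. (Q i j)\<^sup>2)"
  proof -
    have "matrix_power (shape x) 4 = (shape x ** shape x) ** (shape x ** shape x)"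
      by (simp add: numeral_eq_Suc matrix_mul_assoc)
    then have "p 4 x = (\<Sum>i\<in>UNIV. \<Sum>j\<in>UNIV. Q i j * Q j i)"
      by (simp add: p_def trace_def matrix_matrix_mult_def[of "shape x ** shape x"] Q_def)
    then show ?thesis unfolding power2_eq_square using Qsym by (metis (no_types, lifting) sum.cong)
  qed
  have p1': "p 1 y = (\<Sum>i\<in>UNIV. A i i y)" for y
    by (simp add: p_def trace_def shape_def)
  \<comment> \<open>\<open>normal_of_normal\<close>, applied to \<open>p 1\<close> with factor
    \<open>- p 2\<close>, gives the direction of the gradient of \<open>p 2\<close>, and
    \<open>E_p_normal\<close> its length.\<close>
  have dp2: "E k (p 2) y = -2 * (p 3 y * \<nu> k y)" if y: "y \<in> U" for k y
  proof -
    have g: "smooth_on U (\<lambda>y. - p 2 y)" by (intro sm)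
    have "E k (\<lambda>y. - p 2 y) y = (\<Sum>j\<in>UNIV. \<nu> j y * E j (\<lambda>y. - p 2 y) y) * \<nu> k y"
      by (rule normal_of_normal[OF smooth_p g _ y]) (rule p1)
    then have "E k (p 2) y = (\<Sum>j\<in>UNIV. \<nu> j y * E j (p 2) y) * \<nu> k y"
      by (simp add: E_minus y smooth_p sum_negf)
    then show ?thesis using E_p_normal[OF y, of 1] by (simp add: numeral_2_eq_2 numeral_3_eq_3)
  qed
  have EEp1: "E i (E j (p 1)) x = 2 * p 3 x * \<nu> i x * \<nu> j x - p 2 x * A i j x" for i j
  proof -
    have "E i (E j (p 1)) x = E i (\<lambda>y. - p 2 y * \<nu> j y) x" by (rule E_cong[OF x p1])
    also have "\<dots> = - p 2 x * A i j x - E i (p 2) x * \<nu> j x"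
      using E_mult[OF x, of "\<lambda>y. - p 2 y" "\<nu> j" i] by (simp add: sm E_minus x E_\<nu>)
    finally show ?thesis by (simp add: dp2[OF x])
  qed
  \<comment> \<open>Total symmetry of the derivative of \<open>A\<close> and commutation exchange
    the index pair \<open>k, k\<close> of the Laplacian with \<open>i, j\<close>. Since the frame is
    flat and the sum includes the normal direction, no curvature terms arise.\<close>
  have lapA: "(\<Sum>k\<in>UNIV. E k (E k (A i j)) x) = E i (E j (p 1)) x" for i j
  proof -
    have "E k (E k (A i j)) x = E i (E j (A k k)) x" for k
    proof -
      have "E k (E k (A i j)) x = E k (E i (A k j)) x"
        using EA_sym1 by (intro E_cong[OF x])
      also have "\<dots> = E i (E k (A k j)) x" by (intro E_commute x sm)
      also have "\<dots> = E i (E j (A k k)) x"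
      proof (rule E_cong[OF x])
        show "E k (A k j) y = E j (A k k) y" if "y \<in> U" for y
          using EA_sym1[OF that, of k j k] EA_sym2[OF that, of k k j] by simp
      qed
      finally show ?thesis .
    qed
    moreover have "E i (E j (p 1)) x = E i (\<lambda>y. \<Sum>k\<in>UNIV. E j (A k k) y) x"
      unfolding p1'[abs_def] by (intro E_cong[OF x] E_sum sm)
    ultimately show ?thesis by (simp add: E_sum x sm)
  qed
  \<comment> \<open>First computation: the divergence of the gradient \<open>- 2 p 3 \<nu>\<close>.
    The term \<open>6 p 4\<close> comes from the normal derivative \<open>- 3 p 4\<close> of
    \<open>p 3\<close>.\<close>
  have lap1: "(\<Sum>k\<in>UNIV. E k (E k (p 2)) x) = 6 * p 4 x - 2 * p 3 x * p 1 x"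
  proof -
    have "E k (E k (p 2)) x = -2 * (p 3 x * A k k x) - 2 * (\<nu> k x * E k (p 3) x)" for k
    proof -
      have "E k (E k (p 2)) x = E k (\<lambda>y. -2 * (p 3 y * \<nu> k y)) x" by (rule E_cong[OF x dp2])
      also have "\<dots> = -2 * E k (\<lambda>y. p 3 y * \<nu> k y) x" by (intro E_cmult x sm)
      finally show ?thesis by (simp add: E_mult x sm E_\<nu>)
    qed
    then have "(\<Sum>k\<in>UNIV. E k (E k (p 2)) x) =
        -2 * (p 3 x * (\<Sum>k\<in>UNIV. A k k x)) - 2 * (\<Sum>k\<in>UNIV. \<nu> k x * E k (p 3) x)"
      by (simp only: sum_subtractf sum_distrib_left)
    also have "(\<Sum>k\<in>UNIV. \<nu> k x * E k (p 3) x) = -3 * p 4 x"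
      using E_p_normal[OF x, of 2] by (simp add: numeral_eq_Suc)
    finally show ?thesis by (simp add: p1'[symmetric])
  qed
  define s where "s = (\<Sum>k\<in>UNIV. \<Sum>i\<in>UNIV. \<Sum>j\<in>UNIV. (E k (A i j) x)\<^sup>2)"
  \<comment> \<open>Second computation: Laplacian of the sum of squares, with the Laplacian of
    \<open>A\<close> replaced by the Hessian of \<open>p 1\<close>. The part of that Hessian along
    \<open>\<nu> \<nu>\<^sup>T\<close> is lost because \<open>A \<nu> = 0\<close>.\<close>
  have lap2: "(\<Sum>k\<in>UNIV. E k (E k (p 2)) x) = 2 * s - 2 * (p 2 x)\<^sup>2"
  proof -
    have Ep2: "E k (p 2) y = (\<Sum>i\<in>UNIV. \<Sum>j\<in>UNIV. 2 * (A i j y * E k (A i j) y))" if y: "y \<in> U" for k y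
    proof -
      have "E k (p 2) y = E k (\<lambda>y. \<Sum>i\<in>UNIV. \<Sum>j\<in>UNIV. A i j y * A i j y) y"
        by (rule E_cong[OF y p2])
      then show ?thesis using y by (simp add: E_sum E_mult sm mult.commute[of "E _ _ _"])
    qed
    have "E k (E k (p 2)) x =
      (\<Sum>i\<in>UNIV. \<Sum>j\<in>UNIV. 2 * (A i j x * E k (E k (A i j)) x) + 2 * (E k (A i j) x)\<^sup>2)" for k
    proof -
      have "E k (E k (p 2)) x = E k (\<lambda>y. \<Sum>i\<in>UNIV. \<Sum>j\<in>UNIV. 2 * (A i j y * E k (A i j) y)) x"
        by (rule E_cong[OF x Ep2])
      then show ?thesis using x
        by (simp add: E_sum E_cmult E_mult sm power2_eq_square distrib_left)
    qed
    then have "(\<Sum>k\<in>UNIV. E k (E k (p 2)) x) =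
      (\<Sum>k\<in>UNIV. \<Sum>i\<in>UNIV. \<Sum>j\<in>UNIV. 2 * (A i j x * E k (E k (A i j)) x)) + 2 * s"
      by (simp only: sum.distrib s_def sum_distrib_left)
    also have "(\<Sum>k\<in>UNIV. \<Sum>i\<in>UNIV. \<Sum>j\<in>UNIV. 2 * (A i j x * E k (E k (A i j)) x)) =
      (\<Sum>i\<in>UNIV. \<Sum>j\<in>UNIV. 2 * (A i j x * (\<Sum>k\<in>UNIV. E k (E k (A i j)) x)))"
      by (subst triple_sum_swap12, subst triple_sum_swap23) (simp only: sum_distrib_left)
    also have "\<dots> = (\<Sum>i\<in>UNIV. \<Sum>j\<in>UNIV.
        4 * p 3 x * (\<nu> i x * (\<nu> j x * A i j x)) - 2 * p 2 x * (A i j x * A i j x))"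
      unfolding lapA EEp1 by (simp add: algebra_simps)
    also have "\<dots> = 4 * p 3 x * (\<Sum>i\<in>UNIV. \<nu> i x * (\<Sum>j\<in>UNIV. \<nu> j x * A i j x))
        - 2 * p 2 x * p 2 x"
      by (simp only: sum_subtractf p2[OF x] sum_distrib_left[symmetric])
    finally show ?thesis by (simp add: A_normal[OF x] power2_eq_square)
  qed
  \<comment> \<open>Passing to the tangential part costs \<open>3 p 4\<close>, exactly half of the
    \<open>6 p 4\<close> in \<open>lap1\<close>, so \<open>p 4\<close> disappears when the two
    computations are compared.\<close>
  have "(\<Sum>k\<in>UNIV. \<Sum>i\<in>UNIV. \<Sum>j\<in>UNIV.
      (E k (A i j) x + \<nu> k x * Q i j + \<nu> i x * Q k j + \<nu> j x * Q k i)\<^sup>2) = s - 3 * p 4 x"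
    unfolding s_def p4
  proof (rule tensor_square_expand)
    show "E k (A i j) x = E i (A k j) x" for k i j by (rule EA_sym1[OF x])
    show "E k (A i j) x = E k (A j i) x" for k i j by (rule EA_sym2[OF x])
    show "(\<Sum>k\<in>UNIV. \<nu> k x * E k (A i j) x) = - Q i j" for i j
      unfolding Q by (rule EA_normal[OF x])
    show "(\<Sum>i\<in>UNIV. \<nu> i x * Q i j) = 0" for j
    proof -
      have "(\<Sum>i\<in>UNIV. \<nu> i x * Q i j) = (\<Sum>k\<in>UNIV. (\<Sum>i\<in>UNIV. \<nu> i x * A k i x) * A k j x)"
        unfolding Q sum_distrib_left sum_distrib_right
        by (subst sum.swap) (simp add: A_sym[OF x, of _ "_::'n"] ac_simps)
      then show ?thesis by (simp add: A_normal[OF x])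
    qed
  qed (use Qsym unit[OF x] in auto)
  moreover have "2 * s - 2 * (p 2 x)\<^sup>2 = 6 * p 4 x - 2 * p 3 x * p 1 x" using lap1 lap2 by simp
  ultimately show ?thesis by (simp add: algebra_simps)
qed


context
  assumes p1_normal: "\<And>y k. y \<in> U \<Longrightarrow> E k (p 1) y = - p 2 y * \<nu> k y"
begin

text \<open>Adding \<open>\<nu> m\<close> times the square of the shape operator removes the normal
  component in the index \<open>m\<close>, so this says that all power sums are constant along the
  levels. \<open>normal_of_normal\<close> passes this from each power sum to the next, and the trace
  form is what \<open>trace_resolvent_eq_0\<close> needs.\<close>

lemma trace_power_normal:
  "x \<in> U \<Longrightarrow> trace (matrix_power (shape x) k ** (EM m shape x + \<nu> m x *\<^sub>R (shape x ** shape x))) = 0"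
proof (induction k arbitrary: x m)
  case 0
  then show ?case using p1_normal[of x m] E_p[of x m 0]
    by (simp add: trace_add trace_scaleR p_def numeral_2_eq_2)
next
  case (Suc k)
  have tr: "trace (M ** (X + c *\<^sub>R Y)) = trace (M ** X) + c * trace (M ** Y)" for M X Y :: "real ^ 'n ^ 'n" and c
    by (simp add: matrix_add_ldistrib trace_add trace_scaleR scaleR_matrix_mult)
  have eq: "E j (p (Suc k)) y = (- real (Suc k) * p (Suc (Suc k)) y) * \<nu> j y" if y: "y \<in> U" for j y
  proof -
    have t: "trace (matrix_power (shape y) k ** EM j shape y) = - (p (Suc (Suc k)) y * \<nu> j y)"
      using Suc.IH[OF y, of j] unfolding tr matrix_power_mult_square p_def by (simp add: mult.commute)
    show ?thesis unfolding E_p[OF y] t by (simp add: algebra_simps)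
  qed
  define q where "q y = - real (Suc k) * p (Suc (Suc k)) y" for y
  have q: "smooth_on U q" unfolding q_def[abs_def]
    by (intro smooth_on_mult smooth_on_const open_U smooth_p)
  have "E m q x = (\<Sum>j\<in>UNIV. \<nu> j x * E j q x) * \<nu> m x"
    by (rule normal_of_normal[OF smooth_p[of "Suc k"] q _ Suc.prems]) (simp only: eq q_def)
  moreover have "E j q x = - real (Suc k) * E j (p (Suc (Suc k))) x" for j
    unfolding q_def[abs_def] by (rule E_cmult[OF Suc.prems smooth_p])
  ultimately have "real (Suc k) * E m (p (Suc (Suc k))) x =
      real (Suc k) * ((\<Sum>j\<in>UNIV. \<nu> j x * E j (p (Suc (Suc k))) x) * \<nu> m x)"
    by (simp only: mult_minus_left mult.left_commute[of "\<nu> _ _"] sum_negf sum_distrib_left[symmetric]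
        mult.assoc mult_minus_right neg_equal_iff_equal)
  then have "E m (p (Suc (Suc k))) x = - real (Suc (Suc k)) * p (Suc k + 2) x * \<nu> m x"
    unfolding E_p_normal[OF Suc.prems] by (simp only: mult_left_cancel of_nat_eq_0_iff nat.distinct not_False_eq_True)
  then have "real (Suc (Suc k)) * trace (matrix_power (shape x) (Suc k) ** EM m shape x) =
      real (Suc (Suc k)) * (- (p (Suc k + 2) x * \<nu> m x))"
    unfolding E_p[OF Suc.prems] by (simp add: algebra_simps)
  then have "trace (matrix_power (shape x) (Suc k) ** EM m shape x) = - (p (Suc k + 2) x * \<nu> m x)"
    by (simp only: mult_left_cancel of_nat_eq_0_iff nat.distinct not_False_eq_True)
  then show ?case unfolding tr matrix_power_mult_square p_def by simp
qed

end

section \<open>The parallel frame\<close>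

context
  fixes s :: real
  assumes nz: "\<And>x. x \<in> U \<Longrightarrow> det (mat 1 + s *\<^sub>R shape x) \<noteq> 0"
begin

definition R :: "real ^ 'n \<Rightarrow> real ^ 'n ^ 'n" where
  "R x = matrix_inv (mat 1 + s *\<^sub>R shape x)"

text \<open>The coordinate frame of the map \<open>x \<mapsto> x + s \<nu>(x)\<close> onto the parallel surface.\<close>

definition parallel_field :: "'n \<Rightarrow> real ^ 'n \<Rightarrow> real ^ 'n" where
  "parallel_field k x = (\<Sum>l\<in>UNIV. R x $ k $ l *\<^sub>R v l x)"

lemma R_inverse:
  assumes "x \<in> U"
  shows "R x ** (mat 1 + s *\<^sub>R shape x) = mat 1" "(mat 1 + s *\<^sub>R shape x) ** R x = mat 1"
  using matrix_inv_inverse[OF nz[OF assms]] by (auto simp: R_def)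

lemma R_commute: assumes "x \<in> U" shows "R x ** shape x = shape x ** R x"
proof -
  let ?G = "mat 1 + s *\<^sub>R shape x"
  have G: "?G ** shape x = shape x ** ?G"
    by (simp add: matrix_add_rdistrib matrix_add_ldistrib scaleR_matrix_mult)
  have "R x ** shape x = R x ** shape x ** (?G ** R x)" using R_inverse[OF assms] by simp
  also have "\<dots> = R x ** (?G ** shape x) ** R x" by (simp add: matrix_mul_assoc[symmetric] G)
  also have "\<dots> = shape x ** R x" by (simp add: matrix_mul_assoc R_inverse[OF assms])
  finally show ?thesis .
qed

lemma R_transpose: assumes "x \<in> U" shows "transpose (R x) = R x"
proof -
  let ?G = "mat 1 + s *\<^sub>R shape x"
  have G: "transpose ?G = ?G"
    using shape_transpose[OF assms] by (auto simp: transpose_def vec_eq_iff mat_def)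
  have "transpose (R x) ** ?G = mat 1"
    using arg_cong[OF R_inverse(2)[OF assms], of transpose] by (simp add: matrix_transpose_mul G transpose_mat)
  then have "transpose (R x) ** (?G ** R x) = R x" by (simp add: matrix_mul_assoc)
  then show ?thesis by (simp add: R_inverse[OF assms])
qed

lemma R_normal: assumes "x \<in> U" shows "R x *v (\<chi> i. \<nu> i x) = (\<chi> i. \<nu> i x)"
proof -
  have "(mat 1 + s *\<^sub>R shape x) *v (\<chi> i. \<nu> i x) = (\<chi> i. \<nu> i x)"
    by (simp add: matrix_vector_mult_add_rdistrib scaleR_matrix_vector_assoc[symmetric] shape_normal[OF assms])
  then have "R x *v (\<chi> i. \<nu> i x) = R x *v ((mat 1 + s *\<^sub>R shape x) *v (\<chi> i. \<nu> i x))" by simp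
  then show ?thesis by (simp add: matrix_vector_mul_assoc R_inverse[OF assms])
qed

lemma smoothM_R: "smoothM R"
  unfolding smoothM_def R_def
  by (intro allI smooth_on_matrix_inv open_U nz)
    (auto simp: shape_def mat_def intro!: smooth_on_add smooth_on_mult smooth_on_const open_U smooth_A)

lemma EM_R: assumes "x \<in> U" shows "EM k R x = - s *\<^sub>R (R x ** EM k shape x ** R x)"
proof -
  let ?G = "\<lambda>x. mat 1 + s *\<^sub>R shape x"
  have sG: "smoothM ?G"
    by (auto simp: smoothM_def shape_def mat_def intro!: smooth_on_add smooth_on_mult smooth_on_const open_U smooth_A)
  have EG: "EM k ?G x = s *\<^sub>R EM k shape x"
    using assms by (simp add: EM_def vec_eq_iff shape_def E_add E_cmult smooth_on_const open_U
        smooth_on_mult smooth_A along_const)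
  have "0 = EM k (\<lambda>x. R x ** ?G x) x"
    using E_const_eq[OF assms] R_inverse by (simp add: EM_def vec_eq_iff)
  also have "\<dots> = EM k R x ** ?G x + R x ** (s *\<^sub>R EM k shape x)"
    by (simp add: EM_mult[OF assms smoothM_R sG] EG)
  finally have "EM k R x ** ?G x = - s *\<^sub>R (R x ** EM k shape x)"
    by (simp add: scaleR_matrix_mult eq_neg_iff_add_eq_0)
  then have "EM k R x ** ?G x ** R x = - s *\<^sub>R (R x ** EM k shape x) ** R x" by simp
  then show ?thesis
    by (simp add: matrix_mul_assoc[symmetric] R_inverse[OF assms] scaleR_matrix_mult)
qed

lemma smooth_parallel_field: "smooth_on U (parallel_field k)"
  unfolding parallel_field_def[abs_def] using smoothM_R
  by (auto simp: smoothM_def intro!: smooth_on_sum smooth_on_scaleR open_U smooth_v)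

lemma along_parallel_field:
  "h differentiable (at x) \<Longrightarrow> along (parallel_field k) h x = (\<Sum>l\<in>UNIV. R x $ k $ l * E l h x)"
  unfolding parallel_field_def[abs_def] by (rule along_field_sum)

lemma parallel_shape:
  assumes "x \<in> U" shows "along (parallel_field k) (\<nu> l) x = (R x ** shape x) $ k $ l"
  using along_parallel_field[OF smooth_on_imp_differentiable[OF smooth_\<nu> assms]]
  by (simp add: E_\<nu> shape_def matrix_matrix_mult_def)

lemma parallel_symmetric:
  assumes "x \<in> U" shows "along (parallel_field k) (\<nu> l) x = along (parallel_field l) (\<nu> k) x"
proof -
  have "transpose (R x ** shape x) = R x ** shape x"
    by (simp add: matrix_transpose_mul R_transpose shape_transpose R_commute assms)
  then have "transpose (R x ** shape x) $ l $ k = (R x ** shape x) $ l $ k" by simp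
  then show ?thesis using assms by (simp add: parallel_shape transpose_def)
qed

text \<open>The second-order parts agree because the original operators commute. The first-order
  part contains derivatives of \<open>R\<close>, which by \<open>EM_R\<close> are
  \<open>- s R (E A) R\<close>; after contraction with another \<open>R\<close> the Codazzi equation
  makes it symmetric in \<open>k\<close> and \<open>l\<close>.\<close>

lemma parallel_commute:
  assumes h: "smooth_on U h" and x: "x \<in> U"
  shows "along (parallel_field k) (along (parallel_field l) h) x =
    along (parallel_field l) (along (parallel_field k) h) x"
proof -
  have sR: "smooth_on U (\<lambda>x. R x $ i $ j)" for i j using smoothM_R by (simp add: smoothM_def)
  note sm = sR smooth_on_mult smooth_on_sum open_U smooth_E h
  have ER: "E m (\<lambda>x. R x $ i $ j) x =
      - s * (\<Sum>a\<in>UNIV. \<Sum>b\<in>UNIV. R x $ i $ a * E m (A a b) x * R x $ b $ j)" for m i j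
  proof -
    have "E m (\<lambda>x. R x $ i $ j) x = EM m R x $ i $ j" by (simp add: EM_def)
    also have "\<dots> = - s * (\<Sum>b\<in>UNIV. \<Sum>a\<in>UNIV. R x $ i $ a * E m (A a b) x * R x $ b $ j)"
      unfolding EM_R[OF x] by (simp add: matrix_matrix_mult_def EM_def shape_def sum_distrib_right)
    also have "(\<Sum>b\<in>UNIV. \<Sum>a\<in>UNIV. R x $ i $ a * E m (A a b) x * R x $ b $ j) =
        (\<Sum>a\<in>UNIV. \<Sum>b\<in>UNIV. R x $ i $ a * E m (A a b) x * R x $ b $ j)" by (rule sum.swap)
    finally show ?thesis .
  qed
  \<comment> \<open>\<open>t\<close> is the second-order and \<open>u\<close> the first-order part
    of the composed operator.\<close>
  define t where "t k l = (\<Sum>m\<in>UNIV. \<Sum>q\<in>UNIV. R x $ k $ m * R x $ l $ q * E m (E q h) x)" for k l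
  define u where "u k l = (\<Sum>q\<in>UNIV. \<Sum>m\<in>UNIV. R x $ k $ m * E m (\<lambda>x. R x $ l $ q) x * E q h x)" for k l
  have step: "along (parallel_field k) (along (parallel_field l) h) x = t k l + u k l" for k l
  proof -
    have "along (parallel_field k) (along (parallel_field l) h) x =
        along (parallel_field k) (\<lambda>x. \<Sum>q\<in>UNIV. R x $ l $ q * E q h x) x"
      using along_parallel_field[OF smooth_on_imp_differentiable[OF h]]
      by (intro along_cong[OF open_U x])
    also have "\<dots> = (\<Sum>m\<in>UNIV. R x $ k $ m * E m (\<lambda>x. \<Sum>q\<in>UNIV. R x $ l $ q * E q h x) x)"
      by (rule along_parallel_field) (intro smooth_on_imp_differentiable[OF _ x] sm)
    also have "\<dots> = (\<Sum>m\<in>UNIV. \<Sum>q\<in>UNIV. R x $ k $ m * R x $ l $ q * E m (E q h) x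
        + R x $ k $ m * E m (\<lambda>x. R x $ l $ q) x * E q h x)"
      by (simp add: E_sum E_mult x sm sum_distrib_left distrib_left mult.assoc)
    also have "\<dots> = t k l + u k l"
      unfolding t_def u_def sum.distrib by (subst (3) sum.swap) (rule refl)
    finally show ?thesis .
  qed
  have "t k l = t l k"
    unfolding t_def by (subst sum.swap) (simp add: E_commute[OF x h] mult.commute[of "R x $ k $ _"])
  moreover have "u k l = u l k"
  proof -
    \<comment> \<open>The derivative of \<open>A\<close> contracted with two rows of
      \<open>R\<close>: its symmetry in \<open>k\<close> and \<open>l\<close> is the Codazzi
      equation.\<close>
    define w where "w k l b = (\<Sum>m\<in>UNIV. \<Sum>a\<in>UNIV. R x $ k $ m * (R x $ l $ a * E m (A a b) x))" for k l b
    have w: "w k l b = w l k b" for b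
      unfolding w_def by (subst sum.swap) (simp add: EA_sym1[OF x] mult.left_commute)
    have "(\<Sum>m\<in>UNIV. R x $ k $ m * E m (\<lambda>x. R x $ l $ q) x) = - s * (\<Sum>b\<in>UNIV. w k l b * R x $ b $ q)" for k l q
    proof -
      have "(\<Sum>m\<in>UNIV. R x $ k $ m * E m (\<lambda>x. R x $ l $ q) x) =
        - s * (\<Sum>m\<in>UNIV. \<Sum>a\<in>UNIV. \<Sum>b\<in>UNIV. R x $ k $ m * (R x $ l $ a * E m (A a b) x) * R x $ b $ q)"
        unfolding ER by (simp add: sum_distrib_left ac_simps)
      also have "(\<Sum>m\<in>UNIV. \<Sum>a\<in>UNIV. \<Sum>b\<in>UNIV. R x $ k $ m * (R x $ l $ a * E m (A a b) x) * R x $ b $ q) =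
          (\<Sum>b\<in>UNIV. w k l b * R x $ b $ q)"
        unfolding w_def sum_distrib_right by (subst triple_sum_swap23, subst sum.swap) (rule refl)
      finally show ?thesis .
    qed
    then show ?thesis unfolding u_def sum_distrib_right[symmetric] by (simp add: w)
  qed
  ultimately show ?thesis by (simp add: step)
qed

end

end

lemma (in normal_frame) parallel_frame:
  assumes nz: "\<And>x. x \<in> U \<Longrightarrow> det (mat 1 + s *\<^sub>R shape x) \<noteq> 0"
  shows "normal_frame U (parallel_field s) \<nu>"
proof
  show "along (parallel_field s k) (along (parallel_field s l) h) x =
      along (parallel_field s l) (along (parallel_field s k) h) x"
    if "open W" "W \<subseteq> U" "smooth_on W h" "x \<in> W" for k l W h x
  proof -
    \<comment> \<open>\<open>parallel_commute\<close> concerns functions smooth on the whole domain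
      of the frame, so the domain is first shrunk to \<open>W\<close>.\<close>
    interpret W: normal_frame W v \<nu> by (rule restrict) fact+
    have "det (mat 1 + s *\<^sub>R shape y) \<noteq> 0" if "y \<in> W" for y
      using that \<open>W \<subseteq> U\<close> nz by blast
    then show ?thesis using W.parallel_commute that by blast
  qed
  show "open U" by (rule open_U)
  show "smooth_on U (parallel_field s k)" for k using nz by (rule smooth_parallel_field)
  show "smooth_on U (\<nu> k)" for k by (rule smooth_\<nu>)
  show "(\<Sum>k\<in>UNIV. (\<nu> k x)\<^sup>2) = 1" if "x \<in> U" for x by (rule unit[OF that])
  show "along (parallel_field s k) (\<nu> l) x = along (parallel_field s l) (\<nu> k) x" if "x \<in> U" for k l x
    using parallel_symmetric nz that by blast
qed


section \<open>Rigidity of the shape operator\<close>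

context normal_frame
begin

context
  assumes p1_normal: "\<And>y k. y \<in> U \<Longrightarrow> E k (p 1) y = - p 2 y * \<nu> k y"
begin

text \<open>The hypothesis \<open>p1_normal\<close> for the parallel frame. The derivative of
  \<open>R A\<close> is \<open>R (E A) R\<close>, whose trace is that of
  \<open>R\<^sup>2 (E A)\<close>, and \<open>trace_resolvent_eq_0\<close> replaces
  \<open>E A\<close> by a normal multiple of \<open>A\<^sup>2\<close>. Since
  \<open>R \<nu> = \<nu>\<close>, the result stays normal in the new frame.\<close>

lemma parallel_mean_curvature_normal:
  assumes nz: "\<And>x. x \<in> U \<Longrightarrow> det (mat 1 + s *\<^sub>R shape x) \<noteq> 0" and x: "x \<in> U"
  shows "along (parallel_field s k) (\<lambda>y. trace (R s y ** shape y)) x =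
    - trace (R s x ** shape x ** (R s x ** shape x)) * \<nu> k x"
proof -
  note Rinv = R_inverse[of s, OF nz x] and Rcom = R_commute[of s, OF nz x]
  have sR: "smoothM (R s)" using smoothM_R[of s] nz by blast
  have sRA: "smoothM (\<lambda>y. R s y ** shape y)" by (intro smoothM_mult sR smoothM_shape)
  \<comment> \<open>\<open>R (I + s A) = I\<close> rewritten; it absorbs the term coming from the
    derivative of \<open>R\<close>.\<close>
  have R1: "mat 1 - s *\<^sub>R (R s x ** shape x) = R s x"
    using Rinv(1) by (simp add: matrix_add_ldistrib scaleR_matrix_mult algebra_simps)
  have E1: "E l (\<lambda>y. trace (R s y ** shape y)) x = - trace (R s x ** shape x ** (R s x ** shape x)) * \<nu> l x" for l
  proof -
    have "EM l (\<lambda>y. R s y ** shape y) x = EM l (R s) x ** shape x + R s x ** EM l shape x"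
      by (rule EM_mult[OF x sR smoothM_shape])
    also have "\<dots> = R s x ** EM l shape x ** (mat 1 - s *\<^sub>R (R s x ** shape x))"
      using EM_R[of s, OF nz x] by (simp add: matrix_diff_ldistrib scaleR_matrix_mult matrix_mul_assoc)
    finally have "EM l (\<lambda>y. R s y ** shape y) x = R s x ** EM l shape x ** R s x" unfolding R1 .
    then have "trace (EM l (\<lambda>y. R s y ** shape y) x) = trace (R s x ** (R s x ** EM l shape x))"
      by (simp add: trace_mul_sym[of _ "R s x"])
    then have "trace (EM l (\<lambda>y. R s y ** shape y) x) = trace (R s x ** R s x ** EM l shape x)"
      by (simp add: matrix_mul_assoc)
    moreover have "trace (R s x ** R s x ** (EM l shape x + \<nu> l x *\<^sub>R (shape x ** shape x))) = 0"
      using trace_power_normal[OF p1_normal x] by (intro trace_resolvent_eq_0[OF shape_transpose[OF x] _ Rinv(1)])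
    moreover have "R s x ** R s x ** (shape x ** shape x) = R s x ** shape x ** (R s x ** shape x)"
    proof -
      have "R s x ** R s x ** (shape x ** shape x) = R s x ** (R s x ** shape x) ** shape x"
        by (simp add: matrix_mul_assoc)
      also have "\<dots> = R s x ** (shape x ** R s x) ** shape x" by (simp only: Rcom)
      finally show ?thesis by (simp add: matrix_mul_assoc)
    qed
    ultimately show ?thesis
      using E_trace[OF x sRA]
      by (simp add: matrix_add_ldistrib scaleR_matrix_mult trace_add trace_scaleR
          mult.commute[of _ "\<nu> l x"] eq_neg_iff_add_eq_0)
  qed
  have "along (parallel_field s k) (\<lambda>y. trace (R s y ** shape y)) x =
      (\<Sum>l\<in>UNIV. R s x $ k $ l * E l (\<lambda>y. trace (R s y ** shape y)) x)"
    using nz by (intro along_parallel_field smooth_on_imp_differentiable[OF smooth_trace[OF sRA] x])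
  also have "\<dots> = - trace (R s x ** shape x ** (R s x ** shape x)) * (R s x *v (\<chi> i. \<nu> i x)) $ k"
    by (simp add: E1 matrix_vector_mult_def sum_distrib_left sum_distrib_right sum_negf ac_simps)
  finally show ?thesis using R_normal[of s, OF nz x] by simp
qed

text \<open>On the parallel surface the sum of squares in \<open>tangential_derivative_norm\<close>
  gives one inequality between the power sums and \<open>resolvent_shift\<close> the opposite one;
  the case of equality in the latter is the claim.\<close>

theorem shape_square:
  assumes x: "x \<in> U"
  shows "\<exists>l. shape x ** shape x = l *\<^sub>R shape x"
proof -
  obtain s where s: "det (mat 1 + s *\<^sub>R shape x) \<noteq> 0"
    and shift: "\<And>R B. R ** (mat 1 + s *\<^sub>R shape x) = mat 1 \<Longrightarrow> B = R ** shape x \<Longrightarrow>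
       (trace (B ** B))\<^sup>2 \<le> trace B * trace (B ** B ** B) \<and>
       ((trace (B ** B))\<^sup>2 = trace B * trace (B ** B ** B) \<longrightarrow>
         (\<exists>l. shape x ** shape x = l *\<^sub>R shape x))"
    using resolvent_shift[OF shape_transpose[OF x]] by blast
  \<comment> \<open>\<open>s\<close> was chosen for the single point \<open>x\<close>, so the
    resolvent exists only near \<open>x\<close>; the argument at \<open>x\<close> is local.\<close>
  define V where "V = {y \<in> U. det (mat 1 + s *\<^sub>R shape y) \<noteq> 0}"
  have "smooth_on U (\<lambda>y. det (mat 1 + s *\<^sub>R shape y))"
    by (intro smooth_on_det open_U)
      (auto simp: shape_def mat_def intro!: smooth_on_add smooth_on_mult smooth_on_const open_U smooth_A)
  then have "open V"
    using continuous_open_preimage[OF smooth_on_imp_continuous_on open_U, of "\<lambda>y. det (mat 1 + s *\<^sub>R shape y)" "- {0}"]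
    by (simp add: V_def Int_def vimage_def open_Compl)
  moreover have VU: "V \<subseteq> U" by (auto simp: V_def)
  ultimately interpret V: normal_frame V v \<nu> by (rule restrict)
  have nz: "det (mat 1 + s *\<^sub>R shape y) \<noteq> 0" if "y \<in> V" for y using that by (simp add: V_def)
  have xV: "x \<in> V" using x s by (simp add: V_def)
  interpret P: normal_frame V "parallel_field s" \<nu> by (rule V.parallel_frame) (rule nz)
  have shape: "P.shape y = R s y ** shape y" if "y \<in> V" for y
    using V.parallel_shape[OF nz that] by (simp add: P.shape_def P.A_def vec_eq_iff)
  have p: "P.p 1 y = trace (R s y ** shape y)"
      "P.p 2 y = trace (R s y ** shape y ** (R s y ** shape y))"
      "P.p 3 y = trace (R s y ** shape y ** (R s y ** shape y) ** (R s y ** shape y))" if "y \<in> V" for y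
    using shape[OF that] by (simp_all add: P.p_def numeral_eq_Suc matrix_mul_assoc)
  have "P.E k (P.p 1) y = - P.p 2 y * \<nu> k y" if y: "y \<in> V" for k y
  proof -
    have "P.E k (P.p 1) y = P.E k (\<lambda>y. trace (R s y ** shape y)) y" by (rule P.E_cong[OF y p(1)])
    also have "\<dots> = - P.p 2 y * \<nu> k y"
      unfolding p(2)[OF y] by (rule V.parallel_mean_curvature_normal[OF _ nz y]) (use p1_normal VU in auto)
    finally show ?thesis .
  qed
  from P.tangential_derivative_norm[OF this xV]
  have "(P.p 2 x)\<^sup>2 - P.p 1 x * P.p 3 x \<ge> 0" by (metis (no_types, lifting) sum_nonneg zero_le_power2)
  then show ?thesis using shift[of "R s x", OF V.R_inverse(1)[of s, OF nz xV] refl]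
    unfolding p[OF xV] by (metis diff_ge_0_iff_ge order_antisym)
qed

text \<open>Back in the original frame, \<open>shape_square\<close> gives
  \<open>(p 2)\<^sup>2 = p 1 p 3\<close>, so the sum of squares in
  \<open>tangential_derivative_norm\<close> is zero and each summand vanishes.\<close>

theorem shape_derivative:
  assumes x: "x \<in> U"
  defines "Q \<equiv> \<lambda>i j. (shape x ** shape x) $ i $ j"
  shows "E k (A i j) x = - (\<nu> k x * Q i j + \<nu> i x * Q k j + \<nu> j x * Q k i)"
proof -
  obtain l where l: "shape x ** shape x = l *\<^sub>R shape x" using shape_square[OF x] by blast
  have "p 2 x = l * p 1 x" "p 3 x = l * (l * p 1 x)"
    by (simp_all add: p_def numeral_eq_Suc l scaleR_matrix_mult trace_scaleR)
  then have "(\<Sum>k\<in>UNIV. \<Sum>i\<in>UNIV. \<Sum>j\<in>UNIV.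
      (E k (A i j) x + \<nu> k x * Q i j + \<nu> i x * Q k j + \<nu> j x * Q k i)\<^sup>2) = 0"
    using tangential_derivative_norm[OF p1_normal x] unfolding Q_def by (simp add: power2_eq_square)
  then have "(E k (A i j) x + \<nu> k x * Q i j + \<nu> i x * Q k j + \<nu> j x * Q k i)\<^sup>2 = 0"
    by (simp add: sum_nonneg_eq_0_iff sum_nonneg)
  then show ?thesis by simp
qed

end

end

subsection \<open>Randers norms and their Legendre transformation\<close>

lemma matrix_inv_vector:
  fixes M :: "real ^ 'n ^ 'n"
  assumes "det M \<noteq> 0"
  shows "M *v (matrix_inv M *v x) = x" "matrix_inv M *v (M *v x) = x"
  using matrix_inv_inverse[OF assms] by (simp_all add: matrix_vector_mul_assoc)

lemma alpha_norm_inner: "alpha_norm a y = sqrt (y \<bullet> (a *v y))"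
proof -
  have "(\<Sum>i\<in>UNIV. \<Sum>j\<in>UNIV. a $ i $ j * y $ i * y $ j) = y \<bullet> (a *v y)"
    by (simp add: inner_vec_def matrix_vector_mult_def sum_distrib_left ac_simps)
  then show ?thesis by (simp add: alpha_norm_def)
qed

lemma beta_form_inner: "beta_form b y = b \<bullet> y"
  by (simp add: beta_form_def inner_vec_def)

context
  fixes a :: "real ^ 'n ^ 'n" and b :: "real ^ 'n::finite"
  assumes ab: "randers_minkowski a b"
begin

lemma randers_symmetric: "transpose a = a"
  using ab by (simp add: randers_minkowski_def)

lemma randers_positive: "y \<noteq> 0 \<Longrightarrow> y \<bullet> (a *v y) > 0"
proof -
  have eq: "(\<Sum>i\<in>UNIV. \<Sum>j\<in>UNIV. a $ i $ j * y $ i * y $ j) = y \<bullet> (a *v y)" for y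
    by (simp add: inner_vec_def matrix_vector_mult_def sum_distrib_left ac_simps)
  show "y \<noteq> 0 \<Longrightarrow> y \<bullet> (a *v y) > 0" using ab unfolding randers_minkowski_def eq by blast
qed

lemma alpha_norm_pos: "y \<noteq> 0 \<Longrightarrow> alpha_norm a y > 0"
  by (simp add: alpha_norm_inner randers_positive)

lemma alpha_norm_bound: obtains K where "K > 0" "\<And>y. norm y \<le> K * alpha_norm a y"
proof -
  obtain D :: "real ^ 'n ^ 'n" where D: "det D \<noteq> 0" "\<And>x. (norm (D *v x))\<^sup>2 = x \<bullet> (a *v x)"
    using positive_definite_matrix_root[OF randers_symmetric randers_positive] by blast
  obtain K where K: "K > 0" "\<And>x. norm (matrix_inv D *v x) \<le> norm x * K"
    using bounded_linear.pos_bounded[OF matrix_vector_mul_bounded_linear] by blast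
  have "norm y \<le> K * alpha_norm a y" for y
    using K(2)[of "D *v y"] by (simp add: matrix_inv_vector[OF D(1)] alpha_norm_inner D(2)[symmetric] mult.commute)
  with K(1) that show thesis by blast
qed

lemma beta_less_alpha:
  assumes y: "y \<noteq> 0" shows "\<bar>beta_form b y\<bar> < alpha_norm a y"
proof -
  obtain K where K: "K > 0" "\<And>y. norm y \<le> K * alpha_norm a y" using alpha_norm_bound by blast
  \<comment> \<open>The supremum bounds the quotients only once they are known to be bounded
    above.\<close>
  have "\<bar>beta_form b z\<bar> / alpha_norm a z \<le> norm b * K" if "z \<noteq> 0" for z
  proof -
    have "\<bar>beta_form b z\<bar> \<le> norm b * norm z" by (simp add: beta_form_inner Cauchy_Schwarz_ineq2)
    also have "\<dots> \<le> norm b * (K * alpha_norm a z)" using K(2) by (intro mult_left_mono) auto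
    finally show ?thesis using alpha_norm_pos[OF that] by (simp add: field_simps)
  qed
  then have "bdd_above ((\<lambda>y. \<bar>beta_form b y\<bar> / alpha_norm a y) ` (- {0}))"
    by (intro bdd_aboveI2[where M = "norm b * K"]) auto
  then have "\<bar>beta_form b y\<bar> / alpha_norm a y \<le> (SUP y\<in>- {0}. \<bar>beta_form b y\<bar> / alpha_norm a y)"
    using y by (intro cSUP_upper) auto
  also have "\<dots> < 1" using ab by (simp add: randers_minkowski_def)
  finally show ?thesis using alpha_norm_pos[OF y] by simp
qed

lemma randers_norm_pos: "y \<noteq> 0 \<Longrightarrow> randers_norm a b y > 0"
  using beta_less_alpha[of y] by (simp add: randers_norm_def)

lemma smooth_on_alpha_norm: "smooth_on (- {0}) (alpha_norm a)"
proof -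
  have "smooth_on (- {0}) (\<lambda>y. sqrt (y \<bullet> (a *v y)))"
    by (intro smooth_on_sqrt smooth_on_bilinear[OF _ bounded_bilinear_inner] smooth_on_ident
        smooth_on_linear[OF _ matrix_vector_mul_bounded_linear]) (auto simp: randers_positive)
  then show ?thesis by (simp add: alpha_norm_inner[abs_def])
qed

lemma smooth_on_randers_norm: "smooth_on (- {0}) (randers_norm a b)"
  unfolding randers_norm_def[abs_def] beta_form_inner
  by (intro smooth_on_add smooth_on_alpha_norm smooth_on_linear[OF _ bounded_linear_inner_right] smooth_on_ident) auto

text \<open>The unit ball of \<open>F\<close> is an ellipsoid with centre \<open>w\<close>: completing the square in
  \<open>\<alpha>(y)\<^sup>2 = (t - \<beta>(y))\<^sup>2\<close>.\<close>

lemma randers_ellipsoid: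
  obtains D :: "real ^ 'n ^ 'n" and w where "det D \<noteq> 0" "norm (D *v w) < 1"
    "\<And>y t. t > 0 \<Longrightarrow> randers_norm a b y = t \<longleftrightarrow> norm (D *v (y - t *\<^sub>R w)) = t"
proof -
  \<comment> \<open>The form of \<open>G\<close> is
    \<open>\<alpha>\<^sup>2 - \<beta>\<^sup>2\<close>, the quadratic part of
    \<open>\<alpha>\<^sup>2 - (t - \<beta>)\<^sup>2\<close>, and is positive because
    \<open>\<bar>\<beta>\<bar> < \<alpha>\<close>.\<close>
  define G :: "real ^ 'n ^ 'n" where "G = a - (\<chi> i j. b $ i * b $ j)"
  have Gv: "G *v x = a *v x - (b \<bullet> x) *\<^sub>R b" for x
    by (simp add: G_def vec_eq_iff matrix_vector_mult_def inner_vec_def sum_distrib_left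
        left_diff_distrib right_diff_distrib sum_subtractf ac_simps)
  have Gsym: "transpose G = G"
    using randers_symmetric by (simp add: G_def vec_eq_iff transpose_def mult.commute)
  have Gpos: "x \<bullet> (G *v x) > 0" if "x \<noteq> 0" for x
  proof -
    have "\<bar>b \<bullet> x\<bar>\<^sup>2 < (alpha_norm a x)\<^sup>2"
      using beta_less_alpha[OF that] by (intro power_strict_mono) (auto simp: beta_form_inner)
    then show ?thesis using randers_positive[OF that]
      by (simp add: Gv inner_diff_right alpha_norm_inner power2_eq_square inner_commute)
  qed
  obtain D0 :: "real ^ 'n ^ 'n" where D0: "det D0 \<noteq> 0" "\<And>x. (norm (D0 *v x))\<^sup>2 = x \<bullet> (G *v x)"
    using positive_definite_matrix_root[OF Gsym Gpos] by blast
  define w where "w = - (matrix_inv G *v b)"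
  have "det G > 0" using det_positive_definite Gpos by blast
  then have Gw: "G *v w = - b"
    using matrix_inv_vector(1)[of G b] by (simp add: w_def vec.neg)
  \<comment> \<open>The constant produced by completing the square at \<open>t = 1\<close>; dividing
    by it gives the ellipsoid of level \<open>t\<close> the radius \<open>t\<close>.\<close>
  define c where "c = 1 + w \<bullet> (G *v w)"
  have wGw: "w \<bullet> (G *v w) \<ge> 0" by (simp add: D0(2)[symmetric])
  then have c: "c > 0" by (simp add: c_def)
  define D where "D = (1 / sqrt c) *\<^sub>R D0"
  have nD: "(norm (D *v x))\<^sup>2 = x \<bullet> (G *v x) / c" for x
    using c by (simp add: D_def scaleR_matrix_vector_assoc[symmetric] power_mult_distrib power_divide D0(2))
  have "norm (D *v x) = 0 \<Longrightarrow> x = 0" for x using nD[of x] Gpos[of x] c by force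
  then have "det D \<noteq> 0"
    by (metis invertible_det_nz invertible_left_inverse matrix_left_invertible_ker norm_zero)
  moreover have "norm (D *v w) < 1"
  proof -
    have "(norm (D *v w))\<^sup>2 < 1\<^sup>2" unfolding nD using wGw c by (simp add: c_def)
    then show ?thesis by (rule power_less_imp_less_base) simp
  qed
  moreover have "randers_norm a b y = t \<longleftrightarrow> norm (D *v (y - t *\<^sub>R w)) = t" if t: "t > 0" for y t
  proof -
    have yGw: "y \<bullet> (G *v w) = - (b \<bullet> y)" "w \<bullet> (G *v y) = - (b \<bullet> y)"
      using symmetric_matrix_inner[OF Gsym, of w y] by (simp_all add: Gw inner_commute)
    have "norm (D *v (y - t *\<^sub>R w)) = t \<longleftrightarrow> (norm (D *v (y - t *\<^sub>R w)))\<^sup>2 = t\<^sup>2"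
      using t by (simp add: power2_eq_iff_nonneg)
    also have "\<dots> \<longleftrightarrow> (y - t *\<^sub>R w) \<bullet> (G *v (y - t *\<^sub>R w)) = c * t\<^sup>2"
      using c by (simp add: nD field_simps)
    also have "(y - t *\<^sub>R w) \<bullet> (G *v (y - t *\<^sub>R w)) =
        y \<bullet> (G *v y) + 2 * t * (b \<bullet> y) + t\<^sup>2 * (w \<bullet> (G *v w))"
      by (simp add: matrix_vector_mult_diff_distrib matrix_vector_mult_scaleR inner_diff_left
          inner_diff_right yGw power2_eq_square algebra_simps)
    also have "(y \<bullet> (G *v y) + 2 * t * (b \<bullet> y) + t\<^sup>2 * (w \<bullet> (G *v w)) = c * t\<^sup>2) \<longleftrightarrow>
        y \<bullet> (a *v y) = (t - b \<bullet> y)\<^sup>2"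
      by (auto simp: c_def Gv inner_diff_right power2_eq_square algebra_simps inner_commute)
    also have "\<dots> \<longleftrightarrow> randers_norm a b y = t"
    proof (cases "y = 0")
      case True
      then show ?thesis using t by (simp add: randers_norm_def alpha_norm_inner beta_form_inner)
    next
      case False
      have "y \<bullet> (a *v y) = (alpha_norm a y)\<^sup>2"
        using randers_positive[OF False] by (simp add: alpha_norm_inner)
      \<comment> \<open>The second root would mean that \<open>\<alpha> - \<beta>\<close> equals
        \<open>- t\<close>, which is negative, against
        \<open>\<bar>\<beta>\<bar> < \<alpha>\<close>.\<close>
      then have "y \<bullet> (a *v y) = (t - b \<bullet> y)\<^sup>2 \<longleftrightarrow> alpha_norm a y = t - b \<bullet> y \<or> alpha_norm a y = - (t - b \<bullet> y)"
        by (simp only: power2_eq_iff)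
      then show ?thesis using beta_less_alpha[OF False] t
        by (auto simp: randers_norm_def beta_form_inner)
    qed
    finally show ?thesis by simp
  qed
  ultimately show thesis using that by blast
qed

end

section \<open>Zermelo navigation and the Legendre transformation\<close>

lemma differential_inner:
  assumes "h differentiable (at x)"
  shows "frechet_derivative h (at x) v = differential h x \<bullet> v"
proof -
  have "v = (\<Sum>i\<in>UNIV. v $ i *\<^sub>R axis i 1)"
    by (simp add: vec_eq_iff axis_def if_distrib[of "(*) _"] cong: if_cong)
  then have "frechet_derivative h (at x) v = frechet_derivative h (at x) (\<Sum>i\<in>UNIV. v $ i *\<^sub>R axis i 1)"
    by simp
  also have "\<dots> = (\<Sum>i\<in>UNIV. v $ i * frechet_derivative h (at x) (axis i 1))"
    using linear_frechet_derivative[OF assms] by (simp add: linear_sum linear_cmul)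
  finally show ?thesis by (simp add: differential_def partial_deriv_def inner_vec_def mult.commute)
qed

lemma differential_eqI:
  assumes "h differentiable (at x)" "\<And>v. frechet_derivative h (at x) v = \<xi> \<bullet> v"
  shows "differential h x = \<xi>"
  using assms by (simp add: differential_def partial_deriv_def vec_eq_iff inner_axis)

text \<open>Zermelo's navigation data: \<open>F\<close> measures travel time at unit speed in the
  Euclidean metric \<open>norm (D *v y)\<close> under a wind \<open>w\<close> slower than that
  speed. The geometry of the level surfaces sees \<open>F\<close> only through these data.\<close>

locale zermelo =
  fixes F :: "real ^ 'n \<Rightarrow> real" and D :: "real ^ 'n ^ 'n" and w :: "real ^ 'n"
  assumes det_D: "det D \<noteq> 0" and wind: "norm (D *v w) < 1"
    and level: "t > 0 \<Longrightarrow> F y = t \<longleftrightarrow> norm (D *v (y - t *\<^sub>R w)) = t"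
    and pos: "y \<noteq> 0 \<Longrightarrow> F y > 0"
    and zero: "F 0 = 0"
    and differentiable: "y \<noteq> 0 \<Longrightarrow> F differentiable (at y)"
begin

definition C :: "real ^ 'n ^ 'n" where "C = matrix_inv D"

definition pull :: "real ^ 'n \<Rightarrow> real ^ 'n" where "pull \<xi> = transpose C *v \<xi>"

text \<open>The support function of the ellipsoid with centre \<open>w\<close>, that is, the dual
  metric in closed form; see \<open>dual_metric_eq\<close>.\<close>

definition dual :: "real ^ 'n \<Rightarrow> real" where "dual \<xi> = norm (pull \<xi>) + w \<bullet> \<xi>"

lemma DC: "D *v (C *v x) = x" and CD: "C *v (D *v x) = x"
  unfolding C_def by (simp_all add: matrix_inv_vector[OF det_D])

lemma inner_C: "\<xi> \<bullet> (C *v x) = pull \<xi> \<bullet> x"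
  by (simp add: pull_def dot_lmul_matrix[symmetric] vector_transpose_matrix)

lemma inner_pull: "\<xi> \<bullet> x = pull \<xi> \<bullet> (D *v x)"
  using inner_C[of \<xi> "D *v x"] by (simp add: CD)

lemma pull_transpose: "pull (transpose D *v u) = u"
proof -
  have "transpose C ** transpose D = mat 1"
    using matrix_inv_inverse(1)[OF det_D] by (simp add: C_def matrix_transpose_mul[symmetric] transpose_mat)
  then show ?thesis by (simp only: pull_def matrix_vector_mul_assoc matrix_vector_mul_lid)
qed

lemma transpose_pull: "transpose D *v pull \<xi> = \<xi>"
proof -
  have "transpose D ** transpose C = mat 1"
    using matrix_inv_inverse(2)[OF det_D] by (simp add: C_def matrix_transpose_mul[symmetric] transpose_mat)
  then show ?thesis by (simp only: pull_def matrix_vector_mul_assoc matrix_vector_mul_lid)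
qed

lemma pull_eq_0_iff: "pull \<xi> = 0 \<longleftrightarrow> \<xi> = 0"
  by (metis transpose_pull pull_def matrix_vector_mult_0_right)

lemma wind_inner: "norm u = 1 \<Longrightarrow> 1 + u \<bullet> (D *v w) > 0"
  using Cauchy_Schwarz_ineq2[of u "D *v w"] wind by auto

lemma dual_eq: "dual \<xi> = norm (pull \<xi>) + pull \<xi> \<bullet> (D *v w)"
  by (simp add: dual_def inner_commute[of w] inner_pull[of \<xi> w])

lemma dual_pos: "\<xi> \<noteq> 0 \<Longrightarrow> dual \<xi> > 0"
proof -
  assume "\<xi> \<noteq> 0"
  then have n: "norm (pull \<xi>) > 0" by (simp add: pull_eq_0_iff)
  have "\<bar>pull \<xi> \<bullet> (D *v w)\<bar> \<le> norm (pull \<xi>) * norm (D *v w)" by (rule Cauchy_Schwarz_ineq2)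
  also have "\<dots> < norm (pull \<xi>)" using n wind by simp
  finally show ?thesis by (simp add: dual_eq)
qed

lemma unit_direction:
  assumes "y \<noteq> 0"
  defines "u \<equiv> (1 / F y) *\<^sub>R (D *v (y - F y *\<^sub>R w))"
  shows "norm u = 1" "y = F y *\<^sub>R (w + C *v u)"
proof -
  note p = pos[OF assms(1)]
  show "norm u = 1" using level[OF p, of y] p by (simp add: u_def)
  have "F y *\<^sub>R (C *v u) = y - F y *\<^sub>R w"
    using p by (simp add: u_def matrix_vector_mult_scaleR CD)
  then show "y = F y *\<^sub>R (w + C *v u)" by (simp add: scaleR_add_right)
qed

lemma F_direction: "norm u = 1 \<Longrightarrow> t > 0 \<Longrightarrow> F (t *\<^sub>R (w + C *v u)) = t"
  using level[of t "t *\<^sub>R (w + C *v u)"] by (simp add: scaleR_add_right matrix_vector_mult_scaleR DC)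

lemma direction_nz: "norm u = 1 \<Longrightarrow> t > 0 \<Longrightarrow> t *\<^sub>R (w + C *v u) \<noteq> 0"
  using F_direction[of u t] zero by auto

text \<open>\<open>F\<close> is given implicitly by equality of
  \<open>norm (D *v (y - F y *\<^sub>R w))\<close> and \<open>F y\<close>; differentiating the
  squared equation determines the differential of \<open>F\<close>.\<close>

lemma legendre_direction:
  assumes u: "norm u = 1" and t: "t > 0"
  shows "legendre F (t *\<^sub>R (w + C *v u)) = (t / (1 + u \<bullet> (D *v w))) *\<^sub>R (transpose D *v u)"
proof -
  define y where "y = t *\<^sub>R (w + C *v u)"
  have y: "y \<noteq> 0" "F y = t" using direction_nz[OF u t] F_direction[OF u t] by (auto simp: y_def)
  have Dy: "D *v (y - t *\<^sub>R w) = t *\<^sub>R u"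
    by (simp add: y_def scaleR_add_right matrix_vector_mult_scaleR DC)
  obtain F' where F': "(F has_derivative F') (at y)"
    using differentiable[OF y(1)] by (auto simp: differentiable_def)
  have "F' v = u \<bullet> (D *v v) / (1 + u \<bullet> (D *v w))" for v
  proof -
    have 1: "((\<lambda>z. D *v (z - F z *\<^sub>R w)) has_derivative (\<lambda>v. D *v (v - F' v *\<^sub>R w))) (at y)"
      by (intro bounded_linear.has_derivative[OF matrix_vector_mul_bounded_linear]
          derivative_eq_intros F' refl) (use F' in auto)
    have 2: "((\<lambda>z. (D *v (z - F z *\<^sub>R w)) \<bullet> (D *v (z - F z *\<^sub>R w)) - F z * F z) has_derivative
       (\<lambda>v. (t *\<^sub>R u) \<bullet> (D *v (v - F' v *\<^sub>R w)) + (D *v (v - F' v *\<^sub>R w)) \<bullet> (t *\<^sub>R u)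
           - (t * F' v + F' v * t))) (at y)"
      using has_derivative_diff[OF has_derivative_inner[OF 1 1] has_derivative_mult[OF F' F']]
      by (simp add: Dy y(2))
    have "(D *v (z - F z *\<^sub>R w)) \<bullet> (D *v (z - F z *\<^sub>R w)) - F z * F z = 0" if "z \<in> - {0}" for z
      using level[OF pos, of z z] that by (simp add: dot_square_norm power2_eq_square)
    then have "((\<lambda>z. 0) has_derivative
       (\<lambda>v. (t *\<^sub>R u) \<bullet> (D *v (v - F' v *\<^sub>R w)) + (D *v (v - F' v *\<^sub>R w)) \<bullet> (t *\<^sub>R u)
           - (t * F' v + F' v * t))) (at y)"
      using y(1) by (intro has_derivative_transform_within_open[OF 2, of "- {0}"]) auto
    then have "(\<lambda>v. (t *\<^sub>R u) \<bullet> (D *v (v - F' v *\<^sub>R w)) + (D *v (v - F' v *\<^sub>R w)) \<bullet> (t *\<^sub>R u)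
           - (t * F' v + F' v * t)) = (\<lambda>v. 0)"
      by (rule has_derivative_unique) simp
    from fun_cong[OF this, of v] have "2 * t * (u \<bullet> (D *v (v - F' v *\<^sub>R w)) - F' v) = 0"
      by (simp only: inner_scaleR_left inner_scaleR_right inner_commute[of _ u]) (simp add: right_diff_distrib)
    then have "u \<bullet> (D *v (v - F' v *\<^sub>R w)) - F' v = 0" using t by simp
    then have "F' v * (1 + u \<bullet> (D *v w)) = u \<bullet> (D *v v)"
      by (simp add: matrix_vector_mult_diff_distrib matrix_vector_mult_scaleR inner_diff_right algebra_simps)
    then show ?thesis using wind_inner[OF u] by (simp add: field_simps)
  qed
  then have "differential F y = (1 / (1 + u \<bullet> (D *v w))) *\<^sub>R (transpose D *v u)"
    using F' by (intro differential_eqI)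
      (auto simp: differentiable_def frechet_derivative_at[symmetric] dot_lmul_matrix[symmetric] vector_transpose_matrix)
  then show ?thesis using y by (simp add: legendre_def y_def)
qed

text \<open>\<open>inv\<close> chooses some preimage, so the preimage must exist and be unique. By
  \<open>legendre_direction\<close> the covector determines the unit vector of its preimage, and its
  length then determines the scale.\<close>

lemma legendre_inverse:
  assumes \<xi>: "\<xi> \<noteq> 0"
  shows "inv (legendre F) \<xi> = dual \<xi> *\<^sub>R (w + C *v ((1 / norm (pull \<xi>)) *\<^sub>R pull \<xi>))"
proof -
  define n where "n = norm (pull \<xi>)"
  have n: "n > 0" using \<xi> by (simp add: n_def pull_eq_0_iff)
  define u where "u = (1 / n) *\<^sub>R pull \<xi>"
  have u: "norm u = 1" "pull \<xi> = n *\<^sub>R u" using n by (simp_all add: u_def) (simp add: n_def)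
  have dn: "dual \<xi> = n * (1 + u \<bullet> (D *v w))"
    unfolding dual_eq n_def[symmetric] by (simp add: u(2) distrib_left)
  have "legendre F (dual \<xi> *\<^sub>R (w + C *v u)) = n *\<^sub>R (transpose D *v u)"
    using legendre_direction[OF u(1) dual_pos[OF \<xi>]] wind_inner[OF u(1)] by (simp add: dn)
  also have "\<dots> = \<xi>"
    using transpose_pull[of \<xi>] by (simp add: u(2) matrix_vector_mult_scaleR)
  finally have ex: "legendre F (dual \<xi> *\<^sub>R (w + C *v u)) = \<xi>" .
  have uniq: "y = dual \<xi> *\<^sub>R (w + C *v u)" if y: "legendre F y = \<xi>" for y
  proof -
    have "y \<noteq> 0" using y \<xi> by (auto simp: legendre_def)
    define t where "t = F y"
    have t: "t > 0" using pos[OF \<open>y \<noteq> 0\<close>] by (simp add: t_def)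
    obtain v where v: "norm v = 1" "y = t *\<^sub>R (w + C *v v)"
      using unit_direction[OF \<open>y \<noteq> 0\<close>] t_def by blast
    define k where "k = t / (1 + v \<bullet> (D *v w))"
    have k: "k > 0" using t wind_inner[OF v(1)] by (simp add: k_def)
    have "\<xi> = k *\<^sub>R (transpose D *v v)" using y legendre_direction[OF v(1) t] by (simp add: v(2) k_def)
    then have pv: "pull \<xi> = k *\<^sub>R v"
      using pull_transpose[of "k *\<^sub>R v"] by (simp add: matrix_vector_mult_scaleR)
    then have "n = k" using v(1) k by (simp add: n_def)
    then have "v = u" using pv k by (simp add: u_def)
    moreover have "t = dual \<xi>" using wind_inner[OF v(1)] \<open>n = k\<close> by (simp add: dn k_def \<open>v = u\<close>)
    ultimately show ?thesis using v(2) by simp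
  qed
  show ?thesis unfolding inv_def using ex uniq unfolding u_def n_def by (rule some_equality)
qed

text \<open>Cauchy-Schwarz on the unit ellipsoid; the supremum is attained in the direction of
  \<open>pull \<xi>\<close>.\<close>

lemma dual_metric_eq:
  assumes \<xi>: "\<xi> \<noteq> 0"
  shows "dual_metric F \<xi> = dual \<xi>"
  unfolding dual_metric_def
proof (rule cSup_eq_maximum)
  define u where "u = (1 / norm (pull \<xi>)) *\<^sub>R pull \<xi>"
  have n: "norm (pull \<xi>) > 0" using \<xi> by (simp add: pull_eq_0_iff)
  have u: "norm u = 1" using n by (simp add: u_def)
  have "pull \<xi> \<bullet> u = norm (pull \<xi>)" using n by (simp add: u_def dot_square_norm power2_eq_square)
  then have "(\<xi> \<bullet> (1 *\<^sub>R (w + C *v u))) / F (1 *\<^sub>R (w + C *v u)) = dual \<xi>"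
    unfolding F_direction[OF u zero_less_one]
    by (simp add: dual_def inner_add_right inner_C inner_commute)
  then show "dual \<xi> \<in> (\<lambda>y. \<xi> \<bullet> y / F y) ` (- {0})"
    using direction_nz[OF u zero_less_one] by (intro image_eqI[where x = "1 *\<^sub>R (w + C *v u)"]) auto
next
  fix q assume "q \<in> (\<lambda>y. \<xi> \<bullet> y / F y) ` (- {0})"
  then obtain y where y: "y \<noteq> 0" "q = \<xi> \<bullet> y / F y" by auto
  obtain v where v: "norm v = 1" "y = F y *\<^sub>R (w + C *v v)"
    using unit_direction[OF y(1)] by blast
  have "\<xi> \<bullet> y = F y * (\<xi> \<bullet> w + pull \<xi> \<bullet> v)"
    by (subst v(2)) (simp add: inner_add_right inner_C)
  moreover have "pull \<xi> \<bullet> v \<le> norm (pull \<xi>)" using Cauchy_Schwarz_ineq2[of "pull \<xi>" v] v(1) by simp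
  ultimately show "q \<le> dual \<xi>" using pos[OF y(1)] by (simp add: y(2) dual_def inner_commute)
qed

end

lemma zermelo_randers:
  fixes a :: "real ^ 'n ^ 'n" and b :: "real ^ 'n::finite"
  assumes "randers_minkowski a b"
  shows "\<exists>D w. zermelo (randers_norm a b) D w"
proof -
  obtain D :: "real ^ 'n ^ 'n" and w where "det D \<noteq> 0" "norm (D *v w) < 1"
    "\<And>y t. t > 0 \<Longrightarrow> randers_norm a b y = t \<longleftrightarrow> norm (D *v (y - t *\<^sub>R w)) = t"
    using randers_ellipsoid[OF assms] by blast
  moreover have "randers_norm a b 0 = 0" by (simp add: randers_norm_def alpha_norm_inner beta_form_inner)
  ultimately have "zermelo (randers_norm a b) D w"
    using randers_norm_pos[OF assms] smooth_on_imp_differentiable[OF smooth_on_randers_norm[OF assms]]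
    by unfold_locales auto
  then show ?thesis by blast
qed

subsection \<open>Positivity of the volume densities\<close>

context
  fixes a :: "real ^ 'n ^ 'n" and b :: "real ^ 'n::finite"
  assumes ab: "randers_minkowski a b"
begin

lemma continuous_on_randers_norm: "continuous_on UNIV (randers_norm a b)"
  unfolding randers_norm_def[abs_def] alpha_norm_inner beta_form_inner
  by (intro continuous_intros matrix_vector_mult_linear_continuous_on)

lemma open_randers_ball: "open {y. randers_norm a b y < 1}"
  using continuous_on_randers_norm by (simp add: open_Collect_less continuous_on_const)

lemma bounded_randers_ball: "bounded {y. randers_norm a b y < 1}"
proof -
  obtain D w where "zermelo (randers_norm a b) D w" using zermelo_randers[OF ab] by blast
  then interpret zermelo "randers_norm a b" D w .
  obtain K where K: "K > 0" "\<And>x. norm (C *v x) \<le> norm x * K"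
    using bounded_linear.pos_bounded[OF matrix_vector_mul_bounded_linear] by blast
  have "norm y \<le> norm w + K" if "randers_norm a b y < 1" for y
  proof (cases "y = 0")
    case False
    obtain u where u: "norm u = 1" "y = randers_norm a b y *\<^sub>R (w + C *v u)"
      using unit_direction[OF False] by blast
    have "norm y = randers_norm a b y * norm (w + C *v u)"
      using pos[OF False] by (subst u(2)) simp
    also have "\<dots> \<le> 1 * (norm w + K)"
      using that pos[OF False] norm_triangle_ineq[of w "C *v u"] K(2)[of u] u(1)
      by (intro mult_mono) auto
    finally show ?thesis by simp
  qed (use K in auto)
  then show ?thesis by (auto simp: bounded_iff)
qed

text \<open>The second claim removes the origin because nothing is known about the fundamental
  tensor there.\<close>

lemma randers_ball_emeasure:
  "emeasure lborel {y. randers_norm a b y < 1} < \<infinity>" "emeasure lborel ({y. randers_norm a b y < 1} - {0}) > 0"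
proof -
  let ?B = "{y. randers_norm a b y < 1}"
  show "emeasure lborel ?B < \<infinity>" by (rule emeasure_bounded_finite[OF bounded_randers_ball])
  have "0 \<in> ?B" by (simp add: randers_norm_def alpha_norm_inner beta_form_inner)
  then obtain r where r: "r > 0" "ball 0 r \<subseteq> ?B" using open_randers_ball open_contains_ball by blast
  have "emeasure lborel (ball 0 r :: (real ^ 'n) set) > 0"
    using content_ball_pos[OF r(1), of "0 :: real ^ 'n"] by (simp add: measure_def enn2real_positive_iff)
  also have "emeasure lborel (ball 0 r :: (real ^ 'n) set) = emeasure lborel (ball 0 r - {0 :: real ^ 'n})"
    by (rule emeasure_Diff_null_set[symmetric]) auto
  also have "\<dots> \<le> emeasure lborel (?B - {0})"
    using r(2) open_randers_ball by (intro emeasure_mono) auto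
  finally show "emeasure lborel (?B - {0}) > 0" .
qed

lemma busemann_hausdorff_pos: "busemann_hausdorff (randers_norm a b) > 0"
proof -
  let ?B = "{y. randers_norm a b y < 1}"
  have "emeasure lborel (?B - {0}) \<le> emeasure lborel ?B"
    using open_randers_ball by (intro emeasure_mono) auto
  then have "measure lborel ?B > 0"
    using randers_ball_emeasure unfolding measure_def by (subst enn2real_positive_iff) auto
  then show ?thesis using content_ball_pos[of 1 "0 :: real ^ 'n"] by (simp add: busemann_hausdorff_def)
qed

section \<open>The fundamental tensor of a Randers norm\<close>

definition direction_covector :: "real ^ 'n \<Rightarrow> real ^ 'n" where
  "direction_covector y = (1 / alpha_norm a y) *\<^sub>R (a *v y)"

lemma alpha_norm_derivative:
  assumes "y \<noteq> 0"
  shows "(alpha_norm a has_derivative (\<lambda>v. direction_covector y \<bullet> v)) (at y)"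
proof -
  have "((\<lambda>y. y \<bullet> (a *v y)) has_derivative (\<lambda>v. y \<bullet> (a *v v) + v \<bullet> (a *v y))) (at y)"
    by (intro has_derivative_inner bounded_linear.has_derivative[OF matrix_vector_mul_bounded_linear]
        has_derivative_ident)
  then have "((\<lambda>y. y \<bullet> (a *v y)) has_derivative (\<lambda>v. 2 * ((a *v y) \<bullet> v))) (at y)"
    using symmetric_matrix_inner[OF randers_symmetric[OF ab], of y] by (simp add: inner_commute)
  from has_derivative_real_sqrt[OF randers_positive[OF ab assms] this]
  have "((\<lambda>y. sqrt (y \<bullet> (a *v y))) has_derivative (\<lambda>v. direction_covector y \<bullet> v)) (at y)"
    by (rule has_derivative_eq_rhs)
      (use alpha_norm_pos[OF ab assms] in \<open>auto simp: direction_covector_def alpha_norm_inner field_simps\<close>)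
  then show ?thesis by (simp add: alpha_norm_inner[abs_def])
qed

lemma randers_norm_derivative:
  "y \<noteq> 0 \<Longrightarrow> (randers_norm a b has_derivative (\<lambda>v. (direction_covector y + b) \<bullet> v)) (at y)"
  unfolding randers_norm_def[abs_def] beta_form_inner inner_add_left
  by (intro has_derivative_add alpha_norm_derivative
      bounded_linear.has_derivative[OF bounded_linear_inner_right] has_derivative_ident)

text \<open>Half the Hessian of \<open>F\<^sup>2\<close> is the square of the differential
  \<open>l + b\<close> plus \<open>F\<close> times the Hessian of \<open>F\<close>. The linear form
  contributes nothing to the latter, which is \<open>(a - l l\<^sup>T) / \<alpha>\<close>.\<close>

lemma fundamental_tensor_randers:
  assumes y: "y \<noteq> 0"
  defines "l \<equiv> direction_covector y"
  shows "fundamental_tensor (randers_norm a b) y $ i $ j =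
    (l $ i + b $ i) * (l $ j + b $ j) + randers_norm a b y / alpha_norm a y * (a $ i $ j - l $ i * l $ j)"
proof -
  let ?F = "randers_norm a b"
  have 1: "partial_deriv i (\<lambda>z. (?F z)\<^sup>2) z = 2 * (?F z * ((a *v z) $ i / alpha_norm a z + b $ i))"
    if "z \<in> - {0}" for z
  proof -
    have "((\<lambda>z. (?F z)\<^sup>2) has_derivative (\<lambda>v. 2 * (?F z * ((direction_covector z + b) \<bullet> v)))) (at z)"
      using that by (auto intro!: derivative_eq_intros randers_norm_derivative simp: power2_eq_square)
    then show ?thesis
      by (simp add: partial_deriv_def frechet_derivative_at[symmetric] inner_axis direction_covector_def)
  qed
  have Ai: "((\<lambda>z. (a *v z) $ i) has_derivative (\<lambda>v. (a *v v) $ i)) (at y)"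
    by (intro bounded_linear.has_derivative[OF bounded_linear_vec_nth]
        bounded_linear.has_derivative[OF matrix_vector_mul_bounded_linear] has_derivative_ident)
  have "((\<lambda>z. 2 * (?F z * ((a *v z) $ i / alpha_norm a z + b $ i))) has_derivative
      (\<lambda>v. 2 * (?F y * ((a *v v) $ i / alpha_norm a y
            - (a *v y) $ i * (l \<bullet> v) / (alpha_norm a y * alpha_norm a y))
        + ((l + b) \<bullet> v) * ((a *v y) $ i / alpha_norm a y + b $ i)))) (at y)"
    using alpha_norm_pos[OF ab y] unfolding l_def
    by (auto intro!: derivative_eq_intros randers_norm_derivative alpha_norm_derivative y Ai
        simp: field_simps)
  then have "((partial_deriv i (\<lambda>z. (?F z)\<^sup>2)) has_derivative
      (\<lambda>v. 2 * (?F y * ((a *v v) $ i / alpha_norm a y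
            - (a *v y) $ i * (l \<bullet> v) / (alpha_norm a y * alpha_norm a y))
        + ((l + b) \<bullet> v) * ((a *v y) $ i / alpha_norm a y + b $ i)))) (at y)"
    by (rule has_derivative_transform_within_open[of _ _ _ _ "- {0}"]) (use y 1 in auto)
  then have "partial_deriv j (partial_deriv i (\<lambda>z. (?F z)\<^sup>2)) y =
      2 * (?F y * (a $ i $ j / alpha_norm a y
            - (a *v y) $ i * l $ j / (alpha_norm a y * alpha_norm a y))
        + (l $ j + b $ j) * ((a *v y) $ i / alpha_norm a y + b $ i))"
    by (subst partial_deriv_def)
      (simp add: frechet_derivative_at[symmetric] inner_axis matrix_vector_mul_component)
  moreover have "(a *v y) $ i = alpha_norm a y * l $ i"
    using alpha_norm_pos[OF ab y] by (simp add: l_def direction_covector_def)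
  ultimately show ?thesis using alpha_norm_pos[OF ab y]
    by (simp add: fundamental_tensor_def field_simps)
qed

text \<open>Split \<open>v\<close> into a multiple of \<open>y\<close> and a remainder
  \<open>z\<close> orthogonal to \<open>y\<close> for \<open>a\<close>. The second part of the
  tensor is the positive form of \<open>a\<close> evaluated on \<open>z\<close>; if \<open>z\<close>
  is zero, the first part is the square of a nonzero multiple of \<open>F y\<close>.\<close>

lemma fundamental_tensor_positive:
  assumes y: "y \<noteq> 0" and v: "v \<noteq> 0"
  shows "v \<bullet> (fundamental_tensor (randers_norm a b) y *v v) > 0"
proof -
  define l where "l = direction_covector y"
  define c where "c = randers_norm a b y / alpha_norm a y"
  have al: "alpha_norm a y > 0" using alpha_norm_pos[OF ab y] .
  have c: "c > 0" using al randers_norm_pos[OF ab y] by (simp add: c_def)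
  have "v \<bullet> (fundamental_tensor (randers_norm a b) y *v v) =
    (\<Sum>i\<in>UNIV. \<Sum>j\<in>UNIV. ((l $ i + b $ i) * v $ i) * ((l $ j + b $ j) * v $ j)
       + c * (v $ i * (a $ i $ j * v $ j)) - c * ((l $ i * v $ i) * (l $ j * v $ j)))"
    by (simp add: inner_vec_def matrix_vector_mult_def sum_distrib_left fundamental_tensor_randers[OF y]
        l_def[symmetric] c_def[symmetric] algebra_simps)
  also have "\<dots> = ((l + b) \<bullet> v)\<^sup>2 + c * (v \<bullet> (a *v v)) - c * (l \<bullet> v)\<^sup>2"
  proof -
    have "((l + b) \<bullet> v)\<^sup>2 = (\<Sum>i\<in>UNIV. \<Sum>j\<in>UNIV. ((l $ i + b $ i) * v $ i) * ((l $ j + b $ j) * v $ j))"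
      unfolding power2_eq_square inner_vec_def sum_product by simp
    moreover have "c * (l \<bullet> v)\<^sup>2 = (\<Sum>i\<in>UNIV. \<Sum>j\<in>UNIV. c * ((l $ i * v $ i) * (l $ j * v $ j)))"
      unfolding power2_eq_square inner_vec_def sum_product by (simp add: sum_distrib_left)
    moreover have "c * (v \<bullet> (a *v v)) = (\<Sum>i\<in>UNIV. \<Sum>j\<in>UNIV. c * (v $ i * (a $ i $ j * v $ j)))"
      by (simp add: inner_vec_def matrix_vector_mult_def sum_distrib_left)
    ultimately show ?thesis by (simp only: sum.distrib sum_subtractf)
  qed
  finally have eq: "v \<bullet> (fundamental_tensor (randers_norm a b) y *v v) =
    ((l + b) \<bullet> v)\<^sup>2 + c * (v \<bullet> (a *v v) - (l \<bullet> v)\<^sup>2)" by (simp add: algebra_simps)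
  define k where "k = (l \<bullet> v) / alpha_norm a y"
  define z where "z = v - k *\<^sub>R y"
  have yy: "y \<bullet> (a *v y) = (alpha_norm a y)\<^sup>2" using randers_positive[OF ab y] by (simp add: alpha_norm_inner)
  have lv: "(a *v y) \<bullet> v = k * (alpha_norm a y)\<^sup>2" "l \<bullet> v = k * alpha_norm a y"
    using al by (simp_all add: k_def l_def direction_covector_def power2_eq_square)
  have "z \<bullet> (a *v z) = v \<bullet> (a *v v) - (l \<bullet> v)\<^sup>2"
    using symmetric_matrix_inner[OF randers_symmetric[OF ab], of y v] lv(1)
    by (simp add: z_def matrix_vector_mult_diff_distrib matrix_vector_mult_scaleR inner_diff_left
        inner_diff_right yy lv(2) inner_commute[of v "a *v y"] power2_eq_square)
  then have eq2: "v \<bullet> (fundamental_tensor (randers_norm a b) y *v v) =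
    ((l + b) \<bullet> v)\<^sup>2 + c * (z \<bullet> (a *v z))" using eq by simp
  show ?thesis
  proof (cases "z = 0")
    case False
    then show ?thesis unfolding eq2 using c randers_positive[OF ab False] by (intro add_nonneg_pos) auto
  next
    case True
    then have vk: "v = k *\<^sub>R y" by (simp add: z_def)
    then have "k \<noteq> 0" using v by auto
    have "l \<bullet> y = alpha_norm a y"
      using yy al by (simp add: l_def direction_covector_def inner_commute power2_eq_square)
    then have "(l + b) \<bullet> v = k * randers_norm a b y"
      by (simp add: vk inner_add_left randers_norm_def beta_form_inner)
    then show ?thesis unfolding eq2 using \<open>k \<noteq> 0\<close> True randers_norm_pos[OF ab y] by simp
  qed
qed

text \<open>The direction covectors are bounded and \<open>F / \<alpha>\<close> is less than 2, so
  all entries of the tensor are bounded. This serves integrability over the unit ball.\<close>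

lemma fundamental_tensor_det_bounded:
  "\<exists>M. \<forall>y. y \<noteq> 0 \<longrightarrow> \<bar>det (fundamental_tensor (randers_norm a b) y)\<bar> \<le> M"
proof -
  obtain K where K: "K > 0" "\<And>y. norm y \<le> K * alpha_norm a y" using alpha_norm_bound[OF ab] by blast
  obtain L where L: "L > 0" "\<And>x. norm (a *v x) \<le> norm x * L"
    using bounded_linear.pos_bounded[OF matrix_vector_mul_bounded_linear] by blast
  define P where "P = K * L"
  have l: "\<bar>direction_covector y $ i\<bar> \<le> P" if "y \<noteq> 0" for y i
  proof -
    have "\<bar>direction_covector y $ i\<bar> \<le> norm (direction_covector y)" by (rule component_le_norm_cart)
    also have "\<dots> = norm (a *v y) / alpha_norm a y" using alpha_norm_pos[OF ab that] by (simp add: direction_covector_def)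
    also have "\<dots> \<le> (K * alpha_norm a y * L) / alpha_norm a y"
      using order_trans[OF L(2)[of y] mult_right_mono[OF K(2)[of y], of L]] L(1) alpha_norm_pos[OF ab that]
      by (intro divide_right_mono) auto
    also have "\<dots> = P" using alpha_norm_pos[OF ab that] by (simp add: P_def)
    finally show ?thesis .
  qed
  have P: "P > 0" using K L by (simp add: P_def)
  define M where "M = (P + norm b) * (P + norm b) + 2 * (norm a + P * P)"
  have M: "M \<ge> 0" using P by (simp add: M_def)
  have ent: "\<bar>fundamental_tensor (randers_norm a b) y $ i $ j\<bar> \<le> M" if y: "y \<noteq> 0" for y i j
  proof -
    let ?l = "direction_covector y"
    have lb: "\<bar>?l $ i + b $ i\<bar> \<le> P + norm b" for i
      using l[OF y, of i] component_le_norm_cart[of b i] by linarith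
    have "\<bar>a $ i $ j\<bar> \<le> norm a"
      using component_le_norm_cart[of "a $ i" j] Finite_Cartesian_Product.norm_nth_le[of a i] by linarith
    moreover have "\<bar>?l $ i * ?l $ j\<bar> \<le> P * P"
      unfolding abs_mult using l[OF y] P by (intro mult_mono) auto
    ultimately have 2: "\<bar>a $ i $ j - ?l $ i * ?l $ j\<bar> \<le> norm a + P * P" by linarith
    have 3: "\<bar>randers_norm a b y / alpha_norm a y\<bar> \<le> 2"
      using beta_less_alpha[OF ab y] alpha_norm_pos[OF ab y] by (simp add: randers_norm_def divide_simps)
    have "\<bar>(?l $ i + b $ i) * (?l $ j + b $ j)\<bar> \<le> (P + norm b) * (P + norm b)"
      unfolding abs_mult using lb P by (intro mult_mono) (auto simp: add_nonneg_nonneg)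
    moreover have "\<bar>randers_norm a b y / alpha_norm a y * (a $ i $ j - ?l $ i * ?l $ j)\<bar> \<le> 2 * (norm a + P * P)"
      unfolding abs_mult using 2 3 by (intro mult_mono) auto
    ultimately show ?thesis unfolding fundamental_tensor_randers[OF y] M_def by linarith
  qed
  define Z where "Z = (\<Sum>p\<in>{p. p permutes (UNIV :: 'n set)}. (\<Prod>i\<in>(UNIV :: 'n set). M))"
  have "\<bar>det (fundamental_tensor (randers_norm a b) y)\<bar> \<le> Z" if y: "y \<noteq> 0" for y
    unfolding det_def Z_def
  proof (rule order_trans[OF sum_abs], rule sum_mono)
    fix p
    show "\<bar>of_int (sign p) * (\<Prod>i\<in>UNIV. fundamental_tensor (randers_norm a b) y $ i $ p i)\<bar> \<le> (\<Prod>i\<in>(UNIV::'n set). M)"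
      unfolding abs_mult abs_prod using ent[OF y]
      by (auto simp: sign_def intro!: prod_mono simp del: prod_constant)
  qed
  then show ?thesis by blast
qed

lemma fundamental_tensor_det_measurable:
  "(\<lambda>y. det (fundamental_tensor (randers_norm a b) y)) \<in> borel_measurable borel"
proof -
  let ?g = "fundamental_tensor (randers_norm a b)"
  have sq: "smooth_on (- {0}) (\<lambda>z. (randers_norm a b z)\<^sup>2)"
    unfolding power2_eq_square by (intro smooth_on_mult smooth_on_randers_norm[OF ab]) auto
  have "smooth_on (- {0}) (\<lambda>y. det (?g y))"
  proof (rule smooth_on_det)
    fix i j
    have "smooth_on (- {0}) (\<lambda>y. 1 / 2 * partial_deriv j (partial_deriv i (\<lambda>z. (randers_norm a b z)\<^sup>2)) y)"
      unfolding partial_deriv_def[abs_def]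
      by (intro smooth_on_mult smooth_on_const smooth_on_frechet_derivative sq) auto
    then show "smooth_on (- {0}) (\<lambda>y. ?g y $ i $ j)" by (simp add: fundamental_tensor_def)
  qed auto
  then have "continuous_on (- {0}) (\<lambda>y. det (?g y))" by (rule smooth_on_imp_continuous_on)
  \<comment> \<open>The two branches coincide; the split expresses continuity off the origin and,
    trivially, on the single point left.\<close>
  then have "(\<lambda>y. if y \<in> - {0} then det (?g y) else det (?g y)) \<in> borel_measurable borel"
    by (intro borel_measurable_continuous_on_if) auto
  then show ?thesis by simp
qed

text \<open>The integral of a nonintegrable function is 0 by convention, so integrability comes
  first. A nonnegative integrand with integral 0 would vanish almost everywhere, against its
  positivity on the ball without the origin.\<close>

lemma holmes_thompson_pos: "holmes_thompson (randers_norm a b) > 0"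
proof -
  let ?g = "\<lambda>y. det (fundamental_tensor (randers_norm a b) y)" and ?B = "{y. randers_norm a b y < 1}"
  obtain M where M: "\<And>y. y \<noteq> 0 \<Longrightarrow> \<bar>?g y\<bar> \<le> M" using fundamental_tensor_det_bounded by blast
  have B[measurable]: "?B \<in> sets borel" using open_randers_ball by auto
  note [measurable] = fundamental_tensor_det_measurable
  define k where "k y = indicator ?B y *\<^sub>R ?g y" for y
  have ne: "AE y in lborel. y \<noteq> (0 :: real ^ 'n)" by (rule AE_lborel_singleton)
  have int: "integrable lborel k"
  proof (rule Bochner_Integration.integrable_bound)
    show "integrable lborel (\<lambda>y. indicator ?B y *\<^sub>R M)"
      using randers_ball_emeasure(1) by (intro integrable_real_indicator integrable_scaleR_left) auto
    show "k \<in> borel_measurable lborel" unfolding k_def[abs_def] by measurable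
    show "AE y in lborel. norm (k y) \<le> norm (indicator ?B y *\<^sub>R M)"
      using ne by eventually_elim (use M in \<open>fastforce simp: k_def indicator_def\<close>)
  qed
  have gpos: "?g y > 0" if "y \<noteq> 0" for y
    using det_positive_definite fundamental_tensor_positive[OF that] by blast
  have nn: "AE y in lborel. 0 \<le> k y"
    using ne by eventually_elim (use gpos in \<open>fastforce simp: k_def indicator_def\<close>)
  have "integral\<^sup>L lborel k \<noteq> 0"
  proof
    assume "integral\<^sup>L lborel k = 0"
    then have "AE y in lborel. k y = 0" using integral_nonneg_eq_0_iff_AE[OF int nn] by simp
    then have "AE y in lborel. y \<notin> ?B - {0}"
      by eventually_elim (use gpos in \<open>fastforce simp: k_def indicator_def\<close>)
    then have "emeasure lborel (?B - {0}) = 0"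
      using B by (subst (asm) AE_iff_null_sets[symmetric]) (auto simp: null_sets_def)
    then show False using randers_ball_emeasure(2) by simp
  qed
  moreover have "integral\<^sup>L lborel k \<ge> 0" by (rule integral_nonneg_AE[OF nn])
  ultimately have "(LINT y:?B|lborel. ?g y) > 0" by (simp add: set_lebesgue_integral_def k_def[abs_def])
  then show ?thesis using content_ball_pos[of 1 "0 :: real ^ 'n"] by (simp add: holmes_thompson_def)
qed

end

subsection \<open>The frame of an isoparametric function\<close>

text \<open>If \<open>g = \<Gamma> \<circ> f\<close> had a differential independent of that of \<open>f\<close>, then \<open>(f, g)\<close> would be an open map
  into the graph of \<open>\<Gamma>\<close>.\<close>

lemma functional_dependence:
  fixes f g :: "'a::real_normed_vector \<Rightarrow> real"
  assumes U: "open U" "x \<in> U" and cont: "continuous_on U f" "continuous_on U g"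
    and f': "(f has_derivative f') (at x)" and g': "(g has_derivative g') (at x)"
    and \<Gamma>: "\<And>y. y \<in> U \<Longrightarrow> g y = \<Gamma> (f y)" and u: "f' u \<noteq> 0" and v: "f' v = 0"
  shows "g' v = 0"
proof (rule ccontr)
  assume gv: "g' v \<noteq> 0"
  have lin: "linear f'" "linear g'"
    using f' g' has_derivative_linear by blast+
  \<comment> \<open>A right inverse of the pair of differentials: \<open>u\<close> adjusts the first
    component, and \<open>v\<close>, invisible to \<open>f'\<close>, corrects the second.\<close>
  define h where "h q = (fst q / f' u) *\<^sub>R u + ((snd q - fst q / f' u * g' u) / g' v) *\<^sub>R v" for q :: "real \<times> real"
  have "linear h"
    by (rule linearI) (auto simp: h_def add_divide_distrib diff_divide_distrib algebra_simps)
  then have bh: "bounded_linear h" by (rule linear_conv_bounded_linear[THEN iffD1])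
  have id: "(\<lambda>z. (f' z, g' z)) \<circ> h = id"
  proof
    fix q
    have "f' (h q) = fst q" "g' (h q) = snd q"
      using u v gv by (simp_all add: h_def linear_add[OF lin(1)] linear_add[OF lin(2)]
          linear_cmul[OF lin(1)] linear_cmul[OF lin(2)])
    then show "((\<lambda>z. (f' z, g' z)) \<circ> h) q = id q" by simp
  qed
  have "(f x, g x) \<in> interior ((\<lambda>z. (f z, g z)) ` U)"
    by (rule sussmann_open_mapping[OF U(1) _ U(2) _ bh id, of "\<lambda>z. (f z, g z)"])
      (use U cont f' g' in \<open>auto intro!: continuous_intros has_derivative_Pair simp: interior_open\<close>)
  then obtain e where e: "e > 0" "ball (f x, g x) e \<subseteq> (\<lambda>z. (f z, g z)) ` U"
    by (auto simp: mem_interior)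
  \<comment> \<open>Same value of \<open>f\<close> but another value of \<open>g\<close>, which
    \<Gamma> excludes.\<close>
  have "(f x, g x + e / 2) \<in> ball (f x, g x) e"
    using e(1) by (simp add: dist_Pair_Pair dist_real_def)
  then obtain y where "y \<in> U" "f y = f x" "g y = g x + e / 2" using e(2) by auto
  then show False using \<Gamma>[of y] \<Gamma>[OF U(2)] e(1) by simp
qed

lemma along_cmult: "g differentiable (at x) \<Longrightarrow> along X (\<lambda>x. c * g x) x = c * along X g x"
  using along_mult[OF differentiable_const, of g x X c] by (simp add: along_const)

lemma along_compose:
  assumes "h differentiable (at x)" "c differentiable (at (h x))"
  shows "along X (\<lambda>x. c (h x)) x = along X h x * deriv c (h x)"
proof -
  have "(c has_field_derivative deriv c (h x)) (at (h x))"
    using assms(2) by (metis DERIV_deriv_iff_real_differentiable)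
  then have "((\<lambda>x. c (h x)) has_derivative (\<lambda>v. deriv c (h x) * frechet_derivative h (at x) v)) (at x)"
    using assms(1) has_derivative_compose[of h "frechet_derivative h (at x)" x UNIV c "(*) (deriv c (h x))"]
    by (simp add: has_field_derivative_def frechet_derivative_works)
  from along_eqI[OF this] show ?thesis by (simp add: along_def mult.commute)
qed

locale isoparametric_zermelo = zermelo F D w
  for F :: "real ^ 'n::finite \<Rightarrow> real" and D w +
  fixes f :: "real ^ 'n \<Rightarrow> real" and S :: "(real ^ 'n) set" and \<sigma> :: real and c d :: "real \<Rightarrow> real"
  assumes \<sigma>: "\<sigma> \<noteq> 0" and closed_S: "closed S" and smooth_f: "smooth_on (- S) f"
    and smooth_c: "smooth_on (f ` regular_set f S) c"
    and transnormal: "x \<in> regular_set f S \<Longrightarrow> F (gradient F f x) = c (f x)"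
    and laplace: "x \<in> regular_set f S \<Longrightarrow> laplacian F \<sigma> f x = d (f x)"
begin

definition U :: "(real ^ 'n) set" where "U = regular_set f S"

definition df :: "real ^ 'n \<Rightarrow> real ^ 'n" where "df x = differential f x"

definition n :: "real ^ 'n \<Rightarrow> real ^ 'n" where
  "n x = (1 / norm (pull (df x))) *\<^sub>R pull (df x)"

definition \<nu> :: "'n \<Rightarrow> real ^ 'n \<Rightarrow> real" where "\<nu> k x = n x $ k"

definition v :: "'n \<Rightarrow> real ^ 'n \<Rightarrow> real ^ 'n" where
  "v k x = C *v axis k 1 + \<nu> k x *\<^sub>R w"

definition speed :: "real ^ 'n \<Rightarrow> real" where "speed x = dual (df x)"

lemma smooth_df: "smooth_on (- S) df"
  unfolding df_def[abs_def] differential_def[abs_def] partial_deriv_def[abs_def]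
  using closed_S by (intro smooth_on_vec_lambda smooth_on_frechet_derivative smooth_f) auto

lemma U_eq: "U = {x \<in> - S. df x \<in> - {0}}"
  by (auto simp: U_def regular_set_def df_def)

lemma open_U: "open U"
  unfolding U_eq using closed_S continuous_open_preimage[OF smooth_on_imp_continuous_on[OF smooth_df], of "- {0}"]
  by (simp add: Int_def vimage_def open_Compl)

lemma smooth_f_U: "smooth_on U f" and smooth_df_U: "smooth_on U df"
  by (rule smooth_on_subset[OF smooth_f] smooth_on_subset[OF smooth_df], auto simp: U_eq)+

lemma df_nz: "x \<in> U \<Longrightarrow> df x \<noteq> 0" by (simp add: U_eq)

lemma df_inner: "x \<in> U \<Longrightarrow> frechet_derivative f (at x) h = df x \<bullet> h"
  unfolding df_def by (intro differential_inner smooth_on_imp_differentiable[OF smooth_f_U])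

lemma norm_pull_pos: "x \<in> U \<Longrightarrow> norm (pull (df x)) > 0"
  by (simp add: pull_eq_0_iff df_nz)

lemma smooth_pull: "smooth_on U (\<lambda>x. pull (df x))"
  unfolding pull_def by (intro smooth_on_linear[OF open_U matrix_vector_mul_bounded_linear] smooth_df_U)

lemma smooth_norm_pull: "smooth_on U (\<lambda>x. norm (pull (df x)))"
  unfolding norm_eq_sqrt_inner using norm_pull_pos
  by (intro smooth_on_sqrt open_U smooth_on_bilinear[OF open_U bounded_bilinear_inner] smooth_pull)
    (auto simp: norm_eq_sqrt_inner)

lemma smooth_n: "smooth_on U n"
  unfolding n_def[abs_def] using norm_pull_pos
  by (intro smooth_on_scaleR smooth_on_divide open_U smooth_on_const smooth_norm_pull smooth_pull) auto

lemma smooth_\<nu>: "smooth_on U (\<nu> k)"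
  unfolding \<nu>_def[abs_def] by (intro smooth_on_nth open_U smooth_n)

lemma smooth_v: "smooth_on U (v k)"
  unfolding v_def[abs_def] by (intro smooth_on_add smooth_on_scaleR smooth_on_const open_U smooth_\<nu>)

lemma smooth_speed: "smooth_on U speed"
  unfolding speed_def[abs_def] dual_def
  by (intro smooth_on_add open_U smooth_norm_pull smooth_on_linear[OF open_U bounded_linear_inner_right] smooth_df_U)

lemma norm_n: "x \<in> U \<Longrightarrow> norm (n x) = 1"
  using norm_pull_pos by (simp add: n_def)

lemma pull_df: "x \<in> U \<Longrightarrow> pull (df x) = norm (pull (df x)) *\<^sub>R n x"
  using norm_pull_pos by (simp add: n_def)

lemma speed_pos: "x \<in> U \<Longrightarrow> speed x > 0"
  by (simp add: speed_def dual_pos df_nz)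

lemma gradient_eq: "x \<in> U \<Longrightarrow> gradient F f x = speed x *\<^sub>R (w + C *v n x)"
  unfolding gradient_def df_def[symmetric] speed_def n_def by (rule legendre_inverse[OF df_nz])

lemma F_gradient: "x \<in> U \<Longrightarrow> F (gradient F f x) = speed x"
  by (simp add: gradient_eq F_direction norm_n speed_pos)

lemma speed_eq: "x \<in> U \<Longrightarrow> speed x = c (f x)"
  using transnormal F_gradient by (simp add: U_def)

lemma along_v:
  assumes "h differentiable (at x)"
  shows "along (v k) h x = frechet_derivative h (at x) (C *v axis k 1) + \<nu> k x * frechet_derivative h (at x) w"
  using linear_frechet_derivative[OF assms] by (simp add: along_def v_def linear_add linear_cmul)

lemma along_f: assumes "x \<in> U" shows "along (v k) f x = speed x * \<nu> k x"
proof -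
  have "along (v k) f x = pull (df x) $ k + \<nu> k x * (df x \<bullet> w)"
    using assms by (simp add: along_v smooth_on_imp_differentiable[OF smooth_f_U] df_inner inner_C inner_axis)
  also have "pull (df x) $ k = norm (pull (df x)) * \<nu> k x"
    using pull_df[OF assms] by (metis \<nu>_def vector_scaleR_component real_scaleR_def)
  finally show ?thesis by (simp add: speed_def dual_def inner_commute algebra_simps)
qed

lemma differentiable_c: "x \<in> U \<Longrightarrow> c differentiable (at (f x))"
  by (rule smooth_on_imp_differentiable[OF smooth_c]) (simp add: U_def)

lemma along_speed: assumes "x \<in> U" shows "along X speed x = along X f x * deriv c (f x)"
proof -
  have "along X speed x = along X (\<lambda>x. c (f x)) x"
    using speed_eq by (intro along_cong[OF open_U assms])
  also have "\<dots> = along X f x * deriv c (f x)"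
    by (intro along_compose smooth_on_imp_differentiable[OF smooth_f_U assms] differentiable_c assms)
  finally show ?thesis .
qed

text \<open>The frame fields differ from constant fields by multiples of the one constant field
  \<open>w\<close>, so second derivatives of \<open>h\<close> cancel and only derivatives of the
  coefficients \<nu>, multiplying the derivative along \<open>w\<close>, remain.\<close>

lemma commutator:
  assumes W: "open W" "W \<subseteq> U" and h: "smooth_on W h" and x: "x \<in> W"
  shows "along (v k) (along (v l) h) x - along (v l) (along (v k) h) x =
    (along (v k) (\<nu> l) x - along (v l) (\<nu> k) x) * frechet_derivative h (at x) w"
proof -
  let ?P = "\<lambda>u h x. frechet_derivative h (at x) u"
  let ?C = "\<lambda>k. C *v axis k 1"
  have \<nu>W: "smooth_on W (\<nu> k)" for k using smooth_on_subset[OF smooth_\<nu> W(2)] .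
  have sd: "smooth_on W (?P u h)" for u by (rule smooth_on_frechet_derivative[OF h])
  have "along (v k) (along (v l) h) x =
      ?P (?C k) (?P (?C l) h) x + \<nu> k x * ?P w (?P (?C l) h) x +
      (\<nu> l x * (?P (?C k) (?P w h) x + \<nu> k x * ?P w (?P w h) x) + along (v k) (\<nu> l) x * ?P w h x)"
    for k l
  proof -
    have "along (v k) (along (v l) h) x = along (v k) (\<lambda>y. ?P (?C l) h y + \<nu> l y * ?P w h y) x"
      by (rule along_cong[OF W(1) x]) (rule along_v[OF smooth_on_imp_differentiable[OF h]])
    also have "\<dots> = along (v k) (?P (?C l) h) x + along (v k) (\<lambda>y. \<nu> l y * ?P w h y) x"
      by (intro along_add smooth_on_imp_differentiable[OF _ x] sd smooth_on_mult W \<nu>W)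
    also have "along (v k) (\<lambda>y. \<nu> l y * ?P w h y) x = \<nu> l x * along (v k) (?P w h) x + along (v k) (\<nu> l) x * ?P w h x"
      by (intro along_mult smooth_on_imp_differentiable[OF _ x] sd \<nu>W)
    finally show ?thesis
      by (simp only: along_v[OF smooth_on_imp_differentiable[OF sd x]])
  qed
  then show ?thesis
    using smooth_on_frechet_derivative_symmetric[OF W(1) x h, of "?C k" "?C l"]
      smooth_on_frechet_derivative_symmetric[OF W(1) x h, of "?C k" w]
      smooth_on_frechet_derivative_symmetric[OF W(1) x h, of "?C l" w]
    by (simp add: algebra_simps)
qed

text \<open>Apply \<open>commutator\<close> to \<open>f\<close>. Since the speed is a function of
  \<open>f\<close>, its derivatives contribute a symmetric term, and the antisymmetric part of
  \<open>A\<close> is left with the factor \<open>speed x - df x \<bullet> w\<close>, which is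
  \<open>norm (pull (df x))\<close> and nonzero.\<close>

lemma along_\<nu>_symmetric:
  assumes x: "x \<in> U"
  shows "along (v k) (\<nu> l) x = along (v l) (\<nu> k) x"
proof -
  have E2: "along (v k) (along (v l) f) x =
      speed x * along (v k) (\<nu> l) x + speed x * \<nu> k x * deriv c (f x) * \<nu> l x" for k l
  proof -
    have "along (v k) (along (v l) f) x = along (v k) (\<lambda>y. speed y * \<nu> l y) x"
      using along_f by (intro along_cong[OF open_U x])
    also have "\<dots> = speed x * along (v k) (\<nu> l) x + along (v k) speed x * \<nu> l x"
      by (intro along_mult smooth_on_imp_differentiable[OF _ x] smooth_speed smooth_\<nu>)
    finally show ?thesis by (simp add: along_speed x along_f)
  qed
  have "(along (v k) (\<nu> l) x - along (v l) (\<nu> k) x) * (speed x - df x \<bullet> w) = 0"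
    using commutator[OF open_U order_refl smooth_f_U x, of k l] E2[of k l] E2[of l k]
    by (simp add: df_inner x algebra_simps)
  moreover have "speed x - df x \<bullet> w \<noteq> 0"
    using norm_pull_pos[OF x] by (simp add: speed_def dual_def inner_commute)
  ultimately show ?thesis by simp
qed

sublocale normal_frame U v \<nu>
proof
  show "along (v k) (along (v l) h) x = along (v l) (along (v k) h) x"
    if "open W" "W \<subseteq> U" "smooth_on W h" "x \<in> W" for k l W h x
    using commutator[OF that, of k l] along_\<nu>_symmetric[of x k l] that by auto
  show "(\<Sum>k\<in>UNIV. (\<nu> k x)\<^sup>2) = 1" if "x \<in> U" for x
    using norm_n[OF that] by (simp add: \<nu>_def norm_vec_def L2_set_def)
qed (use open_U smooth_v smooth_\<nu> along_\<nu>_symmetric in auto)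

lemma E_sum_frame:
  assumes "h differentiable (at x)"
  shows "(\<Sum>k\<in>UNIV. u $ k * E k h x) =
    frechet_derivative h (at x) (C *v u) + (u \<bullet> n x) * frechet_derivative h (at x) w"
proof -
  note lin = linear_frechet_derivative[OF assms]
  have "u = (\<Sum>k\<in>UNIV. u $ k *\<^sub>R axis k 1)"
    by (simp add: vec_eq_iff axis_def if_distrib[of "(*) _"] cong: if_cong)
  then have "C *v u = C *v (\<Sum>k\<in>UNIV. u $ k *\<^sub>R axis k 1)" by simp
  also have "\<dots> = (\<Sum>k\<in>UNIV. u $ k *\<^sub>R (C *v axis k 1))"
    by (simp add: linear_sum[OF matrix_vector_mul_linear] matrix_vector_mult_scaleR)
  finally have "frechet_derivative h (at x) (C *v u) = (\<Sum>k\<in>UNIV. u $ k * frechet_derivative h (at x) (C *v axis k 1))"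
    by (simp add: linear_sum[OF lin] linear_cmul[OF lin])
  then show ?thesis
    by (simp add: along_v[OF assms] inner_vec_def \<nu>_def sum.distrib sum_distrib_right distrib_left mult.assoc)
qed

text \<open>The frame is a basis because the wind is slower than unit speed: the combination with
  coefficients \<open>D *v w\<close> is the derivative along \<open>w\<close> times the positive
  number \<open>1 + n x \<bullet> (D *v w)\<close>.\<close>

lemma frame_spans:
  assumes h: "h differentiable (at x)" and x: "x \<in> U" and E0: "\<And>k. E k h x = 0"
  shows "frechet_derivative h (at x) u = 0"
proof -
  have s: "frechet_derivative h (at x) (C *v u) + (u \<bullet> n x) * frechet_derivative h (at x) w = 0" for u
    using E_sum_frame[OF h, of u] E0 by simp
  have "(1 + n x \<bullet> (D *v w)) * frechet_derivative h (at x) w = 0"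
    using s[of "D *v w"] by (simp add: CD inner_commute algebra_simps)
  then have "frechet_derivative h (at x) w = 0" using wind_inner[OF norm_n[OF x]] by simp
  then show ?thesis using s[of "D *v u"] by (simp add: CD)
qed

lemma frame_tangent:
  assumes h: "h differentiable (at x)" and x: "x \<in> U" and E: "\<And>k. E k h x = q * \<nu> k x"
  shows "frechet_derivative h (at x) u = q / speed x * (df x \<bullet> u)"
proof -
  let ?g = "\<lambda>y. h y + - (q / speed x) * f y"
  have f: "f differentiable (at x)" by (rule smooth_on_imp_differentiable[OF smooth_f_U x])
  then have g: "?g differentiable (at x)" using h by (intro derivative_intros)
  have g': "along X ?g x = along X h x + - (q / speed x) * along X f x" for X
  proof -
    have "along X ?g x = along X h x + along X (\<lambda>y. - (q / speed x) * f y) x"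
      by (rule along_add[OF h]) (intro derivative_intros f)
    then show ?thesis by (simp only: along_cmult[OF f])
  qed
  then have "E k ?g x = 0" for k
    unfolding g' using speed_pos[OF x] by (simp add: E along_f x)
  from frame_spans[OF g x this] have "frechet_derivative ?g (at x) u = 0" .
  then show ?thesis using g'[of "\<lambda>_. u"] unfolding along_def by (simp add: df_inner x)
qed

text \<open>The constant density cancels, and the gradient is the speed times
  \<open>w + C n\<close>. The speed contributes its derivative along that field. The divergence of
  \<open>C n\<close> equals the trace of \<open>A\<close>, since the extra terms
  \<open>\<nu> k\<close> times the derivative of \<open>\<nu> k\<close> along \<open>w\<close> add
  up to half the derivative of \<open>\<bar>\<nu>\<bar>\<^sup>2 = 1\<close>.\<close>

lemma laplacian_eq:
  assumes x: "x \<in> U"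
  shows "laplacian F \<sigma> f x = speed x * deriv c (f x) + speed x * p 1 x"
proof -
  let ?P = "\<lambda>u h. frechet_derivative h (at x) u"
  have pd: "partial_deriv i (\<lambda>z. \<sigma> * gradient F f z $ i) x =
     \<sigma> * (speed x * (\<Sum>k\<in>UNIV. C $ i $ k * ?P (axis i 1) (\<nu> k)) + ?P (axis i 1) speed * (w + C *v n x) $ i)" for i
  proof -
    note df = smooth_on_imp_differentiable[OF _ x]
    have "along (\<lambda>_. axis i 1) (\<lambda>z. \<sigma> * gradient F f z $ i) x =
        along (\<lambda>_. axis i 1) (\<lambda>z. \<sigma> * (speed z * (w $ i + (\<Sum>k\<in>UNIV. C $ i $ k * \<nu> k z)))) x"
      by (rule along_cong[OF open_U x])
        (simp add: gradient_eq matrix_vector_mult_def \<nu>_def)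
    also have "\<dots> = \<sigma> * (speed x * (\<Sum>k\<in>UNIV. C $ i $ k * ?P (axis i 1) (\<nu> k))
        + ?P (axis i 1) speed * (w $ i + (\<Sum>k\<in>UNIV. C $ i $ k * \<nu> k x)))"
      by (subst along_mult along_sum along_add along_const
          | (intro df smooth_on_mult smooth_on_sum smooth_on_add smooth_on_const smooth_speed smooth_\<nu> open_U; fail)
          | simp add: along_const)+ (simp add: along_def)
    finally show ?thesis
      by (simp add: along_def partial_deriv_def matrix_vector_mult_def \<nu>_def)
  qed
  have "laplacian F \<sigma> f x = speed x * (\<Sum>i\<in>UNIV. \<Sum>k\<in>UNIV. C $ i $ k * ?P (axis i 1) (\<nu> k))
      + (\<Sum>i\<in>UNIV. ?P (axis i 1) speed * (w + C *v n x) $ i)"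
    using \<sigma> by (simp add: laplacian_def divergence_def pd sum.distrib sum_distrib_left distrib_left)
  also have "(\<Sum>i\<in>UNIV. ?P (axis i 1) speed * (w + C *v n x) $ i) = ?P (w + C *v n x) speed"
    using differential_inner[OF smooth_on_imp_differentiable[OF smooth_speed x], of "w + C *v n x"]
    by (simp add: differential_def partial_deriv_def inner_vec_def)
  also have "\<dots> = df x \<bullet> (w + C *v n x) * deriv c (f x)"
    using along_speed[OF x, of "\<lambda>_. w + C *v n x"] by (simp add: along_def df_inner x)
  also have "df x \<bullet> (w + C *v n x) = speed x"
  proof -
    have "pull (df x) \<bullet> n x = (norm (pull (df x)) *\<^sub>R n x) \<bullet> n x"
      by (rule arg_cong[OF pull_df[OF x]])
    then have "pull (df x) \<bullet> n x = norm (pull (df x))"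
      using norm_n[OF x] by (simp add: dot_square_norm)
    then show ?thesis by (simp add: inner_add_right inner_C speed_def dual_def inner_commute[of "df x" w])
  qed
  also have "(\<Sum>i\<in>UNIV. \<Sum>k\<in>UNIV. C $ i $ k * ?P (axis i 1) (\<nu> k)) = p 1 x"
  proof -
    have "(\<Sum>i\<in>UNIV. \<Sum>k\<in>UNIV. C $ i $ k * ?P (axis i 1) (\<nu> k)) =
        (\<Sum>k\<in>UNIV. \<Sum>i\<in>UNIV. C $ i $ k * ?P (axis i 1) (\<nu> k))" by (rule sum.swap)
    also have "\<dots> = (\<Sum>k\<in>UNIV. ?P (C *v axis k 1) (\<nu> k))"
    proof (rule sum.cong[OF refl])
      fix k
      have col: "(C *v axis k 1) $ i = C $ i $ k" for i
        by (simp add: matrix_vector_mul_component inner_axis)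
      have "?P (C *v axis k 1) (\<nu> k) = differential (\<nu> k) x \<bullet> (C *v axis k 1)"
        by (rule differential_inner[OF smooth_on_imp_differentiable[OF smooth_\<nu> x]])
      also have "\<dots> = (\<Sum>i\<in>UNIV. differential (\<nu> k) x $ i * C $ i $ k)"
        by (simp add: inner_vec_def col)
      finally show "(\<Sum>i\<in>UNIV. C $ i $ k * ?P (axis i 1) (\<nu> k)) = ?P (C *v axis k 1) (\<nu> k)"
        by (simp add: differential_def partial_deriv_def mult.commute)
    qed
    also have "\<dots> = (\<Sum>k\<in>UNIV. E k (\<nu> k) x - \<nu> k x * ?P w (\<nu> k))"
      by (simp add: along_v[OF smooth_on_imp_differentiable[OF smooth_\<nu> x]])
    also have "\<dots> = (\<Sum>k\<in>UNIV. E k (\<nu> k) x) - (\<Sum>k\<in>UNIV. \<nu> k x * ?P w (\<nu> k))" by (rule sum_subtractf)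
    also have "(\<Sum>k\<in>UNIV. \<nu> k x * ?P w (\<nu> k)) = 0"
    proof -
      have "0 = along (\<lambda>_. w) (\<lambda>y. \<Sum>k\<in>UNIV. \<nu> k y * \<nu> k y) x"
        using along_cong[OF open_U x, of "\<lambda>y. \<Sum>k\<in>UNIV. \<nu> k y * \<nu> k y" "\<lambda>_. 1" "\<lambda>_. w"] unit
        by (simp add: along_const power2_eq_square)
      also have "\<dots> = (\<Sum>k\<in>UNIV. 2 * (\<nu> k x * ?P w (\<nu> k)))"
      proof -
        have d: "\<nu> k differentiable (at x)" for k by (rule smooth_on_imp_differentiable[OF smooth_\<nu> x])
        have "along (\<lambda>_. w) (\<lambda>y. \<Sum>k\<in>UNIV. \<nu> k y * \<nu> k y) x = (\<Sum>k\<in>UNIV. along (\<lambda>_. w) (\<lambda>y. \<nu> k y * \<nu> k y) x)"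
          by (rule along_sum) (intro differentiable_mult d)
        also have "\<dots> = (\<Sum>k\<in>UNIV. 2 * (\<nu> k x * ?P w (\<nu> k)))"
          by (rule sum.cong[OF refl]) (subst along_mult[OF d d], simp add: along_def)
        finally show ?thesis .
      qed
      finally show ?thesis by (simp add: sum_distrib_left[symmetric])
    qed
    finally show ?thesis by (simp add: p_def trace_def shape_def E_\<nu>)
  qed
  finally show ?thesis by simp
qed

text \<open>\<open>laplacian_eq\<close> solved for the trace of \<open>A\<close>.\<close>

definition H :: "real \<Rightarrow> real" where "H t = (d t - c t * deriv c t) / c t"

lemma mean_curvature: assumes "x \<in> U" shows "p 1 x = H (f x)"
  using laplacian_eq[OF assms] laplace[of x] speed_eq[OF assms] speed_pos[OF assms] assms
  by (simp add: H_def U_def field_simps)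

text \<open>\<open>H\<close> is not known to be differentiable, so \<open>p 1 = H \<circ> f\<close>
  cannot be differentiated by the chain rule. \<open>functional_dependence\<close> shows instead
  that the differential of \<open>p 1\<close> vanishes on the kernel of \<open>df\<close>, here on
  the vectors \<open>\<nu> j v k - \<nu> k v j\<close>.\<close>

lemma p1_normal: assumes x: "x \<in> U" shows "E k (p 1) x = - p 2 x * \<nu> k x"
proof -
  have sp: "p 1 differentiable (at x)" "f differentiable (at x)"
    by (rule smooth_on_imp_differentiable[OF smooth_p x] smooth_on_imp_differentiable[OF smooth_f_U x])+
  note lin = linear_frechet_derivative[OF sp(1)] linear_frechet_derivative[OF sp(2)]
  have *: "\<nu> j x * E k (p 1) x = \<nu> k x * E j (p 1) x" for j
  proof -
    let ?h = "\<nu> j x *\<^sub>R v k x - \<nu> k x *\<^sub>R v j x"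
    have "frechet_derivative f (at x) ?h = \<nu> j x * E k f x - \<nu> k x * E j f x"
      by (simp add: linear_diff[OF lin(2)] linear_cmul[OF lin(2)] along_def)
    then have 0: "frechet_derivative f (at x) ?h = 0" by (simp add: along_f x)
    have "df x \<bullet> df x \<noteq> 0" using df_nz[OF x] by simp
    then have 1: "frechet_derivative f (at x) (df x) \<noteq> 0" by (simp add: df_inner x)
    have "frechet_derivative (p 1) (at x) ?h = 0"
      using functional_dependence[OF open_U x smooth_on_imp_continuous_on[OF smooth_f_U]
          smooth_on_imp_continuous_on[OF smooth_p] _ _ mean_curvature 1 0] sp
      by (simp add: frechet_derivative_works)
    then show ?thesis by (simp add: linear_diff[OF lin(1)] linear_cmul[OF lin(1)] along_def del: One_nat_def)
  qed
  have "E k (p 1) x = (\<Sum>j\<in>UNIV. (\<nu> j x)\<^sup>2) * E k (p 1) x" using unit x by simp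
  also have "\<dots> = (\<Sum>j\<in>UNIV. \<nu> j x * (\<nu> j x * E k (p 1) x))"
    by (simp add: sum_distrib_right power2_eq_square mult.assoc)
  also have "\<dots> = \<nu> k x * (\<Sum>j\<in>UNIV. \<nu> j x * E j (p 1) x)"
    unfolding * by (simp add: sum_distrib_left mult.left_commute)
  also have "\<dots> = - p 2 x * \<nu> k x" using E_p_normal[OF x, of 0] by (simp add: numeral_2_eq_2)
  finally show ?thesis .
qed

end

subsection \<open>Local shape of the level surfaces\<close>

text \<open>All eigenvalues are 0 or \<open>l\<close>, so no product of two of them is negative and
  the squared trace dominates its diagonal terms.\<close>

lemma trace_square_le:
  fixes A :: "real ^ 'n ^ 'n"
  assumes A: "transpose A = A" and sq: "A ** A = l *\<^sub>R A"
  shows "trace (A ** A) \<le> (trace A)\<^sup>2"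
proof -
  obtain e :: "'n \<Rightarrow> real ^ 'n" and d where
    on: "\<And>i j. e i \<bullet> e j = (if i = j then 1 else 0)" and ev: "\<And>i. A *v e i = d i *\<^sub>R e i"
    using symmetric_matrix_eigenbasis[OF A] by blast
  have dd: "d i = 0 \<or> d i = l" for i
  proof -
    have "(A ** A) *v e i = (l *\<^sub>R A) *v e i" by (simp add: sq)
    then have "(d i * d i) *\<^sub>R e i = (l * d i) *\<^sub>R e i"
      by (simp add: matrix_vector_mul_assoc[symmetric] ev matrix_vector_mult_scaleR scaleR_matrix_vector_assoc[symmetric])
    then have "(d i * d i) * (e i \<bullet> e i) = (l * d i) * (e i \<bullet> e i)" by (metis inner_scaleR_left)
    then show ?thesis by (simp add: on)
  qed
  have "trace (A ** A) = (\<Sum>i\<in>UNIV. d i * d i)"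
    by (simp add: trace_orthonormal_family[OF on] matrix_vector_mul_assoc[symmetric] ev on matrix_vector_mult_scaleR)
  also have "\<dots> \<le> (\<Sum>i\<in>UNIV. \<Sum>j\<in>UNIV. d i * d j)"
  proof (rule sum_mono)
    fix i
    have "d i * d j \<ge> 0" for j using dd[of i] dd[of j] by auto
    then show "d i * d i \<le> (\<Sum>j\<in>UNIV. d i * d j)" by (intro member_le_sum) auto
  qed
  also have "\<dots> = (trace A)\<^sup>2"
    by (simp add: trace_orthonormal_family[OF on] ev on power2_eq_square sum_product)
  finally show ?thesis .
qed

text \<open>The weight \<open>exp (- 2 K s)\<close> makes \<open>g\<^sup>2\<close> nonincreasing,
  and it starts at 0.\<close>

lemma gronwall_zero:
  fixes g :: "real \<Rightarrow> real"
  assumes d: "\<And>s. 0 \<le> s \<Longrightarrow> s \<le> 1 \<Longrightarrow> (g has_real_derivative g' s) (at s)"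
    and b: "\<And>s. 0 \<le> s \<Longrightarrow> s \<le> 1 \<Longrightarrow> \<bar>g' s\<bar> \<le> K * \<bar>g s\<bar>" and g0: "g 0 = 0"
  shows "g 1 = 0"
proof -
  have "(g 1)\<^sup>2 * exp (- 2 * K * 1) \<le> (g 0)\<^sup>2 * exp (- 2 * K * 0)"
  proof (rule DERIV_nonpos_imp_nonincreasing[of 0 1 "\<lambda>s. (g s)\<^sup>2 * exp (- 2 * K * s)"])
    fix s :: real assume s: "0 \<le> s" "s \<le> 1"
    have "((\<lambda>s. (g s)\<^sup>2 * exp (- 2 * K * s)) has_real_derivative
        (2 * (g s * g' s) - 2 * K * (g s)\<^sup>2) * exp (- 2 * K * s)) (at s)"
      by (auto intro!: derivative_eq_intros d s simp: algebra_simps power2_eq_square)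
    moreover have "g s * g' s \<le> \<bar>g s\<bar> * \<bar>g' s\<bar>" by (metis abs_ge_self abs_mult)
    then have "g s * g' s \<le> K * (g s)\<^sup>2"
      using mult_left_mono[OF b[OF s], of "\<bar>g s\<bar>"] by (simp add: power2_eq_square ac_simps)
    then have "(2 * (g s * g' s) - 2 * K * (g s)\<^sup>2) * exp (- 2 * K * s) \<le> 0"
      by (intro mult_nonpos_nonneg) auto
    ultimately show "\<exists>y. ((\<lambda>s. (g s)\<^sup>2 * exp (- 2 * K * s)) has_real_derivative y) (at s) \<and> y \<le> 0" by blast
  qed simp
  then show ?thesis using g0 by (simp add: mult_le_0_iff)
qed

lemma projection_norm_le:
  fixes P :: "real ^ 'n ^ 'n"
  assumes "transpose P = P" "P ** P = P"
  shows "norm (P *v u) \<le> norm u"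
proof -
  have "(P *v u) \<bullet> (P *v u) = (P *v u) \<bullet> u"
    using symmetric_matrix_inner[OF assms(1), of "P *v u" u] assms(2) by (simp add: matrix_vector_mul_assoc)
  also have "\<dots> \<le> norm (P *v u) * norm u" by (rule norm_cauchy_schwarz)
  finally show ?thesis by (cases "norm (P *v u) = 0") (auto simp: dot_square_norm power2_eq_square)
qed

context isoparametric_zermelo
begin

lemma isoparametric_shape_square:
  assumes "x \<in> U" shows "\<exists>l. shape x ** shape x = l *\<^sub>R shape x"
  using shape_square[OF _ assms] p1_normal by blast

lemma isoparametric_shape_derivative:
  assumes "x \<in> U"
  shows "E k (A i j) x = - (\<nu> k x * (shape x ** shape x) $ i $ j +
    \<nu> i x * (shape x ** shape x) $ k $ j + \<nu> j x * (shape x ** shape x) $ k $ i)"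
  using shape_derivative[OF _ assms] p1_normal by blast

lemma p_2_sum: assumes "x \<in> U" shows "p 2 x = (\<Sum>i\<in>UNIV. \<Sum>j\<in>UNIV. (A i j x)\<^sup>2)"
proof -
  have "p 2 x = trace (shape x ** transpose (shape x))"
    using shape_transpose[OF assms] by (simp add: p_def numeral_2_eq_2)
  then show ?thesis
    by (simp add: trace_def matrix_matrix_mult_def transpose_def shape_def power2_eq_square)
qed

lemma shape_square_trace:
  assumes "x \<in> U" "shape x ** shape x = l *\<^sub>R shape x"
  shows "p 2 x = l * p 1 x" "p 3 x = l * p 2 x"
  using assms by (simp_all add: p_def numeral_eq_Suc scaleR_matrix_mult trace_scaleR)

text \<open>\<open>p 2\<close> is a multiple of \<open>p 1\<close> by
  \<open>shape_square_trace\<close>, and as a sum of squares it controls every entry of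
  \<open>A\<close>.\<close>

lemma shape_eq_0: assumes x: "x \<in> U" and p: "p 1 x = 0 \<or> p 2 x = 0" shows "shape x = 0"
proof -
  obtain l where "shape x ** shape x = l *\<^sub>R shape x" using isoparametric_shape_square[OF x] by blast
  from shape_square_trace(1)[OF x this] have "p 2 x = 0" using p by auto
  then have "(\<Sum>i\<in>UNIV. \<Sum>j\<in>UNIV. (A i j x)\<^sup>2) = 0" using p_2_sum[OF x] by simp
  then have "(A i j x)\<^sup>2 = 0" for i j by (simp add: sum_nonneg_eq_0_iff sum_nonneg)
  then show ?thesis by (simp add: shape_def vec_eq_iff)
qed

lemma p_2_bounds: assumes "x \<in> U" shows "0 \<le> p 2 x" "p 2 x \<le> (p 1 x)\<^sup>2"
proof -
  show "0 \<le> p 2 x" by (simp add: p_2_sum[OF assms] sum_nonneg)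
  obtain l where "shape x ** shape x = l *\<^sub>R shape x" using isoparametric_shape_square[OF assms] by blast
  from trace_square_le[OF shape_transpose[OF assms] this]
  show "p 2 x \<le> (p 1 x)\<^sup>2" by (simp add: p_def numeral_2_eq_2)
qed

lemma segment_derivative:
  fixes h :: "real ^ 'n \<Rightarrow> real"
  assumes "h differentiable (at (x + s *\<^sub>R u))"
  shows "((\<lambda>s. h (x + s *\<^sub>R u)) has_real_derivative frechet_derivative h (at (x + s *\<^sub>R u)) u) (at s)"
proof -
  have "((\<lambda>s. h (x + s *\<^sub>R u)) has_derivative (\<lambda>t. frechet_derivative h (at (x + s *\<^sub>R u)) (t *\<^sub>R u))) (at s)"
    by (rule has_derivative_compose[where g = h])
      (use assms frechet_derivative_works in \<open>auto intro!: derivative_eq_intros\<close>)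
  then show ?thesis using linear_frechet_derivative[OF assms]
    by (simp add: linear_cmul has_field_derivative_def mult.commute[of _ "frechet_derivative h _ _"])
qed

lemma segment_in_ball:
  fixes x y :: "'v::real_normed_vector"
  assumes "y \<in> ball x e" "0 \<le> s" "s \<le> 1"
  shows "x + s *\<^sub>R (y - x) \<in> ball x e"
proof -
  have "s * norm (y - x) \<le> 1 * norm (y - x)" using assms by (intro mult_right_mono) auto
  then show ?thesis using assms by (simp add: dist_norm norm_minus_commute)
qed

lemma frame_constant:
  assumes B: "ball x e \<subseteq> U" and h: "\<And>y. y \<in> ball x e \<Longrightarrow> h differentiable (at y)"
    and E: "\<And>y k. y \<in> ball x e \<Longrightarrow> E k h y = 0" and y: "y \<in> ball x e"
  shows "h y = h x"
proof -
  have "\<exists>c. \<forall>y\<in>ball x e. h y = c"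
  proof (rule has_derivative_zero_constant)
    fix z assume z: "z \<in> ball x e"
    have "frechet_derivative h (at z) = (\<lambda>u. 0)"
    proof
      have "z \<in> U" using z B by blast
      then show "frechet_derivative h (at z) u = 0" for u
        by (rule frame_spans[OF h[OF z] _ E[OF z]])
    qed
    then have "(h has_derivative (\<lambda>u. 0)) (at z)"
      using h[OF z] frechet_derivative_works by metis
    then show "(h has_derivative (\<lambda>u. 0)) (at z within ball x e)" by (rule has_derivative_at_withinI)
  qed simp
  then show ?thesis using y by (metis centre_in_ball dist_not_less_zero linorder_not_less mem_ball zero_le_dist order.strict_trans1)
qed

section \<open>Flat points\<close>

lemma frechet_p_1:
  assumes "x \<in> U"
  shows "frechet_derivative (p 1) (at x) u = - p 2 x / speed x * (df x \<bullet> u)"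
  by (rule frame_tangent[OF smooth_on_imp_differentiable[OF smooth_p] _ p1_normal]) (use assms in auto)

text \<open>Flatness spreads from one point: the derivative of \<open>p 1\<close> is a multiple of
  \<open>p 2\<close>, which is at most \<open>(p 1)\<^sup>2\<close>, so on a compact ball it is
  bounded by a constant times \<open>\<bar>p 1\<bar>\<close>, and Gronwall's argument applies along
  segments.\<close>

lemma flat_ball:
  assumes x: "x \<in> U" and flat: "shape x = 0"
  shows "\<exists>e>0. ball x e \<subseteq> U \<and> (\<forall>y\<in>ball x e. n y = n x)"
proof -
  obtain e where e: "e > 0" "cball x e \<subseteq> U" using open_U x open_contains_cball by blast
  then have B: "ball x e \<subseteq> U" using ball_subset_cball by blast
  have "continuous_on (cball x e) (\<lambda>y. p 1 y * norm (df y) / speed y)"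
    using e(2) speed_pos smooth_on_imp_continuous_on[OF smooth_p] smooth_on_imp_continuous_on[OF smooth_df_U]
      smooth_on_imp_continuous_on[OF smooth_speed]
    by (intro continuous_intros) (auto intro: continuous_on_subset simp: less_imp_neq[symmetric])
  then have "bounded ((\<lambda>y. p 1 y * norm (df y) / speed y) ` cball x e)"
    by (intro compact_imp_bounded compact_continuous_image) auto
  then obtain K where "\<forall>z\<in>(\<lambda>y. p 1 y * norm (df y) / speed y) ` cball x e. norm z \<le> K"
    unfolding bounded_iff by blast
  then have K: "\<bar>p 1 y * norm (df y) / speed y\<bar> \<le> K" if "y \<in> cball x e" for y
    using that unfolding real_norm_def by blast
  have "p 1 y = 0" if y: "y \<in> ball x e" for y
  proof -
    define g where "g s = p 1 (x + s *\<^sub>R (y - x))" for s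
    have in_ball: "x + s *\<^sub>R (y - x) \<in> ball x e" if "0 \<le> s" "s \<le> 1" for s
      using segment_in_ball[OF y that] .
    have "g 1 = 0"
    proof (rule gronwall_zero)
      fix s :: real assume "0 \<le> s" "s \<le> 1"
      define z where "z = x + s *\<^sub>R (y - x)"
      have z: "z \<in> ball x e" using in_ball[OF \<open>0 \<le> s\<close> \<open>s \<le> 1\<close>] by (simp add: z_def)
      then have zU: "z \<in> U" using B by blast
      show "(g has_real_derivative frechet_derivative (p 1) (at (x + s *\<^sub>R (y - x))) (y - x)) (at s)"
        unfolding g_def[abs_def]
        by (rule segment_derivative) (use smooth_on_imp_differentiable[OF smooth_p] zU z_def in auto)
      have "\<bar>frechet_derivative (p 1) (at z) (y - x)\<bar> = p 2 z / speed z * \<bar>df z \<bullet> (y - x)\<bar>"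
        unfolding frechet_p_1[OF zU] using p_2_bounds[OF zU] speed_pos[OF zU] by (simp add: abs_mult)
      also have "\<dots> \<le> (p 1 z)\<^sup>2 / speed z * (norm (df z) * e)"
      proof (intro mult_mono divide_right_mono)
        have "norm (y - x) \<le> e" using y by (simp add: dist_norm norm_minus_commute)
        then show "\<bar>df z \<bullet> (y - x)\<bar> \<le> norm (df z) * e"
          using Cauchy_Schwarz_ineq2[of "df z" "y - x"] mult_left_mono[of "norm (y - x)" e "norm (df z)"] by simp
      qed (use p_2_bounds[OF zU] speed_pos[OF zU] in auto)
      also have "\<dots> = \<bar>p 1 z * norm (df z) / speed z\<bar> * e * \<bar>p 1 z\<bar>"
        using speed_pos[OF zU] by (simp add: abs_mult power2_eq_square)
      also have "\<dots> \<le> K * e * \<bar>p 1 z\<bar>"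
        using K[of z] z e(1) by (intro mult_right_mono) auto
      finally show "\<bar>frechet_derivative (p 1) (at (x + s *\<^sub>R (y - x))) (y - x)\<bar> \<le> K * e * \<bar>g s\<bar>"
        by (simp add: z_def g_def)
    next
      show "g 0 = 0" using flat by (simp add: g_def p_def trace_def)
    qed
    then show ?thesis by (simp add: g_def)
  qed
  then have s0: "shape y = 0" if "y \<in> ball x e" for y using shape_eq_0 B that by blast
  have "n y = n x" if y: "y \<in> ball x e" for y
  proof -
    have "\<nu> k y = \<nu> k x" for k
    proof (rule frame_constant[OF B _ _ y])
      show "\<nu> k differentiable (at z)" if "z \<in> ball x e" for z
        using smooth_on_imp_differentiable[OF smooth_\<nu>] B that by blast
      show "E j (\<nu> k) z = 0" if "z \<in> ball x e" for z j
        using s0[OF that] by (simp add: E_\<nu> shape_def vec_eq_iff)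
    qed
    then show ?thesis by (simp add: \<nu>_def vec_eq_iff)
  qed
  with e(1) B show ?thesis by blast
qed

lemma df_eq: "x \<in> U \<Longrightarrow> df x = norm (pull (df x)) *\<^sub>R (transpose D *v n x)"
proof -
  assume x: "x \<in> U"
  have "df x = transpose D *v pull (df x)" by (simp only: transpose_pull)
  also have "\<dots> = transpose D *v (norm (pull (df x)) *\<^sub>R n x)" by (rule arg_cong[OF pull_df[OF x]])
  finally show ?thesis by (simp only: matrix_vector_mult_scaleR)
qed

text \<open>Where \<open>n\<close> is constant, \<open>df\<close> is a positive multiple of a fixed
  covector. By the mean value theorem \<open>f y - f x\<close> then vanishes exactly when that
  covector annihilates \<open>y - x\<close>.\<close>

lemma flat_level:
  assumes x: "x \<in> U" and flat: "shape x = 0"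
  shows "\<exists>e>0. ball x e \<subseteq> U \<and> (\<forall>y\<in>ball x e.
    (f y = f x \<longleftrightarrow> (transpose D *v n x) \<bullet> y = (transpose D *v n x) \<bullet> x) \<and> n y = n x)"
proof -
  obtain e where e: "e > 0" "ball x e \<subseteq> U" "\<And>y. y \<in> ball x e \<Longrightarrow> n y = n x"
    using flat_ball[OF assms] by blast
  have "f y = f x \<longleftrightarrow> (transpose D *v n x) \<bullet> y = (transpose D *v n x) \<bullet> x" if y: "y \<in> ball x e" for y
  proof -
    have der: "((\<lambda>s. f (x + s *\<^sub>R (y - x))) has_real_derivative
        df (x + s *\<^sub>R (y - x)) \<bullet> (y - x)) (at s)" if "0 \<le> s" "s \<le> 1" for s
    proof -
      have z: "x + s *\<^sub>R (y - x) \<in> U" using segment_in_ball[OF y that] e(2) by blast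
      show ?thesis
        using segment_derivative[OF smooth_on_imp_differentiable[OF smooth_f_U z]] unfolding df_inner[OF z] .
    qed
    have "\<exists>s>0. s < 1 \<and> f (x + 1 *\<^sub>R (y - x)) - f (x + 0 *\<^sub>R (y - x)) =
        (1 - 0) * (df (x + s *\<^sub>R (y - x)) \<bullet> (y - x))"
      using MVT2[of 0 1 "\<lambda>s. f (x + s *\<^sub>R (y - x))" "\<lambda>s. df (x + s *\<^sub>R (y - x)) \<bullet> (y - x)"] der by simp
    then obtain s where s: "0 < s" "s < 1"
      "f (x + 1 *\<^sub>R (y - x)) - f (x + 0 *\<^sub>R (y - x)) = (1 - 0) * (df (x + s *\<^sub>R (y - x)) \<bullet> (y - x))"
      by auto
    define z where "z = x + s *\<^sub>R (y - x)"
    have z: "z \<in> ball x e" "z \<in> U" using segment_in_ball[OF y, of s] s e(2) by (auto simp: z_def)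
    have "f y - f x = norm (pull (df z)) * ((transpose D *v n x) \<bullet> (y - x))"
    proof -
      have "f y - f x = df z \<bullet> (y - x)" using s(3) by (simp add: z_def)
      also have "df z = norm (pull (df z)) *\<^sub>R (transpose D *v n x)"
        using df_eq[OF z(2)] unfolding e(3)[OF z(1)] .
      finally show ?thesis by simp
    qed
    then show ?thesis using norm_pull_pos[OF z(2)] by (auto simp: inner_diff_right)
  qed
  then show ?thesis using e by blast
qed


text \<open>\<open>rad\<close> is the signed radius \<open>1 / \<lambda>\<close>: on \<open>U1\<close> we have \<open>p 2 = \<lambda> p 1\<close> with \<open>\<lambda> \<noteq> 0\<close>.\<close>

definition U1 :: "(real ^ 'n) set" where "U1 = {x \<in> U. p 1 x \<noteq> 0}"

definition rad :: "real ^ 'n \<Rightarrow> real" where "rad x = p 1 x / p 2 x"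

definition Q :: "real ^ 'n \<Rightarrow> real ^ 'n ^ 'n" where
  "Q x = rad x *\<^sub>R shape x + (\<chi> i j. \<nu> i x * \<nu> j x)"

definition ctr :: "real ^ 'n \<Rightarrow> real ^ 'n" where
  "ctr x = Q x *v (D *v x) - rad x *\<^sub>R n x"

section \<open>Curved points: radius, projection and centre\<close>

lemma open_U1: "open U1"
  using continuous_open_preimage[OF smooth_on_imp_continuous_on[OF smooth_p[of 1]] open_U, of "- {0}"]
  by (simp add: U1_def Int_def vimage_def open_Compl)

lemma U1_U: "x \<in> U1 \<Longrightarrow> x \<in> U" by (simp add: U1_def)

lemma p_2_nz: "x \<in> U1 \<Longrightarrow> p 2 x \<noteq> 0"
  using shape_eq_0[of x] by (auto simp: U1_def p_def trace_def)

lemma rad_nz: "x \<in> U1 \<Longrightarrow> rad x \<noteq> 0"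
  using p_2_nz by (simp add: rad_def U1_def)

lemma shape_square_rad: assumes x: "x \<in> U1"
  shows "shape x ** shape x = (1 / rad x) *\<^sub>R shape x" "rad x * p 3 x = p 2 x"
proof -
  obtain l where l: "shape x ** shape x = l *\<^sub>R shape x" using isoparametric_shape_square[OF U1_U[OF x]] by blast
  have l1: "p 2 x = l * p 1 x" and l2: "p 3 x = l * p 2 x" by (rule shape_square_trace[OF U1_U[OF x] l])+
  then have "l = 1 / rad x" using p_2_nz[OF x] x by (simp add: rad_def U1_def)
  then show "shape x ** shape x = (1 / rad x) *\<^sub>R shape x" using l by simp
  show "rad x * p 3 x = p 2 x" using p_2_nz[OF x] l1 l2 by (simp add: rad_def)
qed

lemma E_p_2: assumes x: "x \<in> U" shows "E k (p 2) x = - 2 * p 3 x * \<nu> k x"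
proof -
  have "trace (matrix_power (shape x) 1 ** (EM k shape x + \<nu> k x *\<^sub>R (shape x ** shape x))) = 0"
    by (rule trace_power_normal[OF _ x]) (use p1_normal in blast)
  then have "trace (matrix_power (shape x) 1 ** EM k shape x) = - (p 3 x * \<nu> k x)"
    by (simp add: matrix_add_ldistrib trace_add trace_scaleR scaleR_matrix_mult p_def numeral_eq_Suc mult.commute)
  then show ?thesis using E_p[OF x, of k 1] by (simp add: numeral_2_eq_2)
qed

lemma smooth_rad: "smooth_on U1 rad"
  unfolding rad_def[abs_def] using p_2_nz
  by (intro smooth_on_divide open_U1 smooth_on_subset[OF smooth_p]) (auto simp: U1_U)

text \<open>Differentiate \<open>p 1 = rad p 2\<close>: the gradients of \<open>p 1\<close> and
  \<open>p 2\<close> are \<open>- p 2 \<nu>\<close> and \<open>- 2 p 3 \<nu>\<close>, and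
  \<open>rad p 3 = p 2\<close>. In the frame, \<open>rad\<close> grows at unit rate along the
  normal.\<close>

lemma E_rad: assumes x: "x \<in> U1" shows "E k rad x = \<nu> k x"
proof -
  have "E k (p 1) x = E k (\<lambda>y. rad y * p 2 y) x"
    by (rule along_cong[OF open_U1 x]) (simp add: rad_def p_2_nz)
  also have "\<dots> = rad x * E k (p 2) x + E k rad x * p 2 x"
    by (intro along_mult smooth_on_imp_differentiable[OF smooth_rad x]
        smooth_on_imp_differentiable[OF smooth_p U1_U[OF x]])
  finally have "- p 2 x * \<nu> k x = - 2 * (rad x * p 3 x) * \<nu> k x + E k rad x * p 2 x"
    by (simp add: p1_normal[OF U1_U[OF x]] E_p_2[OF U1_U[OF x]] del: One_nat_def)
  then have "(E k rad x - \<nu> k x) * p 2 x = 0"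
    unfolding shape_square_rad(2)[OF x] by algebra
  then show ?thesis using p_2_nz[OF x] by simp
qed

lemma frechet_rad: assumes "x \<in> U1" shows "frechet_derivative rad (at x) u = (df x \<bullet> u) / speed x"
  using frame_tangent[OF smooth_on_imp_differentiable[OF smooth_rad assms] U1_U[OF assms], of 1 u]
  by (simp add: E_rad assms)

lemma Q_entry: "Q x $ i $ j = rad x * A i j x + \<nu> i x * \<nu> j x"
  by (simp add: Q_def shape_def)

lemma smooth_Q: "smooth_on U1 (\<lambda>x. Q x $ i $ j)"
  unfolding Q_entry
  by (intro smooth_on_add smooth_on_mult open_U1 smooth_rad smooth_on_subset[OF smooth_A]
      smooth_on_subset[OF smooth_\<nu>]) (auto simp: U1_U)

text \<open>With \<open>A\<^sup>2 = A / rad\<close>, the formula for the derivative of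
  \<open>A\<close> cancels the product-rule terms from \<open>rad\<close> and from
  \<open>\<nu> \<nu>\<^sup>T\<close>.\<close>

lemma E_Q: assumes x: "x \<in> U1" shows "E k (\<lambda>x. Q x $ i $ j) x = 0"
proof -
  note d = smooth_on_imp_differentiable[OF smooth_rad x] smooth_on_imp_differentiable[OF smooth_A U1_U[OF x]]
    smooth_on_imp_differentiable[OF smooth_\<nu> U1_U[OF x]]
  have "E k (\<lambda>x. Q x $ i $ j) x =
    (rad x * E k (A i j) x + \<nu> k x * A i j x) + (\<nu> i x * A k j x + A k i x * \<nu> j x)"
    unfolding Q_entry using d by (simp add: along_add along_mult differentiable_mult E_rad x E_\<nu>)
  moreover have "rad x * E k (A i j) x = - (\<nu> k x * A i j x + \<nu> i x * A k j x + \<nu> j x * A k i x)"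
    unfolding isoparametric_shape_derivative[OF U1_U[OF x]] shape_square_rad(1)[OF x]
    using rad_nz[OF x] by (simp add: shape_def field_simps)
  ultimately show ?thesis by simp
qed

lemma Q_symmetric: "x \<in> U1 \<Longrightarrow> transpose (Q x) = Q x"
  using A_sym[OF U1_U] by (simp add: transpose_def vec_eq_iff Q_entry mult.commute)

lemma Q_normal: assumes x: "x \<in> U1" shows "Q x *v n x = n x"
proof -
  have n: "n x = (\<chi> i. \<nu> i x)" by (simp add: \<nu>_def vec_eq_iff)
  have "(\<chi> i j. \<nu> i x * \<nu> j x) *v n x = n x"
    using unit[OF U1_U[OF x]]
    by (simp add: n matrix_vector_mult_def vec_eq_iff mult.assoc sum_distrib_left[symmetric] power2_eq_square)
  then show ?thesis
    using shape_normal[OF U1_U[OF x]]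
    by (simp add: Q_def matrix_vector_mult_add_rdistrib scaleR_matrix_vector_assoc[symmetric] n)
qed

lemma Q_idem: assumes x: "x \<in> U1" shows "Q x ** Q x = Q x"
proof -
  define P where "P = (\<chi> i j. \<nu> i x * \<nu> j x)"
  have n: "n x = (\<chi> i. \<nu> i x)" by (simp add: \<nu>_def vec_eq_iff)
  have Pv: "P *v u = (n x \<bullet> u) *\<^sub>R n x" for u
    by (simp add: P_def n matrix_vector_mult_def vec_eq_iff inner_vec_def sum_distrib_left ac_simps)
  have An: "shape x *v n x = 0" using shape_normal[OF U1_U[OF x]] by (simp add: n)
  have nA: "n x \<bullet> (shape x *v u) = 0" for u
    using symmetric_matrix_inner[OF shape_transpose[OF U1_U[OF x]], of "n x" u] An by simp
  have Qv: "Q x *v u = rad x *\<^sub>R (shape x *v u) + (n x \<bullet> u) *\<^sub>R n x" for u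
    by (simp add: Q_def P_def[symmetric] matrix_vector_mult_add_rdistrib scaleR_matrix_vector_assoc[symmetric] Pv)
  have "shape x *v (shape x *v u) = (1 / rad x) *\<^sub>R (shape x *v u)" for u
    using shape_square_rad(1)[OF x]
    by (simp add: matrix_vector_mul_assoc scaleR_matrix_vector_assoc)
  then have "Q x *v (Q x *v u) = Q x *v u" for u
    using rad_nz[OF x] norm_n[OF U1_U[OF x]]
    by (simp add: Qv matrix_vector_right_distrib matrix_vector_mult_scaleR An inner_add_right nA dot_square_norm)
  then show ?thesis by (simp add: matrix_eq matrix_vector_mul_assoc)
qed

lemma trace_Q: assumes x: "x \<in> U1" shows "trace (Q x) = rad x * p 1 x + 1"
proof -
  have "trace (\<chi> i j. \<nu> i x * \<nu> j x) = 1"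
    using unit[OF U1_U[OF x]] by (simp add: trace_def power2_eq_square)
  then show ?thesis by (simp add: Q_def trace_add trace_scaleR p_def)
qed


text \<open>Near \<open>x\<close> the surfaces lie on cylinders whose radius is \<open>rad\<close>
  while their centre drifts with the projected wind. The last clause restates that
  \<open>Q D (y - rad w) - rad n\<close> is constant.\<close>

lemma cylinder_ball:
  assumes x: "x \<in> U1"
  obtains e where "e > 0" "ball x e \<subseteq> U1"
    "\<And>y. y \<in> ball x e \<Longrightarrow> \<bar>rad y - rad x\<bar> < \<bar>rad x\<bar>"
    "\<And>y. y \<in> ball x e \<Longrightarrow> Q y = Q x"
    "\<And>y. y \<in> ball x e \<Longrightarrow> Q x *v (D *v y) - ctr x = rad y *\<^sub>R n y + (rad y - rad x) *\<^sub>R (Q x *v (D *v w))"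
proof -
  obtain e1 where e1: "e1 > 0" "ball x e1 \<subseteq> U1" using open_U1 x open_contains_ball by blast
  have "isCont rad x"
    using smooth_on_imp_continuous_on[OF smooth_rad] open_U1 x continuous_on_eq_continuous_at by blast
  then obtain e2 where e2: "e2 > 0" "\<And>y. dist y x < e2 \<Longrightarrow> \<bar>rad y - rad x\<bar> < \<bar>rad x\<bar>"
    using rad_nz[OF x] unfolding continuous_at_eps_delta dist_real_def by (metis zero_less_abs_iff)
  define e where "e = min e1 e2"
  have e: "e > 0" and B1: "ball x e \<subseteq> U1" using e1 e2 by (auto simp: e_def)
  then have B: "ball x e \<subseteq> U" using U1_U by blast
  have Qc: "Q y = Q x" if y: "y \<in> ball x e" for y
  proof -
    have "Q y $ i $ j = Q x $ i $ j" for i j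
      by (rule frame_constant[OF B _ _ y])
        (use smooth_on_imp_differentiable[OF smooth_Q] E_Q B1 in blast)+
    then show ?thesis by (simp add: vec_eq_iff)
  qed
  have rel: "Q x *v (D *v y) - ctr x = rad y *\<^sub>R n y + (rad y - rad x) *\<^sub>R (Q x *v (D *v w))"
    if y: "y \<in> ball x e" for y
  proof -
    \<comment> \<open>Subtracting \<open>rad w\<close> undoes the drift: the wind part of
      \<open>v k\<close> cancels, so \<open>E k (g i)\<close> is an entry of \<open>Q\<close>, which
      is also the derivative of \<open>rad \<nu> i\<close>.\<close>
    define g where "g i y = (Q x *v (D *v (y - rad y *\<^sub>R w))) $ i" for i y
    define h where "h i y = g i y - rad y * \<nu> i y" for i y
    have "h i y = h i x" for i
    proof (rule frame_constant[OF B _ _ y])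
      fix z assume z: "z \<in> ball x e"
      then have zU: "z \<in> U1" "z \<in> U" using B1 B by auto
      note d = smooth_on_imp_differentiable[OF smooth_rad zU(1)] smooth_on_imp_differentiable[OF smooth_\<nu> zU(2)]
      have g': "(g i has_derivative (\<lambda>u. (Q x *v (D *v (u - frechet_derivative rad (at z) u *\<^sub>R w))) $ i)) (at z)"
        unfolding g_def[abs_def] using smooth_on_imp_has_derivative[OF smooth_rad zU(1)]
        by (intro bounded_linear.has_derivative[OF bounded_linear_vec_nth]
            bounded_linear.has_derivative[OF matrix_vector_mul_bounded_linear]
            has_derivative_diff has_derivative_ident has_derivative_scaleR_left)
      then have dg: "g i differentiable (at z)" by (auto simp: differentiable_def)
      show "h i differentiable (at z)"
        unfolding h_def[abs_def] using d dg by (intro differentiable_diff differentiable_mult)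
      fix k
      have "E k (g i) z = (Q x *v (D *v (v k z - E k rad z *\<^sub>R w))) $ i"
        using along_eqI[OF g', of "v k"] by (simp add: along_def)
      also have "\<dots> = Q z $ i $ k"
        by (simp add: E_rad[OF zU(1)] v_def DC Qc[OF z] matrix_vector_mul_component inner_axis)
      finally have Eg: "E k (g i) z = Q z $ i $ k" .
      have "E k (h i) z = E k (\<lambda>y. g i y - rad y * \<nu> i y) z" by (simp add: h_def[abs_def])
      also have "\<dots> = E k (g i) z - E k (\<lambda>y. rad y * \<nu> i y) z"
        using d dg by (intro along_diff differentiable_mult)
      also have "E k (\<lambda>y. rad y * \<nu> i y) z = rad z * A k i z + \<nu> k z * \<nu> i z"
        using d by (simp add: along_mult E_rad[OF zU(1)] E_\<nu>)
      finally show "E k (h i) z = 0" using Eg A_sym[OF zU(2), of k i] by (simp add: Q_entry)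
    qed
    then have "Q x *v (D *v (y - rad y *\<^sub>R w)) - rad y *\<^sub>R n y = Q x *v (D *v (x - rad x *\<^sub>R w)) - rad x *\<^sub>R n x"
      by (simp add: vec_eq_iff h_def g_def \<nu>_def)
    then show ?thesis
      by (simp add: ctr_def matrix_vector_mult_diff_distrib matrix_vector_mult_scaleR algebra_simps)
  qed
  show thesis by (rule that[OF e B1 _ Qc rel]) (use e2 in \<open>auto simp: e_def dist_commute\<close>)
qed

text \<open>A cylinder of the family drifting with \<open>w\<close> meets the one of radius \<open>rad x\<close> only if the radii agree,
  since the drift is slower than the growth of the radius.\<close>

lemma cylinder_radius:
  assumes x: "x \<in> U1" and r: "\<bar>r - rad x\<bar> < \<bar>rad x\<bar>" and u: "norm u = 1"
    and eq: "norm (r *\<^sub>R u + (r - rad x) *\<^sub>R (Q x *v (D *v w))) = \<bar>rad x\<bar>"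
  shows "r = rad x"
proof (rule ccontr)
  assume ne: "r \<noteq> rad x"
  let ?q = "Q x *v (D *v w)"
  have q: "norm ?q < 1"
    using projection_norm_le[OF Q_symmetric[OF x] Q_idem[OF x], of "D *v w"] wind by simp
  have "\<bar>r - rad x\<bar> = \<bar>\<bar>rad x\<bar> - \<bar>r\<bar>\<bar>" using r by (auto simp: abs_if split: if_splits)
  also have "\<dots> = \<bar>norm (r *\<^sub>R u + (r - rad x) *\<^sub>R ?q) - norm (r *\<^sub>R u)\<bar>" using eq u by simp
  also have "\<dots> \<le> norm ((r - rad x) *\<^sub>R ?q)"
    using norm_triangle_ineq3[of "r *\<^sub>R u + (r - rad x) *\<^sub>R ?q" "r *\<^sub>R u"] by simp
  also have "\<dots> = \<bar>r - rad x\<bar> * norm ?q" by simp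
  also have "\<dots> < \<bar>r - rad x\<bar>" using q ne by simp
  finally show False by simp
qed

lemma Q_ctr: "x \<in> U1 \<Longrightarrow> Q x *v ctr x = ctr x"
  by (simp add: ctr_def matrix_vector_mult_diff_distrib matrix_vector_mult_scaleR Q_normal
      matrix_vector_mul_assoc[of "Q x" "Q x"] Q_idem)

text \<open>That the level set lies in the cylinder follows from the constancy of
  \<open>rad\<close>. Conversely, points of the cylinder near \<open>x\<close> have the same
  \<open>rad\<close>, but \<open>f\<close> is not known to be a function of \<open>rad\<close>; its
  value is carried along curves inside the cylinder.\<close>

lemma cylinder_level:
  assumes x: "x \<in> U1"
  shows "\<exists>e>0. ball x e \<subseteq> U1 \<and> (\<forall>y\<in>ball x e.
    (f y = f x \<longleftrightarrow> norm (Q x *v (D *v y) - ctr x) = \<bar>rad x\<bar>) \<and>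
    (f y = f x \<longrightarrow> Q y = Q x \<and> ctr y = ctr x \<and> rad y = rad x))"
proof -
  obtain e where e: "e > 0" and B: "ball x e \<subseteq> U1"
    and near: "\<And>y. y \<in> ball x e \<Longrightarrow> \<bar>rad y - rad x\<bar> < \<bar>rad x\<bar>"
    and Qc: "\<And>y. y \<in> ball x e \<Longrightarrow> Q y = Q x"
    and rel: "\<And>y. y \<in> ball x e \<Longrightarrow>
      Q x *v (D *v y) - ctr x = rad y *\<^sub>R n y + (rad y - rad x) *\<^sub>R (Q x *v (D *v w))"
    using cylinder_ball[OF x] by blast
  have BU: "y \<in> ball x e \<Longrightarrow> y \<in> U" for y using B U1_U by blast
  define V where "V y = Q x *v (D *v y) - ctr x" for y
  have V_rad: "norm (V y) = \<bar>rad x\<bar> \<longleftrightarrow> rad y = rad x" if y: "y \<in> ball x e" for y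
    using cylinder_radius[OF x near[OF y] norm_n[OF BU[OF y]]] norm_n[OF BU[OF y]]
    by (auto simp: V_def rel[OF y])
  have f_rad: "rad y = rad x" if y: "y \<in> ball x e" and fy: "f y = f x" for y
  proof -
    \<comment> \<open>\<open>Q\<close> is constant near \<open>x\<close>, so its trace
      \<open>rad p 1 + 1\<close> is too, and \<open>p 1 = H \<circ> f\<close> is constant and
      nonzero on the level.\<close>
    have "p 1 y = p 1 x" using mean_curvature[OF BU[OF y]] mean_curvature[OF U1_U[OF x]] fy by simp
    moreover have "rad y * p 1 y = rad x * p 1 x"
      using trace_Q[OF subsetD[OF B y]] trace_Q[OF x] Qc[OF y] by simp
    ultimately show ?thesis using x by (simp add: U1_def)
  qed
  have f_all: "Q y = Q x \<and> ctr y = ctr x \<and> rad y = rad x" if y: "y \<in> ball x e" and fy: "f y = f x" for y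
  proof -
    have r: "rad y = rad x" by (rule f_rad[OF y fy])
    have "Q x *v (D *v y) - ctr x = rad x *\<^sub>R n y" using rel[OF y] r by simp
    then have "ctr y = ctr x" by (simp add: ctr_def[of y] Qc[OF y] r algebra_simps)
    then show ?thesis using r Qc[OF y] by simp
  qed
  \<comment> \<open>\<open>\<pi>\<close> retracts a neighbourhood onto the cylinder; it carries segments to curves in the cylinder, along
    which \<open>rad\<close> and hence \<open>f\<close> is constant.\<close>
  define \<pi> where "\<pi> y = y + C *v ((\<bar>rad x\<bar> / norm (V y) - 1) *\<^sub>R V y)" for y
  have V_lin: "V (y + C *v u) = V y + Q x *v u" for y u
    by (simp add: V_def matrix_vector_right_distrib DC)
  have QV: "Q x *v V y = V y" for y
    by (simp add: V_def matrix_vector_mult_diff_distrib Q_ctr[OF x] matrix_vector_mul_assoc[of "Q x" "Q x"] Q_idem[OF x])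
  have V\<pi>: "V (\<pi> y) = (\<bar>rad x\<bar> / norm (V y)) *\<^sub>R V y" for y
    unfolding \<pi>_def V_lin by (simp add: matrix_vector_mult_scaleR QV algebra_simps)
  have Vx: "V x = rad x *\<^sub>R n x" by (simp add: V_def ctr_def)
  then have nVx: "norm (V x) = \<bar>rad x\<bar>" "V x \<noteq> 0"
    using norm_n[OF U1_U[OF x]] rad_nz[OF x] by auto
  have dV: "V differentiable (at y)" for y
    unfolding V_def[abs_def] differentiable_def
    by (rule exI[of _ "\<lambda>u. Q x *v (D *v u) - 0"])
      (intro has_derivative_diff has_derivative_const has_derivative_ident
        bounded_linear.has_derivative[OF matrix_vector_mul_bounded_linear])
  have contV: "continuous_on UNIV V"
    using dV by (intro continuous_at_imp_continuous_on ballI differentiable_imp_continuous_within)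
  have d\<pi>: "\<pi> differentiable (at y)" if "V y \<noteq> 0" for y
  proof -
    have "(\<lambda>y. norm (V y)) differentiable (at y)"
      by (rule differentiable_compose[OF differentiable_norm_at[OF that] dV])
    then have "(\<lambda>y. (\<bar>rad x\<bar> / norm (V y) - 1) *\<^sub>R V y) differentiable (at y)"
      using that dV by (intro differentiable_scaleR differentiable_diff differentiable_divide differentiable_const) auto
    then show ?thesis unfolding \<pi>_def[abs_def]
      by (intro differentiable_add differentiable_ident
          differentiable_compose[OF bounded_linear_imp_differentiable[OF matrix_vector_mul_bounded_linear]])
  qed
  have fix\<pi>: "\<pi> y = y" if "norm (V y) = \<bar>rad x\<bar>" for y
    using that rad_nz[OF x] by (simp add: \<pi>_def)
  have "isCont \<pi> x" using d\<pi>[OF nVx(2)] differentiable_imp_continuous_within by blast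
  then obtain e1 where e1: "e1 > 0" "\<And>y. dist y x < e1 \<Longrightarrow> dist (\<pi> y) x < e"
    using e fix\<pi>[OF nVx(1)] unfolding continuous_at_eps_delta by metis
  have "open {y. V y \<noteq> 0}"
    using contV by (intro open_Collect_neq continuous_on_const)
  then obtain e2 where e2: "e2 > 0" "ball x e2 \<subseteq> {y. V y \<noteq> 0}"
    using nVx(2) open_contains_ball by blast
  define e' where "e' = min e (min e1 e2)"
  have rad_f: "f y = f x" if y: "y \<in> ball x e'" and Vy: "norm (V y) = \<bar>rad x\<bar>" for y
  proof -
    define \<gamma> where "\<gamma> s = \<pi> (x + s *\<^sub>R (y - x))" for s
    have seg: "x + s *\<^sub>R (y - x) \<in> ball x e'" if "0 \<le> s" "s \<le> 1" for s
      by (rule segment_in_ball[OF y that])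
    have \<gamma>B: "\<gamma> s \<in> ball x e" and \<gamma>V: "V (x + s *\<^sub>R (y - x)) \<noteq> 0" if "0 \<le> s" "s \<le> 1" for s
      using seg[OF that] e1(2)[of "x + s *\<^sub>R (y - x)"] e2(2)
      by (auto simp: e'_def \<gamma>_def dist_commute subset_iff)
    have \<gamma>r: "rad (\<gamma> s) = rad x" if "0 \<le> s" "s \<le> 1" for s
      using V_rad[OF \<gamma>B[OF that]] \<gamma>V[OF that] by (simp add: \<gamma>_def V\<pi>)
    have "\<exists>\<gamma>'. (\<gamma> has_derivative \<gamma>') (at s)" if "0 \<le> s" "s \<le> 1" for s
    proof -
      have "(\<lambda>s. x + s *\<^sub>R (y - x)) differentiable (at s)"
        by (intro differentiable_add differentiable_const differentiable_scaleR differentiable_ident)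
      then have "\<gamma> differentiable (at s)" unfolding \<gamma>_def[abs_def]
        by (rule differentiable_compose[of \<pi> "\<lambda>s. x + s *\<^sub>R (y - x)", OF d\<pi>[OF \<gamma>V[OF that]]])
      then show ?thesis by (simp add: differentiable_def)
    qed
    then obtain \<gamma>' where \<gamma>': "\<And>s. 0 \<le> s \<Longrightarrow> s \<le> 1 \<Longrightarrow> (\<gamma> has_derivative \<gamma>' s) (at s)" by metis
    have comp: "((\<lambda>s. h (\<gamma> s)) has_derivative (\<lambda>t. frechet_derivative h (at (\<gamma> s)) (\<gamma>' s t))) (at s)"
      if "0 \<le> s" "s \<le> 1" "h differentiable (at (\<gamma> s))" for s and h :: "real ^ 'n \<Rightarrow> real"
      using has_derivative_compose[OF \<gamma>'[OF that(1,2)], of h "frechet_derivative h (at (\<gamma> s))"] that(3)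
      by (simp add: frechet_derivative_works)
    have "f (\<gamma> 1) = f (\<gamma> 0)"
    proof (rule DERIV_isconst_end[of 0 1 "\<lambda>s. f (\<gamma> s)"])
      show "continuous_on {0..1} (\<lambda>s. f (\<gamma> s))"
      proof (rule continuous_at_imp_continuous_on, intro ballI)
        fix s :: real assume "s \<in> {0..1}"
        then have s: "0 \<le> s" "s \<le> 1" by auto
        show "isCont (\<lambda>s. f (\<gamma> s)) s"
          using comp[OF s smooth_on_imp_differentiable[OF smooth_f_U BU[OF \<gamma>B[OF s]]]]
          by (rule has_derivative_continuous)
      qed
      fix s :: real assume s: "0 < s" "s < 1"
      then have s': "0 \<le> s" "s \<le> 1" by auto
      have zU: "\<gamma> s \<in> U1" "\<gamma> s \<in> U" using \<gamma>B[OF s'] B BU by auto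
      have "((\<lambda>s. rad x) has_derivative (\<lambda>t. frechet_derivative rad (at (\<gamma> s)) (\<gamma>' s t))) (at s)"
        by (rule has_derivative_transform_within_open[of _ _ _ _ "{0<..<1}", OF
              comp[OF s' smooth_on_imp_differentiable[OF smooth_rad zU(1)]]])
          (use s \<gamma>r in auto)
      then have "(\<lambda>t. frechet_derivative rad (at (\<gamma> s)) (\<gamma>' s t)) = (\<lambda>t. 0)"
        by (rule has_derivative_unique) simp
      \<comment> \<open>By \<open>frechet_rad\<close> the differential of \<open>rad\<close> is that
        of \<open>f\<close> divided by the positive speed.\<close>
      then have "frechet_derivative f (at (\<gamma> s)) (\<gamma>' s t) = 0" for t
        using fun_cong[of _ _ t] speed_pos[OF zU(2)] frechet_rad[OF zU(1)] df_inner[OF zU(2)] by (force simp: fun_eq_iff)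
      then show "((\<lambda>s. f (\<gamma> s)) has_real_derivative 0) (at s)"
        using comp[OF s' smooth_on_imp_differentiable[OF smooth_f_U zU(2)]]
        by (simp add: has_field_derivative_def lambda_zero)
    qed simp
    then show ?thesis using fix\<pi>[OF Vy] fix\<pi>[OF nVx(1)] by (simp add: \<gamma>_def)
  qed
  have e': "e' > 0" "ball x e' \<subseteq> ball x e" using e e1 e2 by (auto simp: e'_def)
  show ?thesis
  proof (intro exI[of _ e'] conjI ballI)
    show "ball x e' \<subseteq> U1" using e' B by blast
    fix y assume y: "y \<in> ball x e'"
    then have y': "y \<in> ball x e" using e' by blast
    show "f y = f x \<longleftrightarrow> norm (Q x *v (D *v y) - ctr x) = \<bar>rad x\<bar>"
      using rad_f[OF y] V_rad[OF y'] f_rad[OF y'] by (auto simp: V_def)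
    show "f y = f x \<longrightarrow> Q y = Q x \<and> ctr y = ctr x \<and> rad y = rad x" using f_all[OF y'] by blast
  qed (rule e')
qed

text \<open>The unit normal is \<open>w + C n\<close>. For tangent \<open>X = C u\<close> its
  derivative is \<open>C\<close> applied to \<open>A u\<close>: the constant \<open>w\<close> drops
  out, and \<open>u \<bullet> n x = 0\<close> removes the wind from the frame. As
  \<open>A\<^sup>2 = A / rad\<close>, only the eigenvalues 0 and \<open>1 / rad\<close> of
  \<open>A\<close> occur.\<close>

lemma principal_curvature_shape:
  assumes x: "x \<in> U" and pc: "principal_curvature F f x \<kappa>"
  shows "\<kappa> = 0 \<or> (x \<in> U1 \<and> \<kappa> = - 1 / rad x)"
proof -
  obtain X where X: "X \<noteq> 0" "df x \<bullet> X = 0" "- frechet_derivative (unit_normal F f) (at x) X = \<kappa> *\<^sub>R X"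
    using pc by (auto simp: principal_curvature_def df_def)
  define u where "u = D *v X"
  have XC: "X = C *v u" by (simp add: u_def CD)
  then have u0: "u \<noteq> 0" using X(1) by auto
  have "pull (df x) \<bullet> u = 0" using X(2) by (simp add: XC inner_C)
  moreover have "pull (df x) \<bullet> u = (norm (pull (df x)) *\<^sub>R n x) \<bullet> u" by (rule arg_cong[OF pull_df[OF x]])
  ultimately have un: "u \<bullet> n x = 0" using norm_pull_pos[OF x] by (simp add: inner_commute)
  have n': "(n has_derivative frechet_derivative n (at x)) (at x)"
    by (rule smooth_on_imp_has_derivative[OF smooth_n x])
  have "(unit_normal F f has_derivative (\<lambda>u. 0 + C *v frechet_derivative n (at x) u)) (at x)"
  proof (rule has_derivative_transform_within_open[OF _ open_U x])
    show "((\<lambda>y. w + C *v n y) has_derivative (\<lambda>u. 0 + C *v frechet_derivative n (at x) u)) (at x)"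
      by (intro has_derivative_add has_derivative_const n'
          bounded_linear.has_derivative[OF matrix_vector_mul_bounded_linear])
    show "w + C *v n y = unit_normal F f y" if "y \<in> U" for y
      using speed_pos[OF that] unfolding unit_normal_def F_gradient[OF that] unfolding gradient_eq[OF that] by simp
  qed
  then have un': "frechet_derivative (unit_normal F f) (at x) X = C *v frechet_derivative n (at x) X"
    by (simp add: frechet_derivative_at[symmetric])
  have comp: "frechet_derivative n (at x) X $ j = (\<Sum>k\<in>UNIV. u $ k * A k j x)" for j
  proof -
    have "(\<nu> j has_derivative (\<lambda>u. frechet_derivative n (at x) u $ j)) (at x)"
      unfolding \<nu>_def[abs_def] by (rule bounded_linear.has_derivative[OF bounded_linear_vec_nth n'])
    then have "frechet_derivative n (at x) X $ j = frechet_derivative (\<nu> j) (at x) (C *v u)"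
      by (simp add: frechet_derivative_at[symmetric] XC)
    then show ?thesis
      using E_sum_frame[OF smooth_on_imp_differentiable[OF smooth_\<nu> x], of u j] un by (simp add: E_\<nu>)
  qed
  have "frechet_derivative n (at x) X = shape x *v u"
    using A_sym[OF x] by (simp add: vec_eq_iff comp shape_def matrix_vector_mult_def mult.commute)
  then have "- (C *v (shape x *v u)) = \<kappa> *\<^sub>R X" using X(3) un' by simp
  then have "C *v (- (shape x *v u)) = C *v (\<kappa> *\<^sub>R u)"
    by (simp add: XC matrix_vector_mult_scaleR vec.neg)
  then have Au: "shape x *v u = - \<kappa> *\<^sub>R u" by (metis DC minus_equation_iff scaleR_minus_left)
  show ?thesis
  proof (cases "p 1 x = 0")
    case True
    then have "shape x = 0" using shape_eq_0[OF x] by blast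
    then show ?thesis using Au u0 by simp
  next
    case False
    then have x1: "x \<in> U1" using x by (simp add: U1_def)
    have "(shape x ** shape x) *v u = (\<kappa> * \<kappa>) *\<^sub>R u"
      by (simp add: matrix_vector_mul_assoc[symmetric] Au matrix_vector_mult_scaleR vec.neg)
    then have "(1 / rad x) *\<^sub>R (- \<kappa> *\<^sub>R u) = (\<kappa> * \<kappa>) *\<^sub>R u"
      unfolding shape_square_rad(1)[OF x1] by (simp add: scaleR_matrix_vector_assoc[symmetric] Au)
    moreover have "(\<kappa> * (- 1 / rad x - \<kappa>)) *\<^sub>R u = (1 / rad x) *\<^sub>R (- \<kappa> *\<^sub>R u) - (\<kappa> * \<kappa>) *\<^sub>R u"
      by (simp add: algebra_simps)
    ultimately have "(\<kappa> * (- 1 / rad x - \<kappa>)) *\<^sub>R u = 0" by simp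
    then have "\<kappa> * (- 1 / rad x - \<kappa>) = 0" using u0 by (simp only: scaleR_eq_0_iff simp_thms)
    then show ?thesis using x1 by auto
  qed
qed

end

subsection \<open>Global shape of the level surfaces\<close>

text \<open>A small connected neighbourhood of a point within \<open>M\<close> lies in
  \<open>L\<close>, and the component \<open>N\<close> absorbs it.\<close>

lemma component_openin_model:
  fixes N :: "'a::real_normed_vector set"
  assumes N: "N \<in> components L" and M: "locally connected M"
    and loc: "\<And>x. x \<in> N \<Longrightarrow> \<exists>e>0. \<forall>y\<in>ball x e. y \<in> L \<longleftrightarrow> y \<in> M"
  shows "openin (top_of_set M) N"
proof (subst openin_subopen, intro ballI)
  fix x assume x: "x \<in> N"
  have NL: "N \<subseteq> L" using N by (rule in_components_subset)
  obtain e where e: "e > 0" "\<And>y. y \<in> ball x e \<Longrightarrow> y \<in> L \<longleftrightarrow> y \<in> M" using loc[OF x] by blast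
  have "x \<in> M" using e(2)[of x] e(1) x NL by auto
  then obtain V where V: "openin (top_of_set M) V" "connected V" "x \<in> V" "V \<subseteq> M \<inter> ball x e"
    using M e(1) unfolding locally_connected by (meson IntI centre_in_ball open_ball openin_open_Int)
  then have "V \<subseteq> L" using e(2) by blast
  then have "V \<subseteq> N" using components_maximal[OF N V(2)] x V(3) by blast
  then show "\<exists>T. openin (top_of_set M) T \<and> x \<in> T \<and> T \<subseteq> N" using V by blast
qed

lemma closed_component_eq_model:
  assumes "openin (top_of_set M) N" "N \<noteq> {}" "connected M" "closed N"
  shows "N = M"
proof -
  have "closedin (top_of_set M) N"
    using assms(1,4) openin_imp_subset by (metis closed_subset)
  then show ?thesis using assms by (metis connected_clopen)
qed

lemma locally_constant_on_component:
  assumes N: "N \<in> components L"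
    and loc: "\<And>x. x \<in> N \<Longrightarrow> \<exists>e>0. \<forall>y\<in>N \<inter> ball x e. h y = h x"
  shows "\<exists>c. \<forall>x\<in>N. h x = c"
proof -
  have "h constant_on N"
  proof (rule locally_constant_imp_constant)
    show "connected N" using N by (rule in_components_connected)
    fix x assume x: "x \<in> N"
    then obtain e where e: "e > 0" "\<forall>y\<in>N \<inter> ball x e. h y = h x" using loc by blast
    show "\<exists>T. openin (top_of_set N) T \<and> x \<in> T \<and> (\<forall>y\<in>T. h y = h x)"
    proof (intro exI conjI)
      show "openin (top_of_set N) (N \<inter> ball x e)" by (rule openin_open_Int[OF open_ball])
      show "x \<in> N \<inter> ball x e" using e(1) x by simp
      show "\<forall>y\<in>N \<inter> ball x e. h y = h x" by (rule e(2))
    qed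
  qed
  then show ?thesis by (simp add: constant_on_def)
qed

section \<open>Ellipsoidal tubes as Minkowski hyperspheres and cylinders\<close>

lemma orth_proj_subspace:
  fixes x :: "real ^ 'n"
  assumes "subspace W"
  shows "orth_proj W x \<in> W" "\<xi> \<in> W \<Longrightarrow> \<xi> \<bullet> orth_proj W x = \<xi> \<bullet> x"
proof -
  obtain p z where pz: "p \<in> span W" "\<And>w. w \<in> span W \<Longrightarrow> orthogonal z w" "x = p + z"
    using orthogonal_subspace_decomp_exists[of W x] by metis
  have W: "span W = W" using assms by simp
  have "p \<in> W \<and> (\<forall>w\<in>W. orthogonal (x - p) w)" using pz W by simp
  moreover have "p' = p" if "p' \<in> W \<and> (\<forall>w\<in>W. orthogonal (x - p') w)" for p'
  proof -
    have "p' - p \<in> W" using that pz(1) W assms by (simp add: subspace_diff)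
    then have "(x - p') \<bullet> (p' - p) = 0" "(x - p) \<bullet> (p' - p) = 0"
      using that pz W by (auto simp: orthogonal_def)
    then have "(p' - p) \<bullet> (p' - p) = 0" by (simp add: inner_diff_left)
    then show ?thesis by simp
  qed
  ultimately have eq: "orth_proj W x = p" unfolding orth_proj_def by (rule the_equality)
  show "orth_proj W x \<in> W" using eq pz W by simp
  show "\<xi> \<bullet> orth_proj W x = \<xi> \<bullet> x" if "\<xi> \<in> W"
  proof -
    have "\<xi> \<bullet> x = \<xi> \<bullet> p + \<xi> \<bullet> z" by (subst pz(3)) (rule inner_add_right)
    moreover have "\<xi> \<bullet> z = 0" using pz(2)[of \<xi>] that W by (simp add: orthogonal_def inner_commute)
    ultimately show ?thesis by (simp add: eq)
  qed
qed

context zermelo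
begin

context
  fixes Q :: "real ^ 'n ^ 'n" and q :: "real ^ 'n" and \<rho> :: real
  assumes Q: "transpose Q = Q" "Q ** Q = Q" and q: "Q *v q = q" and \<rho>: "\<rho> > 0"
begin

definition tube :: "(real ^ 'n) set" where "tube = {y. norm (Q *v (D *v y) - q) = \<rho>}"

lemma tube_mult: "Q *v (Q *v u) = Q *v u"
  using Q(2) by (simp add: matrix_vector_mul_assoc)

text \<open>The tube is a retract of the open complement of its axis: rescaling the radial part
  \<open>V\<close> to length \<rho> is continuous there.\<close>

lemma locally_connected_tube: "locally connected tube"
proof -
  define V where "V y = Q *v (D *v y) - q" for y
  define \<pi> where "\<pi> y = y + C *v ((\<rho> / norm (V y) - 1) *\<^sub>R V y)" for y
  have contV: "continuous_on T V" for T
    unfolding V_def[abs_def]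
    by (intro continuous_on_diff continuous_on_const continuous_on_compose2[OF matrix_vector_mult_linear_continuous_on matrix_vector_mult_linear_continuous_on]) auto
  have QV: "Q *v V y = V y" for y by (simp add: V_def matrix_vector_mult_diff_distrib tube_mult q)
  have Vadd: "V (y + C *v u) = V y + Q *v u" for y u
    by (simp add: V_def matrix_vector_right_distrib DC)
  have V\<pi>: "V (\<pi> y) = (\<rho> / norm (V y)) *\<^sub>R V y" for y
    unfolding \<pi>_def Vadd by (simp add: matrix_vector_mult_scaleR QV algebra_simps)
  have op: "open {y. V y \<noteq> 0}" using contV by (intro open_Collect_neq continuous_on_const)
  have "tube retract_of {y. V y \<noteq> 0}"
    unfolding retract_of_def retraction_def
  proof (intro exI[of _ \<pi>] conjI)
    show "tube \<subseteq> {y. V y \<noteq> 0}" using \<rho> by (auto simp: tube_def V_def)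
    show "continuous_on {y. V y \<noteq> 0} \<pi>"
      unfolding \<pi>_def[abs_def]
      by (intro continuous_on_add continuous_on_id
          continuous_on_compose2[OF matrix_vector_mult_linear_continuous_on[of UNIV]]
          continuous_on_scaleR continuous_on_diff continuous_on_divide continuous_on_norm contV continuous_on_const) auto
    show "\<pi> \<in> {y. V y \<noteq> 0} \<rightarrow> tube"
      using \<rho> V\<pi> by (auto simp: tube_def V_def[symmetric])
    show "\<forall>x\<in>tube. \<pi> x = x" using \<rho> by (auto simp: tube_def V_def[symmetric] \<pi>_def)
  qed
  then show ?thesis using retract_of_locally_connected open_imp_locally_connected op by blast
qed

lemma subspace_range: "subspace (range ((*v) Q))"
  by (rule linear_subspace_image) auto

text \<open>A punctured subspace of dimension at least 2 is connected, and the tube is a continuous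
  image of its product with the whole space: \<open>fst z\<close> gives the radial direction,
  \<open>snd z\<close> the position along the axis.\<close>

lemma connected_tube:
  assumes dim: "dim (range ((*v) Q)) \<ge> 2"
  shows "connected tube"
proof -
  let ?W = "range ((*v) Q)"
  define \<Phi> where "\<Phi> z = C *v (q + (\<rho> / norm (fst z)) *\<^sub>R fst z + (D *v snd z - Q *v (D *v snd z)))" for z
  have Wu: "Q *v u = u" if "u \<in> ?W" for u using that by (auto simp: tube_mult)
  have "connected (?W - {0})"
    using dim subspace_range by (intro connected_punctured_convex subspace_imp_convex) (auto simp: aff_dim_subspace)
  then have "connected ((?W - {0}) \<times> (UNIV :: (real ^ 'n) set))" by (intro connected_Times connected_UNIV)
  moreover have "continuous_on ((?W - {0}) \<times> UNIV) \<Phi>"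
    unfolding \<Phi>_def[abs_def]
    by (intro continuous_on_compose2[OF matrix_vector_mult_linear_continuous_on[of UNIV]]
        continuous_on_add continuous_on_diff continuous_on_const continuous_on_scaleR continuous_on_divide
        continuous_on_norm continuous_on_fst continuous_on_snd continuous_on_id) auto
  ultimately have "connected (\<Phi> ` ((?W - {0}) \<times> UNIV))" by (rule connected_continuous_image[rotated])
  moreover have "\<Phi> ` ((?W - {0}) \<times> UNIV) = tube"
  proof (intro equalityI subsetI)
    fix y assume "y \<in> \<Phi> ` ((?W - {0}) \<times> UNIV)"
    then obtain u z where u: "u \<in> ?W" "u \<noteq> 0" "y = \<Phi> (u, z)" by auto
    have "Q *v (D *v y) - q = (\<rho> / norm u) *\<^sub>R u"
      by (simp add: u(3) \<Phi>_def DC matrix_vector_right_distrib matrix_vector_mult_diff_distrib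
          matrix_vector_mult_scaleR tube_mult q Wu[OF u(1)])
    then show "y \<in> tube" using u(2) \<rho> by (simp add: tube_def)
  next
    fix y assume y: "y \<in> tube"
    define u where "u = Q *v (D *v y) - q"
    have nu: "norm u = \<rho>" using y by (simp add: tube_def u_def)
    have "u = Q *v (D *v y - q)" by (simp add: u_def matrix_vector_mult_diff_distrib q)
    then have "u \<in> ?W" by blast
    moreover have "\<Phi> (u, y) = C *v (D *v y)" using nu \<rho> by (simp add: \<Phi>_def u_def)
    then have "y = \<Phi> (u, y)" by (simp add: CD)
    ultimately show "y \<in> \<Phi> ` ((?W - {0}) \<times> UNIV)" using nu \<rho> by (intro image_eqI[where x = "(u, y)"]) auto
  qed
  ultimately show ?thesis by simp
qed

lemma tube_minkowski_hypersphere: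
  assumes "range ((*v) Q) = UNIV"
  shows "is_minkowski_hypersphere F tube"
proof -
  have Qu: "Q *v u = u" for u
  proof -
    obtain v where "u = Q *v v" using assms by (metis UNIV_I imageE)
    then show ?thesis by (simp add: tube_mult)
  qed
  \<comment> \<open>The ellipsoid \<open>F (y - x0) = \<rho>\<close> is centred at
    \<open>x0 + \<rho> w\<close>, so the wind has to be subtracted from the centre
    \<open>C q\<close>.\<close>
  have "norm (Q *v (D *v y) - q) = \<rho> \<longleftrightarrow> F (y - (C *v q - \<rho> *\<^sub>R w)) = \<rho>" for y
    unfolding level[OF \<rho>] by (simp add: Qu matrix_vector_mult_diff_distrib DC)
  then show ?thesis unfolding is_minkowski_hypersphere_def tube_def using \<rho> by blast
qed

text \<open>The quotient differs from \<rho> by \<open>u \<bullet> V - \<rho> * norm u\<close> over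
  a denominator comparable to \<open>norm u\<close>. So the supremum is \<rho> exactly if that of
  \<open>u \<bullet> V / norm u\<close> is, and the latter is \<open>norm V\<close> because
  \<open>V\<close> lies in \<open>W\<close>.\<close>

lemma restricted_dual_level:
  fixes W :: "(real ^ 'n) set" and V p :: "real ^ 'n"
  assumes V: "V \<in> W" and ne: "W - {0} \<noteq> {}" and p: "norm p < 1"
  shows "(SUP u\<in>W - {0}. (u \<bullet> (V + \<rho> *\<^sub>R p)) / (norm u + u \<bullet> p)) = \<rho> \<longleftrightarrow> norm V = \<rho>"
proof -
  define k where "k u = (u \<bullet> (V + \<rho> *\<^sub>R p)) / (norm u + u \<bullet> p)" for u
  have up: "\<bar>u \<bullet> p\<bar> \<le> norm u * norm p" for u by (rule Cauchy_Schwarz_ineq2)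
  have den: "norm u + u \<bullet> p > 0" "norm u + u \<bullet> p \<le> 2 * norm u" if "u \<noteq> 0" for u
  proof -
    have "norm u * norm p < norm u" using that p by simp
    then show "norm u + u \<bullet> p > 0" "norm u + u \<bullet> p \<le> 2 * norm u" using up[of u] by auto
  qed
  have k: "k u = \<rho> + (u \<bullet> V - \<rho> * norm u) / (norm u + u \<bullet> p)" if "u \<noteq> 0" for u
    using den(1)[OF that] by (simp add: k_def inner_add_right field_simps)
  have "(SUP u\<in>W - {0}. k u) = \<rho> \<longleftrightarrow> norm V = \<rho>"
  proof
    assume nV: "norm V = \<rho>"
    show "(SUP u\<in>W - {0}. k u) = \<rho>"
    proof (rule cSup_eq_maximum)
      have V0: "V \<noteq> 0" using nV \<rho> by auto
      have "k V = \<rho>" using k[OF V0] nV by (simp add: dot_square_norm power2_eq_square)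
      then show "\<rho> \<in> k ` (W - {0})" using V V0 by (metis Diff_iff imageI singletonD)
      fix z assume "z \<in> k ` (W - {0})"
      then obtain u where u: "u \<noteq> 0" "z = k u" by auto
      have "u \<bullet> V \<le> norm u * norm V" by (rule norm_cauchy_schwarz)
      then have "(u \<bullet> V - \<rho> * norm u) / (norm u + u \<bullet> p) \<le> 0"
        using den(1)[OF u(1)] nV by (intro divide_nonpos_pos) (auto simp: mult.commute)
      then show "z \<le> \<rho>" using k[OF u(1)] u(2) by simp
    qed
  next
    assume S: "(SUP u\<in>W - {0}. k u) = \<rho>"
    have bound: "k u \<le> \<rho> + (norm V - \<rho>) * (norm u / (norm u + u \<bullet> p))" if "u \<noteq> 0" for u
    proof -
      have "u \<bullet> V - \<rho> * norm u \<le> (norm V - \<rho>) * norm u"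
        using norm_cauchy_schwarz[of u V] by (simp add: algebra_simps)
      then have "(u \<bullet> V - \<rho> * norm u) / (norm u + u \<bullet> p) \<le> (norm V - \<rho>) * norm u / (norm u + u \<bullet> p)"
        using den(1)[OF that] by (intro divide_right_mono) auto
      then show ?thesis using k[OF that] by simp
    qed
    \<comment> \<open>Without this bound the value of the supremum would say nothing about the
      single quotients.\<close>
    have "bdd_above (k ` (W - {0}))"
    proof (rule bdd_aboveI2)
      fix u assume u: "u \<in> W - {0}"
      then have u0: "norm u > 0" by simp
      have "norm u * (1 - norm p) \<le> norm u + u \<bullet> p" using up[of u] by (simp add: algebra_simps)
      then have "norm u / (norm u + u \<bullet> p) \<le> 1 / (1 - norm p)"
        using den(1)[of u] u p by (simp add: field_simps)
      moreover have "(norm V - \<rho>) * (norm u / (norm u + u \<bullet> p)) \<le> \<bar>norm V - \<rho>\<bar> * (norm u / (norm u + u \<bullet> p))"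
        using den(1)[of u] u by (intro mult_right_mono) auto
      ultimately have "(norm V - \<rho>) * (norm u / (norm u + u \<bullet> p)) \<le> \<bar>norm V - \<rho>\<bar> * (1 / (1 - norm p))"
        by (meson abs_ge_zero mult_left_mono order_trans)
      then show "k u \<le> \<rho> + \<bar>norm V - \<rho>\<bar> * (1 / (1 - norm p))" using bound[of u] u by auto
    qed
    then have le: "k u \<le> \<rho>" if "u \<in> W - {0}" for u using cSUP_upper[OF that] S by metis
    have "norm V \<le> \<rho>"
    proof (cases "V = 0")
      case False
      have "(V \<bullet> V - \<rho> * norm V) / (norm V + V \<bullet> p) \<le> 0" using le[of V] k[OF False] V False by simp
      then have "norm V * (norm V - \<rho>) \<le> 0"
        using den(1)[OF False] by (simp add: divide_le_0_iff dot_square_norm power2_eq_square algebra_simps)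
      then show ?thesis using False by (simp add: mult_le_0_iff)
    qed (use \<rho> in auto)
    \<comment> \<open>The denominator is at most \<open>2 * norm u\<close>, so every quotient stays
      below \<rho> by a fixed amount.\<close>
    moreover have "\<not> norm V < \<rho>"
    proof
      assume lt: "norm V < \<rho>"
      have "k u \<le> \<rho> - (\<rho> - norm V) / 2" if "u \<in> W - {0}" for u
      proof -
        have "1 / 2 \<le> norm u / (norm u + u \<bullet> p)" using den[of u] that by (simp add: field_simps)
        then have "(norm V - \<rho>) * (norm u / (norm u + u \<bullet> p)) \<le> (norm V - \<rho>) * (1 / 2)"
          using lt by (intro mult_left_mono_neg) auto
        moreover have "k u \<le> \<rho> + (norm V - \<rho>) * (norm u / (norm u + u \<bullet> p))"
          using bound[of u] that by blast
        ultimately have "k u \<le> \<rho> + (norm V - \<rho>) * (1 / 2)" by (meson add_left_mono order_trans)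
        then show ?thesis by (simp add: field_simps)
      qed
      then have "(SUP u\<in>W - {0}. k u) \<le> \<rho> - (\<rho> - norm V) / 2" using ne by (intro cSUP_least) auto
      then show False using S lt by simp
    qed
    ultimately show "norm V = \<rho>" by simp
  qed
  then show ?thesis by (simp add: k_def[abs_def])
qed

text \<open>Covectors of \<open>W\<close> have the form \<open>transpose D *v u\<close> with
  \<open>u\<close> in the range of \<open>Q\<close>. On these the dual metric is
  \<open>norm u + u \<bullet> (D *v w)\<close>, and \<open>u\<close> sees only the projected wind,
  so the supremum is the one in \<open>restricted_dual_level\<close>.\<close>

lemma tube_dual_minkowski_cylinder:
  assumes dim: "dim (range ((*v) Q)) \<ge> 2" and ne: "range ((*v) Q) \<noteq> UNIV"
  shows "is_dual_minkowski_cylinder F tube"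
proof -
  let ?W = "range ((*v) Q)" and ?T = "(*v) (transpose D)"
  define W where "W = ?T ` ?W"
  have inj: "inj ?T" by (rule inj_on_inverseI[where g = pull]) (rule pull_transpose)
  have Wu: "Q *v u = u" if "u \<in> ?W" for u using that by (auto simp: tube_mult)
  have sub: "subspace W" unfolding W_def by (intro linear_subspace_image subspace_range) auto
  have dW: "dim W = dim ?W" unfolding W_def
    by (rule dim_image_eq) (use inj in \<open>auto intro: inj_on_subset\<close>)
  have "dim ?W < CARD('n)"
  proof -
    have "dim ?W \<noteq> DIM(real ^ 'n)" using ne subspace_range dim_eq_full[of ?W] by (metis span_eq_iff)
    moreover have "dim ?W \<le> DIM(real ^ 'n)" by (rule dim_subset_UNIV)
    ultimately show ?thesis by simp
  qed
  \<comment> \<open>The centre is shifted against the wind as for a hypersphere. Projecting it puts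
    it into \<open>W\<close> and is invisible to covectors from \<open>W\<close>.\<close>
  define x0 where "x0 = orth_proj W (C *v q - \<rho> *\<^sub>R w)"
  define p where "p = Q *v (D *v w)"
  have p: "norm p < 1" unfolding p_def using projection_norm_le[OF Q, of "D *v w"] wind by simp
  have W0: "?W - {0} \<noteq> {}"
  proof
    assume "?W - {0} = {}"
    then have "?W \<subseteq> {0}" by blast
    then have "dim ?W = 0" by (simp only: dim_eq_0)
    then show False using dim by linarith
  qed
  have eq: "dual_of_restricted_dual F W (orth_proj W x - x0) = \<rho> \<longleftrightarrow> norm (Q *v (D *v x) - q) = \<rho>" for x
  proof -
    define V where "V = Q *v (D *v x) - q"
    have "V = Q *v (D *v x - q)" by (simp add: V_def matrix_vector_mult_diff_distrib q)
    then have V: "V \<in> ?W" by blast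
    have img: "W - {0} = ?T ` (?W - {0})"
    proof -
      have "?T ` (?W - {0}) = ?T ` ?W - ?T ` {0}" by (rule image_set_diff[OF inj])
      then show ?thesis by (simp add: W_def)
    qed
    have "(?T u \<bullet> (orth_proj W x - x0)) / dual_metric F (?T u) = (u \<bullet> (V + \<rho> *\<^sub>R p)) / (norm u + u \<bullet> p)"
      if u: "u \<in> ?W - {0}" for u
    proof -
      have Tu: "?T u \<in> W" using u by (auto simp: W_def)
      have T: "?T u \<bullet> y = u \<bullet> (D *v y)" for y using inner_pull[of "?T u" y] by (simp only: pull_transpose)
      have uQ: "u \<bullet> (Q *v y) = u \<bullet> y" for y
        using symmetric_matrix_inner[OF Q(1), of u y] Wu[of u] u by simp
      have "?T u \<bullet> (orth_proj W x - x0) = ?T u \<bullet> x - ?T u \<bullet> (C *v q - \<rho> *\<^sub>R w)"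
        by (simp only: x0_def inner_diff_right[of _ "orth_proj W _"] orth_proj_subspace(2)[OF sub Tu])
      also have "\<dots> = u \<bullet> (D *v x) - u \<bullet> q + \<rho> * (u \<bullet> (D *v w))"
        unfolding T by (simp add: matrix_vector_mult_diff_distrib matrix_vector_mult_scaleR DC inner_diff_right)
      also have "\<dots> = u \<bullet> (V + \<rho> *\<^sub>R p)" by (simp add: V_def p_def inner_add_right inner_diff_right uQ)
      finally have 1: "?T u \<bullet> (orth_proj W x - x0) = u \<bullet> (V + \<rho> *\<^sub>R p)" .
      have "?T u \<noteq> 0" using u pull_transpose[of u] by (metis Diff_iff insertI1 pull_eq_0_iff)
      then have "dual_metric F (?T u) = norm u + u \<bullet> (D *v w)"
        by (rule dual_metric_eq[unfolded dual_eq, of "?T u", unfolded pull_transpose])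
      then show ?thesis using 1 by (simp only: p_def uQ)
    qed
    then have "dual_of_restricted_dual F W (orth_proj W x - x0) =
        (SUP u\<in>?W - {0}. (u \<bullet> (V + \<rho> *\<^sub>R p)) / (norm u + u \<bullet> p))"
      unfolding dual_of_restricted_dual_def img image_image by (intro SUP_cong refl)
    then show ?thesis using restricted_dual_level[OF V W0 p] by (simp add: V_def)
  qed
  show ?thesis
    unfolding is_dual_minkowski_cylinder_def
  proof (intro exI conjI)
    show "tube = {x. dual_of_restricted_dual F W (orth_proj W x - x0) = \<rho>}"
      unfolding tube_def eq ..
  qed (use sub dim dW \<open>dim ?W < CARD('n)\<close> \<rho> orth_proj_subspace(1)[OF sub] in \<open>auto simp: x0_def\<close>)
qed

end

end

section \<open>Components of a level set\<close>

context isoparametric_zermelo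
begin

context
  fixes t N
  assumes N: "N \<in> components (f -` {t} \<inter> U)"
begin

lemma N_point: "x \<in> N \<Longrightarrow> x \<in> U" "x \<in> N \<Longrightarrow> f x = t"
  using in_components_subset[OF N] by auto

lemma N_mean_curvature: "x \<in> N \<Longrightarrow> p 1 x = H t"
  using mean_curvature N_point by blast

lemma flat_component:
  assumes H0: "H t = 0"
  shows "\<exists>M. is_hyperplane M \<and> openin (top_of_set M) N \<and> (closed N \<longrightarrow> N = M)"
proof -
  have flat: "shape x = 0" if "x \<in> N" for x
    by (intro shape_eq_0 N_point(1) that disjI1) (simp only: N_mean_curvature[OF that] H0)
  define \<eta> where "\<eta> x = transpose D *v n x" for x
  note level = flat_level[OF N_point(1) flat, folded \<eta>_def]
  have "\<exists>c. \<forall>x\<in>N. (n x, \<eta> x \<bullet> x) = c"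
  proof (rule locally_constant_on_component[OF N])
    fix x assume x: "x \<in> N"
    obtain e where e: "e > 0" "\<forall>y\<in>ball x e. (f y = f x \<longleftrightarrow> \<eta> x \<bullet> y = \<eta> x \<bullet> x) \<and> n y = n x"
      using level[OF x x] by blast
    have "(n y, \<eta> y \<bullet> y) = (n x, \<eta> x \<bullet> x)" if y: "y \<in> N \<inter> ball x e" for y
      using bspec[OF e(2), of y] y N_point(2)[of y] N_point(2)[OF x] by (simp add: \<eta>_def)
    then show "\<exists>e>0. \<forall>y\<in>N \<inter> ball x e. (n y, \<eta> y \<bullet> y) = (n x, \<eta> x \<bullet> x)" using e(1) by blast
  qed
  then obtain n0 k where const: "\<And>x. x \<in> N \<Longrightarrow> n x = n0 \<and> \<eta> x \<bullet> x = k" by auto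
  define c where "c = transpose D *v n0"
  define M where "M = {x. c \<bullet> x = k}"
  obtain x0 where x0: "x0 \<in> N" using in_components_nonempty[OF N] by blast
  have "norm n0 = 1" using norm_n[OF N_point(1)[OF x0]] const[OF x0] by simp
  then have "c \<noteq> 0" using pull_transpose[of n0] by (auto simp: c_def pull_def)
  then have "is_hyperplane M" by (auto simp: is_hyperplane_def M_def)
  moreover have cM: "convex M" by (simp add: M_def convex_hyperplane)
  have op: "openin (top_of_set M) N"
  proof (rule component_openin_model[OF N convex_imp_locally_connected[OF cM]])
    fix x assume x: "x \<in> N"
    obtain e where e: "e > 0" "ball x e \<subseteq> U" "\<forall>y\<in>ball x e. (f y = f x \<longleftrightarrow> \<eta> x \<bullet> y = \<eta> x \<bullet> x)"
      using level[OF x x] by blast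
    then show "\<exists>e>0. \<forall>y\<in>ball x e. y \<in> f -` {t} \<inter> U \<longleftrightarrow> y \<in> M"
      using const[OF x] N_point(2)[OF x] by (intro exI[of _ e]) (auto simp: M_def c_def \<eta>_def)
  qed
  moreover have "closed N \<longrightarrow> N = M"
    using closed_component_eq_model[OF op in_components_nonempty[OF N] convex_connected[OF cM]] by blast
  ultimately show ?thesis by blast
qed

lemma curved_component:
  assumes H0: "H t \<noteq> 0"
  shows "(\<exists>r. \<forall>x\<in>N. x \<in> U1 \<and> rad x = r) \<and>
    (\<exists>M. (is_minkowski_hypersphere F M \<or> is_dual_minkowski_cylinder F M) \<and>
      openin (top_of_set M) N \<and> (closed N \<longrightarrow> N = M))"
proof -
  have U1: "x \<in> U1" if "x \<in> N" for x
    using N_mean_curvature[OF that] N_point(1)[OF that] H0 by (simp add: U1_def)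
  have "\<exists>c. \<forall>x\<in>N. (Q x, ctr x, rad x) = c"
  proof (rule locally_constant_on_component[OF N])
    fix x assume x: "x \<in> N"
    obtain e where e: "e > 0" "\<forall>y\<in>ball x e. f y = f x \<longrightarrow> Q y = Q x \<and> ctr y = ctr x \<and> rad y = rad x"
      using cylinder_level[OF U1[OF x]] by blast
    have "(Q y, ctr y, rad y) = (Q x, ctr x, rad x)" if y: "y \<in> N \<inter> ball x e" for y
      using bspec[OF e(2), of y] y N_point(2)[of y] N_point(2)[OF x] by simp
    then show "\<exists>e>0. \<forall>y\<in>N \<inter> ball x e. (Q y, ctr y, rad y) = (Q x, ctr x, rad x)" using e(1) by blast
  qed
  then obtain Q0 q r where const: "\<And>x. x \<in> N \<Longrightarrow> Q x = Q0 \<and> ctr x = q \<and> rad x = r" by auto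
  obtain x0 where x0: "x0 \<in> N" using in_components_nonempty[OF N] by blast
  have x1: "x0 \<in> U1" by (rule U1[OF x0])
  have Q0: "transpose Q0 = Q0" "Q0 ** Q0 = Q0" "Q0 *v q = q" and r: "\<bar>r\<bar> > 0"
    using Q_symmetric[OF x1] Q_idem[OF x1] Q_ctr[OF x1] rad_nz[OF x1] const[OF x0] by auto
  let ?M = "{y. norm (Q0 *v (D *v y) - q) = \<bar>r\<bar>}"
  note tube = tube_def[OF Q0 r]
  have op: "openin (top_of_set ?M) N"
  proof (rule component_openin_model[OF N locally_connected_tube[OF Q0 r, unfolded tube]])
    fix x assume x: "x \<in> N"
    obtain e where e: "e > 0" "ball x e \<subseteq> U1"
      "\<forall>y\<in>ball x e. f y = f x \<longleftrightarrow> norm (Q x *v (D *v y) - ctr x) = \<bar>rad x\<bar>"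
      using cylinder_level[OF U1[OF x]] by blast
    then show "\<exists>e>0. \<forall>y\<in>ball x e. y \<in> f -` {t} \<inter> U \<longleftrightarrow> y \<in> ?M"
      using const[OF x] N_point(2)[OF x] U1_U by (intro exI[of _ e]) auto
  qed
  \<comment> \<open>The range of the projection contains the normal and, orthogonal to it, some
    nonzero \<open>A u\<close>. Dimension 2 is what a cylinder requires, and it makes the tube
    connected.\<close>
  have dim: "dim (range ((*v) Q0)) \<ge> 2"
  proof -
    have "shape x0 \<noteq> 0" using x1 by (auto simp: U1_def p_def trace_def)
    then obtain u where u: "shape x0 *v u \<noteq> 0" by (metis matrix_eq matrix_vector_mult_0)
    let ?s = "shape x0 *v u"
    have nn: "n x0 = (\<chi> i. \<nu> i x0)" by (simp add: \<nu>_def vec_eq_iff)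
    have ns: "n x0 \<bullet> ?s = 0"
      using symmetric_matrix_inner[OF shape_transpose[OF U1_U[OF x1]], of "n x0" u] shape_normal[OF U1_U[OF x1]]
      by (simp add: nn)
    have "(\<chi> i j. \<nu> i x0 * \<nu> j x0) *v ?s = (n x0 \<bullet> ?s) *\<^sub>R n x0"
      by (simp add: nn matrix_vector_mult_def[of "\<chi> i j. \<nu> i x0 * \<nu> j x0"] vec_eq_iff inner_vec_def sum_distrib_left ac_simps)
    moreover have "rad x0 *\<^sub>R (shape x0 *v ?s) = ?s"
      using shape_square_rad(1)[OF x1] rad_nz[OF x1]
      by (simp add: matrix_vector_mul_assoc scaleR_matrix_vector_assoc)
    ultimately have "Q x0 *v ?s = ?s"
      by (simp add: Q_def matrix_vector_mult_add_rdistrib scaleR_matrix_vector_assoc[symmetric] ns)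
    then have "{n x0, ?s} \<subseteq> range ((*v) Q0)"
      using Q_normal[OF x1] const[OF x0] by (metis empty_subsetI insert_subset rangeI)
    moreover have n0: "n x0 \<noteq> 0" using norm_n[OF U1_U[OF x1]] by auto
    have "independent {n x0, ?s}"
      by (rule pairwise_orthogonal_independent)
        (use ns n0 u in \<open>auto simp: pairwise_insert orthogonal_def inner_commute\<close>)
    moreover have "n x0 \<noteq> ?s" using ns n0 by auto
    then have "card {n x0, ?s} = 2" by simp
    ultimately show ?thesis using independent_card_le_dim by metis
  qed
  have "is_minkowski_hypersphere F ?M \<or> is_dual_minkowski_cylinder F ?M"
    using tube_minkowski_hypersphere[OF Q0 r] tube_dual_minkowski_cylinder[OF Q0 r dim] unfolding tube by blast
  moreover have "closed N \<longrightarrow> N = ?M"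
    using closed_component_eq_model[OF op in_components_nonempty[OF N]] connected_tube[OF Q0 r dim, unfolded tube] by blast
  ultimately have "\<exists>M. (is_minkowski_hypersphere F M \<or> is_dual_minkowski_cylinder F M) \<and>
      openin (top_of_set M) N \<and> (closed N \<longrightarrow> N = M)"
    using op by (intro exI[of _ ?M] conjI)
  moreover have "x \<in> U1 \<and> rad x = r" if "x \<in> N" for x using U1[OF that] const[OF that] by simp
  ultimately show ?thesis by blast
qed

text \<open>The value \<open>H t\<close> decides between flat and curved. Ellipsoids and the
  cylinders over them are centrally symmetric, so the sign of \<open>rad\<close> does not affect the
  model and the forward types describe every curved component.\<close>

theorem component_classification:
  "finite {\<kappa>. \<exists>x\<in>N. principal_curvature F f x \<kappa>} \<and>
   card {\<kappa>. \<exists>x\<in>N. principal_curvature F f x \<kappa>} \<le> 2 \<and>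
   (\<exists>M. (is_hyperplane M \<or> is_minkowski_hypersphere F M \<or> is_dual_minkowski_cylinder F M) \<and>
      openin (top_of_set M) N \<and> (closed N \<longrightarrow> N = M))"
proof -
  have two: "finite K \<and> card K \<le> 2" if "K \<subseteq> {0, k}" for K and k :: real
    using that card_mono[of "{0, k}" K] card_insert_le_m1[of 2 "{k}" 0] by (auto intro: finite_subset)
  let ?K = "{\<kappa>. \<exists>x\<in>N. principal_curvature F f x \<kappa>}"
  show ?thesis
  proof (cases "H t = 0")
    case True
    have "?K \<subseteq> {0, 0}"
      using principal_curvature_shape N_point(1) N_mean_curvature True by (fastforce simp: U1_def)
    from two[OF this] flat_component[OF True] show ?thesis by blast
  next
    case False
    obtain r where r: "\<forall>x\<in>N. rad x = r" using curved_component[OF False] by blast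
    have "?K \<subseteq> {0, - 1 / r}" using principal_curvature_shape N_point(1) r by fastforce
    from two[OF this] curved_component[OF False] show ?thesis by blast
  qed
qed

end

end

theorem theorem1p3:
  fixes a :: "real ^ 'n ^ 'n" and b :: "real ^ 'n::finite"
    and F f :: "real ^ 'n \<Rightarrow> real" and \<sigma> :: real and S N :: "(real ^ 'n) set"
  assumes "randers_minkowski a b" and "F = randers_norm a b"
    and "\<sigma> = busemann_hausdorff F \<or> \<sigma> = holmes_thompson F"
    and "isoparametric_hypersurface F \<sigma> f S N"
  shows "finite {\<kappa>. \<exists>x\<in>N. principal_curvature F f x \<kappa>} \<and>
         card {\<kappa>. \<exists>x\<in>N. principal_curvature F f x \<kappa>} \<le> 2 \<and>
         (\<exists>M. (is_hyperplane M \<or>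
               is_minkowski_hypersphere F M \<or> is_reverse_minkowski_hypersphere F M \<or>
               is_dual_minkowski_cylinder F M \<or> is_reverse_dual_minkowski_cylinder F M) \<and>
              openin (top_of_set M) N \<and> (closed N \<longrightarrow> N = M))"
proof -
  obtain D w where Dw: "zermelo F D w" using zermelo_randers[OF assms(1)] assms(2) by blast
  \<comment> \<open>A constant density cancels in the divergence as soon as it is nonzero, so both
    volume forms lead to the same equation.\<close>
  have \<sigma>: "\<sigma> \<noteq> 0"
    using assms(2,3) busemann_hausdorff_pos[OF assms(1)] holmes_thompson_pos[OF assms(1)] by auto
  obtain c d t where iso: "closed S" "smooth_on (- S) f" "smooth_on (f ` regular_set f S) c"
    "\<And>x. x \<in> regular_set f S \<Longrightarrow> F (gradient F f x) = c (f x) \<and> laplacian F \<sigma> f x = d (f x)"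
    and N: "N \<in> components (f -` {t} \<inter> regular_set f S)"
    using assms(4) unfolding isoparametric_hypersurface_def isoparametric_def by blast
  interpret isoparametric_zermelo F D w f S \<sigma> c d
    using Dw \<sigma> iso by (intro isoparametric_zermelo.intro isoparametric_zermelo_axioms.intro) auto
  show ?thesis using component_classification[of N t] N unfolding U_def by blast
qed

end
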